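(* For $k\in\mathbb{N}$ and $n\in\mathbb{Z}$ let $$\lambda_n^{(k)}=\begin{cases}1+\frac{n}{2^k}, & 0\le n\le 2^{k-1},\\ 2-\frac{n}{2^k}, & 2^{k-1}\le n\le 2^{k},\\ 1,&\text{otherwise},\end{cases}$$ and let $P^{(k)}=\prod_{n\in\mathbb{Z}}P_n^{(k)}$ be the product measure on $X=\{0,1\}^{\mathbb{Z}}$ with $P_n^{(k)}(1)=1-P_n^{(k)}(0)=\frac{\lambda_n^{(k)}}{1+\lambda_n^{(k)}}$. Let $T$ be the full shift on $X$ and $T_{(k)}^{l'}=\frac{dP^{(k)}\circ T^{l}}{dP^{(k)}}$. Let $m_0=0$ and, inductively for $t=1,2,\dots$, given $m_{t-1}$, choose $k_t\in\mathbb{N}$ such that $$P^{(k_t)}\left(\inf_{0\le l\le m_{t-1}}T_{(k_t)}^{l'}(w)\ge e^{-2^{-t}}\right)\ge 1-2^{-t},$$ and set $n_t=m_{t-1}+2^{k_t}$ and $m_t=n_t+2^{n_t}$. Let $\mathrm{P}=\prod_{j\in\mathbb{Z}}\mathrm{P}_j$ be the product measure on $X$ with $$\mathrm{P}_j(1)=1-\mathrm{P}_j(0)=\begin{cases}\frac12,& j<0,\\ P^{(k_t)}_{j-m_{t-1}}(1),& m_{t-1}\le j<n_t,\ t\ge1,\\ \frac12,& n_t\le j<m_t,\ t\ge 1.\end{cases}$$ Then the shift $(X,\mathcal{B},\mathrm{P},T)$ is conservative, ergodic and of type ${\rm III}_1$.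
   Context: $\mathbb{N}=\{1,2,\dots\}$, $\mathcal{B}$ is the Borel $\sigma$-algebra of $X$, and the full shift is $(Tw)_k=w_{k+1}$. (Suitable $k_t$ exist at each step; $T^{0'}_{(k)}\equiv1$.) An invertible measurable transformation $T$ of a standard probability space $(X,\mathcal{B},\mu)$ is non singular if $\mu$ and $\mu\circ T^{-1}$ have the same null sets; then $T^{n'}:=\frac{d\mu\circ T^n}{d\mu}$ and $T'=T^{1'}$. All set equalities are modulo null sets. A set $A\in\mathcal{B}$ is wandering if the sets $\{T^{-n}A\}_{n\ge1}$ are pairwise disjoint; a non singular $T$ is conservative if every wandering set is null. $T$ is ergodic if $T^{-1}A=A$ implies $A\in\{\emptyset,X\}$. $T$ is of type ${\rm III}_1$ if $T$ is ergodic and its Maharam extension $\tilde{T}(x,y)=(Tx,\,y+\log T'(x))$, acting on $(X\times\mathbb{R},\mathcal{B}\otimes\mathcal{B}_{\mathbb{R}},\mu\otimes e^{-s}ds)$, is ergodic. *)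

theory Defs
  imports "HOL-Probability.Probability"
begin

definition null_eq :: "'a measure \<Rightarrow> 'a set \<Rightarrow> 'a set \<Rightarrow> bool" where
  "null_eq M A B \<longleftrightarrow> sym_diff A B \<in> null_sets M"

definition invertible_measurable :: "'a measure \<Rightarrow> ('a \<Rightarrow> 'a) \<Rightarrow> bool" where
  "invertible_measurable M T \<longleftrightarrow>
     bij_betw T (space M) (space M) \<and> T \<in> M \<rightarrow>\<^sub>M M \<and> inv_into (space M) T \<in> M \<rightarrow>\<^sub>M M"

definition nonsingular :: "'a measure \<Rightarrow> ('a \<Rightarrow> 'a) \<Rightarrow> bool" where
  "nonsingular M T \<longleftrightarrow>
     invertible_measurable M T \<and> null_sets (distr M M T) = null_sets M"

text \<open>
  The measure \<open>A \<mapsto> \<mu> (T\<^sup>l A)\<close> is the push-forward of \<open>\<mu>\<close> under \<open>T\<^sup>-\<^sup>l\<close>; see the lemma below.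
\<close>

definition pullback_measure :: "'a measure \<Rightarrow> ('a \<Rightarrow> 'a) \<Rightarrow> nat \<Rightarrow> 'a measure" where
  "pullback_measure M T l = distr M M (inv_into (space M) T ^^ l)"

lemma emeasure_pullback_measure:
  assumes T: "invertible_measurable M T" and A: "A \<in> sets M"
  shows "emeasure (pullback_measure M T l) A = emeasure M ((T ^^ l) ` A)"
proof -
  define S where "S = inv_into (space M) T"
  have bij: "bij_betw T (space M) (space M)" and S: "S \<in> M \<rightarrow>\<^sub>M M"
    using T by (auto simp: invertible_measurable_def S_def)
  have Sl: "S ^^ l \<in> M \<rightarrow>\<^sub>M M" using S by (rule measurable_compose_n)
  have Tsp: "T x \<in> space M" and Ssp: "S x \<in> space M"
    and ST: "S (T x) = x" and TS: "T (S x) = x" if "x \<in> space M" for x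
    using that bij S measurable_space[OF S]
    by (auto simp: S_def bij_betw_inv_into_left bij_betw_inv_into_right bij_betw_apply)
  have 1: "(T ^^ i) x \<in> space M \<and> (S ^^ i) x \<in> space M" if "x \<in> space M" for i x
    using that by (induction i) (auto simp: Tsp Ssp)
  have 2: "(S ^^ i) ((T ^^ i) x) = x \<and> (T ^^ i) ((S ^^ i) x) = x" if "x \<in> space M" for i x
    using that
  proof (induction i)
    case (Suc i)
    then show ?case
      using 1[of x i] by (simp add: funpow_swap1 Tsp Ssp ST TS)
        (simp flip: funpow_swap1 add: ST TS)
  qed simp
  have "(S ^^ l) -` A \<inter> space M = (T ^^ l) ` A"
  proof (intro equalityI subsetI)
    fix x assume "x \<in> (S ^^ l) -` A \<inter> space M"
    then show "x \<in> (T ^^ l) ` A"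
      using 2[of x l] by (metis IntE imageI vimageD)
  next
    fix x assume "x \<in> (T ^^ l) ` A"
    then show "x \<in> (S ^^ l) -` A \<inter> space M"
      using 1 2 sets.sets_into_space[OF A] by fastforce
  qed
  then show ?thesis
    using Sl A by (simp add: pullback_measure_def emeasure_distr S_def)
qed

text \<open>
  The derivative is taken real-valued; it is almost everywhere in \<open>(0, \<infinity>)\<close> for nonsingular \<open>T\<close>.
\<close>

definition rn_power :: "'a measure \<Rightarrow> ('a \<Rightarrow> 'a) \<Rightarrow> nat \<Rightarrow> 'a \<Rightarrow> real" where
  "rn_power M T l x = enn2real (RN_deriv M (pullback_measure M T l) x)"

definition wandering :: "'a measure \<Rightarrow> ('a \<Rightarrow> 'a) \<Rightarrow> 'a set \<Rightarrow> bool" where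
  "wandering M T A \<longleftrightarrow> A \<in> sets M \<and>
     (\<forall>i\<ge>1. \<forall>j\<ge>1. i \<noteq> j \<longrightarrow>
        null_eq M (((T ^^ i) -` A \<inter> space M) \<inter> ((T ^^ j) -` A \<inter> space M)) {})"

definition conservative :: "'a measure \<Rightarrow> ('a \<Rightarrow> 'a) \<Rightarrow> bool" where
  "conservative M T \<longleftrightarrow> nonsingular M T \<and> (\<forall>A. wandering M T A \<longrightarrow> A \<in> null_sets M)"

definition ergodic :: "'a measure \<Rightarrow> ('a \<Rightarrow> 'a) \<Rightarrow> bool" where
  "ergodic M T \<longleftrightarrow> nonsingular M T \<and>
     (\<forall>A\<in>sets M. null_eq M (T -` A \<inter> space M) A \<longrightarrow> null_eq M A {} \<or> null_eq M A (space M))"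

definition maharam_measure :: "'a measure \<Rightarrow> ('a \<times> real) measure" where
  "maharam_measure M = M \<Otimes>\<^sub>M density lborel (\<lambda>s. ennreal (exp (- s)))"

text \<open>
  As the cocycle is real-valued everywhere, this is a bijection whenever \<open>T\<close> is, including over
  the null set where the derivative vanishes or is infinite (there \<open>ln 0 = 0\<close> is used).
\<close>

definition maharam_map :: "'a measure \<Rightarrow> ('a \<Rightarrow> 'a) \<Rightarrow> 'a \<times> real \<Rightarrow> 'a \<times> real" where
  "maharam_map M T = (\<lambda>(x, y). (T x, y + ln (rn_power M T 1 x)))"

definition type_III_1 :: "'a measure \<Rightarrow> ('a \<Rightarrow> 'a) \<Rightarrow> bool" where
  "type_III_1 M T \<longleftrightarrow>
     nonsingular M T \<and> ergodic M T \<and> ergodic (maharam_measure M) (maharam_map M T)"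

text \<open>
  The space \<open>{0,1}\<^sup>\<int>\<close> is the type \<open>int \<Rightarrow> bool\<close>, with \<open>True\<close> for the symbol 1; the product
  \<open>\<sigma>\<close>-algebra is its Borel \<open>\<sigma>\<close>-algebra. The argument \<open>p j\<close> is the probability of a 1 at \<open>j\<close>.
\<close>

definition coin_product :: "(int \<Rightarrow> real) \<Rightarrow> (int \<Rightarrow> bool) measure" where
  "coin_product p = PiM UNIV (\<lambda>j. measure_pmf (bernoulli_pmf (p j)))"

definition full_shift :: "(int \<Rightarrow> bool) \<Rightarrow> (int \<Rightarrow> bool)" where
  "full_shift w = (\<lambda>i. w (i + 1))"

definition lam :: "nat \<Rightarrow> int \<Rightarrow> real" where
  "lam k n =
     (if 0 \<le> n \<and> n \<le> 2 ^ (k - 1) then 1 + real_of_int n / 2 ^ k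
      else if 2 ^ (k - 1) \<le> n \<and> n \<le> 2 ^ k then 2 - real_of_int n / 2 ^ k
      else 1)"

definition lam_prob :: "nat \<Rightarrow> int \<Rightarrow> real" where
  "lam_prob k n = lam k n / (1 + lam k n)"

definition lam_measure :: "nat \<Rightarrow> (int \<Rightarrow> bool) measure" where
  "lam_measure k = coin_product (lam_prob k)"

end

theory Submission
  imports Defs
begin

text \<open>Write \<open>\<mu>\<close> for the product measure, \<open>T\<close> for the shift and \<open>\<T>\<close> for the Maharam extension
  \<open>(x, y) \<mapsto> (T x, y + ln (T' x))\<close>, which preserves \<open>\<M> = \<mu> \<otimes> exp (- s) ds\<close>.

  Density. The derivative of \<open>\<mu> \<circ> T\<^sup>l\<close> is a product of factors, one for each tent together with the
  gap behind it. Such a factor depends on finitely many coordinates, and once \<open>l\<close> is shorter than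
  the gap in front of the tent it has the law of the corresponding derivative of a single tent.
  The choice of \<open>k\<close> therefore bounds the factors from below by \<open>exp (- 1 / 2\<^sup>t)\<close> outside a set of
  probability \<open>1 / 2\<^sup>t\<close>; since each factor has integral 1, this bounds its \<open>L\<^sup>1\<close> distance to 1 as
  well. Hence the product converges in \<open>L\<^sup>1\<close> and almost everywhere, and by the Borel-Cantelli
  argument in \<open>AE_good_from\<close> its limit is positive (\<open>density_shift_rn\<close>).

  Recurrence. Choose \<open>N\<close> inside the gap after the \<open>t\<close>-th tent. The factors of the tents up to \<open>t\<close>
  multiply to at least 1 as soon as the window of length \<open>n t\<close> at \<open>N\<close> has a 1 wherever the window
  at 0 has one. The gap offers about \<open>2^n t / n t\<close> independent windows, which suffices with
  probability close to 1; the later tents cost at most a factor \<open>exp (-1)\<close>. So the cocycle is at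
  least \<open>exp (-1)\<close> for infinitely many \<open>N\<close> (\<open>AE_cocycle_recurrent\<close>). This yields conservativity,
  and almost every orbit of \<open>\<T>\<close> that starts in height at least \<open>c + 1\<close> returns infinitely often to
  height at least \<open>c\<close>, a set of finite measure.

  Ergodicity. Flipping a coordinate lifts to a map that preserves \<open>\<M>\<close>. Two points that differ by a
  flip become indistinguishable under \<open>\<T>\<close>, because the flipped coordinate drifts to minus infinity,
  where the measure is homogeneous. Recurrence turns this into exact invariance of every
  \<open>\<T>\<close>-invariant set under all flips (\<open>asymptotic_invariance\<close>, a form of the Hopf argument which
  counts visits to a set of finite measure). A flip at a coordinate \<open>j\<close> with value 0 also raises the
  height by the logarithm of the odds at \<open>j\<close>. The tents become arbitrarily flat, so each value
  \<open>1 + 1 / 2\<^sup>i\<close> occurs as odds arbitrarily far to the right; there the flip itself is invisible to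
  sets depending on finitely many coordinates, and invariance under the pure translation by
  \<open>ln (1 + 1 / 2\<^sup>i)\<close> remains (\<open>fibre_shift_invariance_of_essential_value\<close>). A set invariant under
  all flips and under arbitrarily small translations occupies the same proportion of all boxes, so
  it is trivial (\<open>invariant_under_flips_and_shifts_trivial\<close>). Thus \<open>\<T>\<close> is ergodic, and so is its
  factor \<open>T\<close>.\<close>

section \<open>Products of coins and densities\<close>

abbreviation bits :: "(int \<Rightarrow> bool) measure" where
  "bits \<equiv> PiM UNIV (\<lambda>_. count_space UNIV)"

lemma sets_coin_product [simp, measurable_cong]: "sets (coin_product p) = sets bits"
  unfolding coin_product_def by (intro sets_PiM_cong) auto

lemma space_bits: "space bits = UNIV"
  by (simp add: space_PiM)

lemma space_coin_product [simp]: "space (coin_product p) = UNIV"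
  by (simp add: coin_product_def space_PiM)

lemma prob_space_coin_product: "prob_space (coin_product p)"
  unfolding coin_product_def by (intro prob_space_PiM measure_pmf.prob_space_axioms)

lemma vimage_sets_bits: "f \<in> bits \<rightarrow>\<^sub>M bits \<Longrightarrow> A \<in> sets bits \<Longrightarrow> f -` A \<in> sets bits"
  using measurable_sets[of f bits bits A] by (simp add: space_bits)

lemma coordinate_measurable [measurable]: "(\<lambda>w. w i) \<in> bits \<rightarrow>\<^sub>M count_space UNIV"
  by measurable

lemma measurable_coordinate_fun [measurable]: "(\<lambda>w. g (w i)) \<in> bits \<rightarrow>\<^sub>M borel"
  by (rule measurable_compose[OF coordinate_measurable]) simp

definition bit_prob :: "real \<Rightarrow> bool \<Rightarrow> real" where
  "bit_prob a b = (if b then a else 1 - a)"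

lemma coin_product_eqI:
  assumes "finite_measure M" "sets M = sets bits"
    and eq: "\<And>J F. finite J \<Longrightarrow> emeasure M {w. \<forall>j\<in>J. w j \<in> F j} = emeasure (coin_product q) {w. \<forall>j\<in>J. w j \<in> F j}"
  shows "M = coin_product q"
proof (rule measure_eqI_PiM_infinite[of _ UNIV "\<lambda>j. measure_pmf (bernoulli_pmf (q j))"])
  show "sets M = sets (Pi\<^sub>M UNIV (\<lambda>j. measure_pmf (bernoulli_pmf (q j))))"
    using assms(2) by (metis sets_coin_product coin_product_def)
  show "sets (coin_product q) = sets (Pi\<^sub>M UNIV (\<lambda>j. measure_pmf (bernoulli_pmf (q j))))"
    by (simp add: coin_product_def)
  show "finite_measure M" by fact
  fix A J assume "finite (J :: int set)"
  moreover have "prod_emb UNIV (\<lambda>j. measure_pmf (bernoulli_pmf (q j))) J (Pi\<^sub>E J A) = {w. \<forall>j\<in>J. w j \<in> A j}"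
    by (auto simp: prod_emb_def)
  ultimately show "emeasure M (prod_emb UNIV (\<lambda>j. measure_pmf (bernoulli_pmf (q j))) J (Pi\<^sub>E J A)) =
    emeasure (coin_product q) (prod_emb UNIV (\<lambda>j. measure_pmf (bernoulli_pmf (q j))) J (Pi\<^sub>E J A))"
    using eq by simp
qed

lemma distr_restrict_coin_product:
  assumes "finite J"
  shows "distr (coin_product p) (PiM J (\<lambda>_. count_space UNIV)) (\<lambda>w. restrict w J)
       = PiM J (\<lambda>j. measure_pmf (bernoulli_pmf (p j)))"
proof -
  interpret product_prob_space "\<lambda>j. measure_pmf (bernoulli_pmf (p j))" UNIV
    by unfold_locales
  have "distr (coin_product p) (PiM J (\<lambda>_. count_space UNIV)) (\<lambda>w. restrict w J)
    = distr (coin_product p) (PiM J (\<lambda>j. measure_pmf (bernoulli_pmf (p j)))) (\<lambda>w. restrict w J)"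
    by (intro distr_cong refl sets_PiM_cong) auto
  also have "\<dots> = PiM J (\<lambda>j. measure_pmf (bernoulli_pmf (p j)))"
    unfolding coin_product_def by (rule distr_PiM_restrict_finite[OF assms]) simp
  finally show ?thesis .
qed

lemma nn_integral_coin_product_depends:
  assumes J: "finite J" and H [measurable]: "H \<in> borel_measurable bits"
    and dep: "\<And>w w'. (\<And>j. j \<in> J \<Longrightarrow> w j = w' j) \<Longrightarrow> H w = H w'"
  shows "(\<integral>\<^sup>+w. H w \<partial>coin_product p) =
    (\<integral>\<^sup>+v. H (\<lambda>i. if i \<in> J then v i else False) \<partial>PiM J (\<lambda>j. measure_pmf (bernoulli_pmf (p j))))"
proof -
  let ?e = "\<lambda>v i. if i \<in> J then v i else False"
  have [measurable]: "?e \<in> PiM J (\<lambda>_. count_space UNIV) \<rightarrow>\<^sub>M bits"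
  proof (rule measurable_PiM_single')
    fix i :: int
    show "(\<lambda>v. ?e v i) \<in> Pi\<^sub>M J (\<lambda>_. count_space UNIV) \<rightarrow>\<^sub>M count_space UNIV"
      by (cases "i \<in> J") (auto intro: measurable_component_singleton)
  qed auto
  have "(\<integral>\<^sup>+w. H w \<partial>coin_product p) = (\<integral>\<^sup>+w. H (?e (restrict w J)) \<partial>coin_product p)"
    by (intro nn_integral_cong dep) auto
  also have "\<dots> = (\<integral>\<^sup>+v. H (?e v) \<partial>distr (coin_product p) (PiM J (\<lambda>_. count_space UNIV)) (\<lambda>w. restrict w J))"
    by (subst nn_integral_distr) auto
  finally show ?thesis by (simp add: distr_restrict_coin_product[OF J])
qed

lemma nn_integral_coin_product_cong:
  assumes J: "finite J" and H: "H \<in> borel_measurable bits"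
    and dep: "\<And>w w'. (\<And>j. j \<in> J \<Longrightarrow> w j = w' j) \<Longrightarrow> H w = H w'"
    and pq: "\<And>j. j \<in> J \<Longrightarrow> p j = q j"
  shows "(\<integral>\<^sup>+w. H w \<partial>coin_product p) = (\<integral>\<^sup>+w. H w \<partial>coin_product q)"
proof -
  have "PiM J (\<lambda>j. measure_pmf (bernoulli_pmf (p j))) = PiM J (\<lambda>j. measure_pmf (bernoulli_pmf (q j)))"
    by (rule PiM_cong) (auto simp: pq)
  then show ?thesis
    by (simp add: nn_integral_coin_product_depends[OF J H dep])
qed

lemma emeasure_coin_product_cong:
  assumes J: "finite J" and A: "A \<in> sets bits"
    and dep: "\<And>w w'. (\<And>j. j \<in> J \<Longrightarrow> w j = w' j) \<Longrightarrow> w \<in> A \<longleftrightarrow> w' \<in> A"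
    and pq: "\<And>j. j \<in> J \<Longrightarrow> p j = q j"
  shows "emeasure (coin_product p) A = emeasure (coin_product q) A"
proof -
  have "(\<integral>\<^sup>+w. indicator A w \<partial>coin_product p) = (\<integral>\<^sup>+w. indicator A w \<partial>coin_product q)"
  proof (rule nn_integral_coin_product_cong[OF J _ _ pq])
    fix w w' :: "int \<Rightarrow> bool" assume "\<And>j. j \<in> J \<Longrightarrow> w j = w' j"
    from dep[OF this] show "indicator A w = (indicator A w' :: ennreal)"
      by (simp add: indicator_def)
  qed (use A in auto)
  then show ?thesis using A by simp
qed

lemma nn_integral_coin_product_prod:
  assumes J: "finite J"
  shows "(\<integral>\<^sup>+w. (\<Prod>j\<in>J. g j (w j)) \<partial>coin_product p) = (\<Prod>j\<in>J. \<integral>\<^sup>+b. g j b \<partial>bernoulli_pmf (p j))"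
proof -
  interpret product_sigma_finite "\<lambda>j. measure_pmf (bernoulli_pmf (p j))"
    by unfold_locales
  have "(\<integral>\<^sup>+w. (\<Prod>j\<in>J. g j (w j)) \<partial>coin_product p) =
    (\<integral>\<^sup>+v. (\<Prod>j\<in>J. g j (v j)) \<partial>PiM J (\<lambda>j. measure_pmf (bernoulli_pmf (p j))))"
    by (subst nn_integral_coin_product_depends[OF J]) (auto intro!: prod.cong)
  also have "\<dots> = (\<Prod>j\<in>J. \<integral>\<^sup>+b. g j b \<partial>bernoulli_pmf (p j))"
    by (rule product_nn_integral_prod[OF J]) auto
  finally show ?thesis .
qed

lemma nn_integral_bernoulli:
  assumes "0 \<le> a" "a \<le> 1"
  shows "(\<integral>\<^sup>+b. g b \<partial>bernoulli_pmf a) = ennreal a * g True + ennreal (1 - a) * g False"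
proof -
  have "(\<integral>\<^sup>+b. g b \<partial>bernoulli_pmf a) = g True * ennreal a + g False * ennreal (1 - a)"
    by (rule nn_integral_bernoulli_pmf[OF assms]) simp
  then show ?thesis by (simp only: mult.commute)
qed

lemma cylinder_measurable [intro]:
  assumes "finite J" shows "{w. \<forall>j\<in>J. w j \<in> F j} \<in> sets bits"
proof -
  have "{w \<in> space bits. \<forall>j\<in>J. w j \<in> F j} \<in> sets bits"
  proof (rule sets.sets_Collect_finite_All[OF _ assms])
    fix j
    show "{w \<in> space bits. w j \<in> F j} \<in> sets bits"
      using measurable_sets[OF coordinate_measurable, of "F j" j]
      by (simp only: vimage_def Int_def mem_Collect_eq conj_commute) simp
  qed
  then show ?thesis by (simp add: space_bits)
qed

lemma emeasure_cylinder:
  assumes "finite J"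
  shows "emeasure (coin_product p) {w. \<forall>j\<in>J. w j \<in> F j} = (\<Prod>j\<in>J. emeasure (bernoulli_pmf (p j)) (F j))"
proof -
  have "emeasure (coin_product p) {w. \<forall>j\<in>J. w j \<in> F j} = (\<integral>\<^sup>+w. indicator {w. \<forall>j\<in>J. w j \<in> F j} w \<partial>coin_product p)"
    using assms by (subst nn_integral_indicator) auto
  also have "\<dots> = (\<integral>\<^sup>+w. (\<Prod>j\<in>J. indicator (F j) (w j)) \<partial>coin_product p)"
    using assms by (intro nn_integral_cong) (auto simp: indicator_def)
  also have "\<dots> = (\<Prod>j\<in>J. \<integral>\<^sup>+b. indicator (F j) b \<partial>bernoulli_pmf (p j))"
    by (rule nn_integral_coin_product_prod[OF assms])
  finally show ?thesis by simp
qed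

definition bit_ratio :: "real \<Rightarrow> real \<Rightarrow> bool \<Rightarrow> real" where
  "bit_ratio a b x = bit_prob b x / bit_prob a x"

lemma bit_ratio_nonneg: "0 < a \<Longrightarrow> a < 1 \<Longrightarrow> 0 \<le> b \<Longrightarrow> b \<le> 1 \<Longrightarrow> 0 \<le> bit_ratio a b x"
  by (simp add: bit_ratio_def bit_prob_def)

lemma bit_ratio_pos: "0 < a \<Longrightarrow> a < 1 \<Longrightarrow> 0 < b \<Longrightarrow> b < 1 \<Longrightarrow> 0 < bit_ratio a b x"
  by (simp add: bit_ratio_def bit_prob_def)

text \<open>A change of finitely many coins has an explicit density. This is also the substitute for
  conditioning: integrating against a product over some coordinates amounts to altering these coins
  and leaves the law of all other coordinates untouched.\<close>

lemma coin_product_density: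
  assumes J: "finite J" and p: "\<And>j. 0 < p j \<and> p j < 1" and q: "\<And>j. 0 \<le> q j \<and> q j \<le> 1"
    and pq: "\<And>j. j \<notin> J \<Longrightarrow> q j = p j"
  shows "density (coin_product p) (\<lambda>w. ennreal (\<Prod>j\<in>J. bit_ratio (p j) (q j) (w j))) = coin_product q"
    (is "density _ (\<lambda>w. ennreal (?f w)) = _")
proof -
  interpret P: prob_space "coin_product p" by (rule prob_space_coin_product)
  have r: "0 \<le> bit_ratio (p j) (q j) x" for j x
    using p[of j] q[of j] by (intro bit_ratio_nonneg) auto
  have f: "ennreal (?f w) = (\<Prod>j\<in>J. ennreal (bit_ratio (p j) (q j) (w j)))" for w
    using r by (simp add: prod_ennreal)
  have fm: "(\<lambda>w. ennreal (?f w)) \<in> borel_measurable bits"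
    by measurable
  have eq: "emeasure (density (coin_product p) (\<lambda>w. ennreal (?f w))) {w. \<forall>j\<in>L. w j \<in> F j} =
      emeasure (coin_product q) {w. \<forall>j\<in>L. w j \<in> F j}" if L: "finite L" for L F
  proof -
    let ?C = "{w. \<forall>j\<in>L. w j \<in> F j}"
    have C: "?C \<in> sets bits" using L by (rule cylinder_measurable)
    let ?g = "\<lambda>j x. (if j \<in> J then ennreal (bit_ratio (p j) (q j) x) else 1) * (if j \<in> L then indicator (F j) x else 1)"
    have *: "(\<integral>\<^sup>+x. ?g j x \<partial>bernoulli_pmf (p j)) = (if j \<in> L then emeasure (bernoulli_pmf (q j)) (F j) else 1)" for j
    proof -
      have "(\<integral>\<^sup>+x. ?g j x \<partial>bernoulli_pmf (p j)) = (\<integral>\<^sup>+x. (if j \<in> L then indicator (F j) x else 1) \<partial>bernoulli_pmf (q j))"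
        using p[of j] q[of j] pq[of j]
        by (subst (1 2) nn_integral_bernoulli)
           (auto simp: bit_ratio_def bit_prob_def indicator_def ennreal_mult'[symmetric] simp flip: ennreal_plus)
      also have "\<dots> = (if j \<in> L then emeasure (bernoulli_pmf (q j)) (F j) else 1)"
        by (cases "j \<in> L") auto
      finally show ?thesis .
    qed
    have "emeasure (density (coin_product p) (\<lambda>w. ennreal (?f w))) ?C = (\<integral>\<^sup>+w. ennreal (?f w) * indicator ?C w \<partial>coin_product p)"
      using fm C by (subst emeasure_density) auto
    also have "\<dots> = (\<integral>\<^sup>+w. (\<Prod>j\<in>J\<union>L. ?g j (w j)) \<partial>coin_product p)"
    proof (intro nn_integral_cong)
      fix w
      have "indicator ?C w = (\<Prod>j\<in>L. indicator (F j) (w j) :: ennreal)"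
        using L by (auto simp: indicator_def)
      then have "indicator ?C w = (\<Prod>j\<in>J\<union>L. if j \<in> L then indicator (F j) (w j) else 1 :: ennreal)"
        using J L by (simp add: prod.inter_restrict[symmetric] Int_absorb1)
      moreover have "ennreal (?f w) = (\<Prod>j\<in>J\<union>L. if j \<in> J then ennreal (bit_ratio (p j) (q j) (w j)) else 1)"
        using J L by (simp add: f prod.inter_restrict[symmetric] Int_absorb1)
      ultimately show "ennreal (?f w) * indicator ?C w = (\<Prod>j\<in>J\<union>L. ?g j (w j))"
        by (simp add: prod.distrib)
    qed
    also have "\<dots> = (\<Prod>j\<in>J\<union>L. if j \<in> L then emeasure (bernoulli_pmf (q j)) (F j) else 1)"
      using J L by (subst nn_integral_coin_product_prod) (simp_all only: * finite_Un)
    also have "\<dots> = (\<Prod>j\<in>L. emeasure (bernoulli_pmf (q j)) (F j))"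
      using J L by (simp add: prod.inter_restrict[symmetric] Int_absorb1)
    finally show ?thesis using L by (simp add: emeasure_cylinder)
  qed
  show ?thesis
  proof (rule coin_product_eqI)
    have "emeasure (density (coin_product p) (\<lambda>w. ennreal (?f w))) UNIV = emeasure (coin_product q) UNIV"
      using eq[of "{}"] by simp
    then show "finite_measure (density (coin_product p) (\<lambda>w. ennreal (?f w)))"
      using prob_space.emeasure_space_1[OF prob_space_coin_product, of q]
      by (intro finite_measureI) auto
  qed (auto intro: eq)
qed

definition unshift :: "(int \<Rightarrow> bool) \<Rightarrow> (int \<Rightarrow> bool)" where
  "unshift w = (\<lambda>i. w (i - 1))"

lemma full_shift_unshift [simp]: "full_shift (unshift w) = w" "unshift (full_shift w) = w"
  by (auto simp: full_shift_def unshift_def)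

lemma full_shift_measurable [measurable]: "full_shift \<in> bits \<rightarrow>\<^sub>M bits"
  unfolding full_shift_def by (rule measurable_PiM_single') auto

lemma unshift_measurable [measurable]: "unshift \<in> bits \<rightarrow>\<^sub>M bits"
  unfolding unshift_def by (rule measurable_PiM_single') auto

lemma bij_full_shift: "bij full_shift"
  by (rule bij_betw_byWitness[of _ unshift]) auto

lemma inv_full_shift: "inv_into UNIV full_shift = unshift"
  by (rule inv_unique_comp) (auto simp: fun_eq_iff)

lemma unshift_power: "(unshift ^^ l) w = (\<lambda>i. w (i - int l))"
  by (induction l) (auto simp: unshift_def algebra_simps)

lemma full_shift_power: "(full_shift ^^ l) w = (\<lambda>i. w (i + int l))"
  by (induction l) (auto simp: full_shift_def algebra_simps)

lemma distr_reindex_coin_product: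
  assumes f: "inj f" and g: "g \<in> bits \<rightarrow>\<^sub>M bits" "\<And>w. g w = (\<lambda>i. w (f i))"
  shows "distr (coin_product p) bits g = coin_product (\<lambda>i. p (f i))"
proof -
  have "distr (coin_product p) (coin_product (\<lambda>i. p (f i))) (\<lambda>\<omega>. \<lambda>n\<in>UNIV. \<omega> (f n)) = coin_product (\<lambda>i. p (f i))"
    unfolding coin_product_def
    using f by (intro distr_PiM_reindex[where M="\<lambda>j. measure_pmf (bernoulli_pmf (p j))"]) (auto simp: measure_pmf.prob_space_axioms)
  moreover have "distr (coin_product p) bits g = distr (coin_product p) (coin_product (\<lambda>i. p (f i))) (\<lambda>\<omega>. \<lambda>n\<in>UNIV. \<omega> (f n))"
    by (rule distr_cong) (auto simp: g)
  ultimately show ?thesis by simp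
qed

lemma distr_unshift_power: "distr (coin_product p) bits (unshift ^^ l) = coin_product (\<lambda>i. p (i - int l))"
  by (rule distr_reindex_coin_product) (auto simp: unshift_power inj_on_def intro: measurable_compose_n)

lemma distr_unshift: "distr (coin_product p) bits unshift = coin_product (\<lambda>i. p (i - 1))"
  by (rule distr_reindex_coin_product) (auto simp: unshift_def inj_on_def)

definition flip :: "int \<Rightarrow> (int \<Rightarrow> bool) \<Rightarrow> (int \<Rightarrow> bool)" where
  "flip j w = w(j := \<not> w j)"

lemma flip_flip [simp]: "flip j (flip j w) = w"
  by (auto simp: flip_def)

lemma flip_apply: "flip j w i = (if i = j then \<not> w i else w i)"
  by (auto simp: flip_def)

lemma flip_measurable [measurable]: "flip j \<in> bits \<rightarrow>\<^sub>M bits"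
proof (rule measurable_PiM_single')
  fix i
  show "(\<lambda>w. flip j w i) \<in> bits \<rightarrow>\<^sub>M count_space UNIV"
    by (cases "i = j") (auto simp: flip_apply)
qed auto

lemma full_shift_flip: "full_shift (flip j w) = flip (j - 1) (full_shift w)"
  by (auto simp: full_shift_def flip_def fun_eq_iff)

definition flip_ratio :: "(int \<Rightarrow> real) \<Rightarrow> int \<Rightarrow> (int \<Rightarrow> bool) \<Rightarrow> real" where
  "flip_ratio p j w = bit_prob (p j) (\<not> w j) / bit_prob (p j) (w j)"

lemma flip_ratio_measurable [measurable]: "flip_ratio p j \<in> borel_measurable bits"
  unfolding flip_ratio_def by measurable

text \<open>Flipping coordinate \<open>j\<close> turns the coin \<open>p j\<close> into \<open>1 - p j\<close>, and this is a change of one coin.\<close>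

lemma distr_flip:
  assumes p: "\<And>j. 0 < p j \<and> p j < 1"
  shows "distr (coin_product p) bits (flip j) = density (coin_product p) (flip_ratio p j)"
proof -
  have "distr (coin_product p) bits (flip j) = coin_product (p(j := 1 - p j))" (is "?M = coin_product ?q")
  proof (rule coin_product_eqI)
    interpret prob_space "coin_product p" by (rule prob_space_coin_product)
    show "finite_measure (distr (coin_product p) bits (flip j))" by (rule finite_measure_distr) auto
    fix J :: "int set" and F assume J: "finite J"
    have "emeasure ?M {w. \<forall>i\<in>J. w i \<in> F i} = emeasure (coin_product p) (flip j -` {w. \<forall>i\<in>J. w i \<in> F i} \<inter> space (coin_product p))"
      using J by (intro emeasure_distr) auto
    also have "flip j -` {w. \<forall>i\<in>J. w i \<in> F i} \<inter> space (coin_product p) = {w. \<forall>i\<in>J. w i \<in> (if i = j then {b. (\<not> b) \<in> F i} else F i)}"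
      by (auto simp: flip_apply)
    also have "emeasure (coin_product p) \<dots> = (\<Prod>i\<in>J. emeasure (bernoulli_pmf (p i)) (if i = j then {b. (\<not> b) \<in> F i} else F i))"
      using J by (rule emeasure_cylinder)
    also have "\<dots> = (\<Prod>i\<in>J. emeasure (bernoulli_pmf (?q i)) (F i))"
    proof (intro prod.cong refl)
      fix i
      have "emeasure (bernoulli_pmf (p j)) {b. (\<not> b) \<in> F j} = emeasure (bernoulli_pmf (1 - p j)) (F j)"
        using p[of j]
        by (subst (1 2) nn_integral_indicator[symmetric], simp, simp, subst (1 2) nn_integral_bernoulli) (auto simp: indicator_def add.commute)
      then show "emeasure (bernoulli_pmf (p i)) (if i = j then {b. (\<not> b) \<in> F i} else F i) = emeasure (bernoulli_pmf (?q i)) (F i)"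
        by auto
    qed
    finally show "emeasure ?M {w. \<forall>i\<in>J. w i \<in> F i} = emeasure (coin_product ?q) {w. \<forall>i\<in>J. w i \<in> F i}"
      using J by (simp add: emeasure_cylinder)
  qed simp
  also have "\<dots> = density (coin_product p) (\<lambda>w. ennreal (\<Prod>i\<in>{j}. bit_ratio (p i) (?q i) (w i)))"
    using p by (intro coin_product_density[symmetric]) (auto simp: less_imp_le)
  also have "\<dots> = density (coin_product p) (flip_ratio p j)"
    by (intro density_cong) (auto simp: flip_ratio_def bit_ratio_def bit_prob_def)
  finally show ?thesis .
qed

lemma sets_Collect_bits:
  assumes "Measurable.pred bits P" shows "{w. P w} \<in> sets bits"
  using assms by (simp add: pred_def space_bits)

lemma UNIV_sets_bits [simp]: "UNIV \<in> sets bits"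
  using sets.top[of bits] by (simp add: space_bits)

text \<open>A density that is rarely much below 1 is close to 1 in the mean, since its positive and negative
  deviations from 1 have equal integrals.\<close>

lemma (in prob_space) L1_dist_one_le:
  fixes f :: "'a \<Rightarrow> real"
  assumes [measurable]: "f \<in> borel_measurable M" and f: "\<And>x. 0 \<le> f x" and f1: "(\<integral>\<^sup>+x. f x \<partial>M) = 1"
    and a: "0 \<le> a" and large: "1 - a \<le> prob {x \<in> space M. exp (- a) \<le> f x}"
  shows "(\<integral>\<^sup>+x. \<bar>f x - 1\<bar> \<partial>M) \<le> ennreal (4 * a)"
proof -
  let ?S = "{x \<in> space M. f x < exp (- a)}"
  have S [measurable]: "?S \<in> events" by measurable
  have "prob ?S = 1 - prob {x \<in> space M. exp (- a) \<le> f x}"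
    by (subst prob_compl[symmetric]) (auto intro!: arg_cong[where f=prob])
  then have pS: "prob ?S \<le> a" using large by simp
  have int: "integrable M f"
    by (rule integrableI_nonneg) (use f f1 in auto)
  have int_S: "integrable M (indicator ?S :: _ \<Rightarrow> real)"
    using S by (intro integrable_real_indicator) (auto simp: emeasure_eq_measure)
  have I1: "(\<integral>x. f x \<partial>M) = 1"
    using nn_integral_eq_integral[OF int] f f1 by simp
  have "\<bar>f x - 1\<bar> \<le> f x - 1 + 2 * (a + indicator ?S x)" if "x \<in> space M" for x
    using f[of x] exp_ge_add_one_self[of "- a"] a that by (auto simp: indicator_def abs_if not_less)
  then have "(\<integral>x. \<bar>f x - 1\<bar> \<partial>M) \<le> (\<integral>x. f x - 1 + 2 * (a + indicator ?S x) \<partial>M)"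
    using int int_S by (intro integral_mono integrable_abs Bochner_Integration.integrable_add
      Bochner_Integration.integrable_diff integrable_mult_right) simp_all
  also have "\<dots> = (\<integral>x. f x \<partial>M) - 1 + 2 * (a + (\<integral>x. indicator ?S x \<partial>M))"
    using int int_S by (simp add: prob_space)
  also have "\<dots> = 2 * a + 2 * prob ?S"
    by (simp add: I1)
  also have "\<dots> \<le> 4 * a" using pS by simp
  finally have "(\<integral>x. \<bar>f x - 1\<bar> \<partial>M) \<le> 4 * a" .
  moreover have "(\<integral>\<^sup>+x. \<bar>f x - 1\<bar> \<partial>M) = ennreal (\<integral>x. \<bar>f x - 1\<bar> \<partial>M)"
    using int by (intro nn_integral_eq_integral) auto
  ultimately show ?thesis by (simp add: ennreal_leI)
qed

lemma (in prob_space) AE_of_prob_lower_bound: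
  assumes A: "{x \<in> space M. P x} \<in> events" and f: "f \<longlonglongrightarrow> 1" "\<And>t. t \<ge> N \<Longrightarrow> f t \<le> prob {x \<in> space M. P x}"
  shows "AE x in M. P x"
proof -
  have "1 \<le> prob {x \<in> space M. P x}"
    using f(2) by (intro LIMSEQ_le_const2[OF f(1)]) blast
  then have "prob {x \<in> space M. P x} = 1" by (intro antisym prob_le_1)
  then show ?thesis by (simp add: prob_Collect_eq_1 A)
qed

lemma emeasure_density_le_L1:
  fixes f g :: "'a \<Rightarrow> real"
  assumes [measurable]: "f \<in> borel_measurable M" "g \<in> borel_measurable M" "A \<in> sets M" and g: "\<And>x. 0 \<le> g x"
  shows "emeasure (density M f) A \<le> emeasure (density M g) A + (\<integral>\<^sup>+x. \<bar>f x - g x\<bar> \<partial>M)"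
proof -
  have "ennreal (f x) * indicator A x \<le> ennreal (g x) * indicator A x + ennreal \<bar>f x - g x\<bar>" for x
    using g[of x] by (auto simp: indicator_def ennreal_plus[symmetric] intro!: ennreal_leI simp del: ennreal_plus)
  then have "emeasure (density M f) A \<le> (\<integral>\<^sup>+x. ennreal (g x) * indicator A x + ennreal \<bar>f x - g x\<bar> \<partial>M)"
    by (subst emeasure_density) (auto intro: nn_integral_mono)
  then show ?thesis
    by (subst (asm) nn_integral_add) (auto simp: emeasure_density)
qed

section \<open>The Maharam extension and asymptotic invariance\<close>

lemma null_eq_iff_AE:
  assumes "A \<in> sets M" "B \<in> sets M"
  shows "null_eq M A B \<longleftrightarrow> (AE z in M. z \<in> A \<longleftrightarrow> z \<in> B)"
proof -
  have "null_eq M A B \<longleftrightarrow> (AE z in M. z \<notin> sym_diff A B)"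
    unfolding null_eq_def using assms by (intro AE_iff_null_sets) auto
  also have "\<dots> \<longleftrightarrow> (AE z in M. z \<in> A \<longleftrightarrow> z \<in> B)"
    by (intro AE_cong) auto
  finally show ?thesis .
qed

abbreviation exp_line :: "real measure" where
  "exp_line \<equiv> density lborel (\<lambda>s. ennreal (exp (- s)))"

lemma emeasure_exp_line_atLeast: "emeasure exp_line {s..} = ennreal (exp (- s))"
proof -
  have "emeasure exp_line {s..} = (\<integral>\<^sup>+x. ennreal (exp (- x)) * indicator {s..} x \<partial>lborel)"
    by (subst emeasure_density) auto
  also have "\<dots> = ennreal (0 - (- exp (- s)))"
  proof (rule nn_integral_FTC_atLeast)
    show "((\<lambda>x. - exp (- x :: real)) \<longlongrightarrow> 0) at_top"
      using tendsto_minus[OF filterlim_compose[OF exp_at_bot filterlim_uminus_at_bot_at_top]] by simp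
  qed (auto intro!: derivative_eq_intros)
  finally show ?thesis by simp
qed

lemma sigma_finite_exp_line: "sigma_finite_measure exp_line"
proof
  show "\<exists>A. countable A \<and> A \<subseteq> sets exp_line \<and> \<Union> A = space exp_line \<and> (\<forall>a\<in>A. emeasure exp_line a \<noteq> \<infinity>)"
  proof (intro exI conjI)
    show "countable (range (\<lambda>i::nat. {- real i..}))" by simp
    show "\<Union> (range (\<lambda>i::nat. {- real i..})) = space exp_line"
    proof -
      have "\<exists>i::nat. - real i \<le> x" for x
        using real_arch_simple[of "- x"] by (metis minus_le_iff)
      then show ?thesis by auto
    qed
    show "\<forall>a\<in>range (\<lambda>i::nat. {- real i..}). emeasure exp_line a \<noteq> \<infinity>"
      by (auto simp: emeasure_exp_line_atLeast)
  qed auto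
qed

lemma nn_integral_exp_line_shift:
  assumes [measurable]: "g \<in> borel_measurable borel"
  shows "(\<integral>\<^sup>+y. g (y + c) \<partial>exp_line) = ennreal (exp c) * (\<integral>\<^sup>+y. g y \<partial>exp_line)"
proof -
  have "(\<integral>\<^sup>+y. g y \<partial>exp_line) = (\<integral>\<^sup>+y. ennreal (exp (- y)) * g y \<partial>lborel)"
    by (subst nn_integral_density) auto
  also have "\<dots> = (\<integral>\<^sup>+y. ennreal (exp (- (y + c))) * g (y + c) \<partial>lborel)"
    using nn_integral_real_affine[of "\<lambda>y. ennreal (exp (- y)) * g y" 1 c] by (simp add: add.commute)
  finally have "ennreal (exp c) * (\<integral>\<^sup>+y. g y \<partial>exp_line) = (\<integral>\<^sup>+y. ennreal (exp c) * (ennreal (exp (- (y + c))) * g (y + c)) \<partial>lborel)"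
    by (simp add: nn_integral_cmult)
  also have "\<dots> = (\<integral>\<^sup>+y. ennreal (exp (- y)) * g (y + c) \<partial>lborel)"
  proof (intro nn_integral_cong)
    fix y
    have "exp c * exp (- (y + c)) = exp (- y)" by (simp flip: exp_add)
    then show "ennreal (exp c) * (ennreal (exp (- (y + c))) * g (y + c)) = ennreal (exp (- y)) * g (y + c)"
      by (simp add: mult.assoc[symmetric] ennreal_mult[symmetric])
  qed
  also have "\<dots> = (\<integral>\<^sup>+y. g (y + c) \<partial>exp_line)"
    by (subst nn_integral_density) auto
  finally show ?thesis by simp
qed

lemma maharam_measure_eq: "maharam_measure M = M \<Otimes>\<^sub>M exp_line"
  by (simp add: maharam_measure_def)

lemma sets_maharam_measure [measurable_cong]: "sets (maharam_measure M) = sets (M \<Otimes>\<^sub>M borel)"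
  unfolding maharam_measure_def by (intro sets_pair_measure_cong) auto

lemma sigma_finite_maharam_measure:
  assumes "sigma_finite_measure M" shows "sigma_finite_measure (maharam_measure M)"
  unfolding maharam_measure_def
  using assms sigma_finite_exp_line by (intro sigma_finite_pair_measure)

lemma emeasure_maharam_measure:
  assumes "A \<in> sets (maharam_measure M)"
  shows "emeasure (maharam_measure M) A = (\<integral>\<^sup>+x. \<integral>\<^sup>+y. indicator A (x, y) \<partial>exp_line \<partial>M)"
  using assms unfolding maharam_measure_def
  by (intro sigma_finite_measure.emeasure_pair_measure sigma_finite_exp_line)

text \<open>The skew product over \<open>S\<close> that translates the fibre by \<open>ln (a x)\<close>; with \<open>a = S'\<close> it is the
  Maharam extension of \<open>S\<close>. Allowing any \<open>a\<close> permits an everywhere positive version of the derivative.\<close>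

definition skew :: "('a \<Rightarrow> 'a) \<Rightarrow> ('a \<Rightarrow> real) \<Rightarrow> 'a \<times> real \<Rightarrow> 'a \<times> real" where
  "skew S a = (\<lambda>(x, y). (S x, y + ln (a x)))"

lemma skew_measurable [measurable]:
  assumes [measurable]: "S \<in> M \<rightarrow>\<^sub>M M" "a \<in> borel_measurable M"
  shows "skew S a \<in> M \<Otimes>\<^sub>M borel \<rightarrow>\<^sub>M M \<Otimes>\<^sub>M borel"
  unfolding skew_def by measurable

text \<open>The translation by \<open>ln (a x)\<close> multiplies \<open>exp (- s) ds\<close> by \<open>a x\<close>, which compensates the density of
  \<open>S\<close> exactly. The map \<open>S'\<close> is the inverse of \<open>S\<close>, so the last premise says that \<open>a\<close> is the derivative
  of \<open>S\<close>.\<close>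

lemma distr_skew:
  assumes S [measurable]: "S \<in> M \<rightarrow>\<^sub>M M" and S' [measurable]: "S' \<in> M \<rightarrow>\<^sub>M M" and SS': "\<And>x. x \<in> space M \<Longrightarrow> S (S' x) = x"
    and a [measurable]: "a \<in> borel_measurable M" and pos: "\<And>x. 0 < a x"
    and dens: "density M (\<lambda>x. ennreal (a x)) = distr M M S'"
  shows "distr (maharam_measure M) (M \<Otimes>\<^sub>M borel) (skew S a) = maharam_measure M"
proof (rule measure_eqI)
  interpret L: sigma_finite_measure exp_line by (rule sigma_finite_exp_line)
  fix A assume "A \<in> sets (distr (maharam_measure M) (M \<Otimes>\<^sub>M borel) (skew S a))"
  then have A [measurable]: "A \<in> sets (M \<Otimes>\<^sub>M borel)" by simp
  have A' [measurable]: "A \<in> sets (M \<Otimes>\<^sub>M exp_line)"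
    using A sets_maharam_measure[of M] by (simp add: maharam_measure_def)
  define G where "G x = (\<integral>\<^sup>+y. indicator A (x, y) \<partial>exp_line)" for x
  have G [measurable]: "G \<in> borel_measurable M"
    unfolding G_def by measurable
  have sk: "skew S a \<in> maharam_measure M \<rightarrow>\<^sub>M M \<Otimes>\<^sub>M borel" by measurable
  have "emeasure (distr (maharam_measure M) (M \<Otimes>\<^sub>M borel) (skew S a)) A =
     emeasure (maharam_measure M) (skew S a -` A \<inter> space (maharam_measure M))"
    by (rule emeasure_distr[OF sk A])
  also have "\<dots> = (\<integral>\<^sup>+x. \<integral>\<^sup>+y. indicator (skew S a -` A \<inter> space (maharam_measure M)) (x, y) \<partial>exp_line \<partial>M)"
    by (rule emeasure_maharam_measure[OF measurable_sets[OF sk A]])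
  also have "\<dots> = (\<integral>\<^sup>+x. ennreal (a x) * G (S x) \<partial>M)"
  proof (rule nn_integral_cong)
    fix x assume x: "x \<in> space M"
    then have Sx: "S x \<in> space M" using S by (rule measurable_space[rotated])
    have [measurable]: "(\<lambda>y. indicator A (S x, y) :: ennreal) \<in> borel_measurable borel"
      using Sx by measurable
    have "(\<integral>\<^sup>+y. indicator (skew S a -` A \<inter> space (maharam_measure M)) (x, y) \<partial>exp_line)
       = (\<integral>\<^sup>+y. indicator A (S x, y + ln (a x)) \<partial>exp_line)"
      using x by (intro nn_integral_cong) (auto simp: indicator_def skew_def maharam_measure_def space_pair_measure)
    also have "\<dots> = ennreal (a x) * G (S x)"
      unfolding G_def using pos[of x] by (subst nn_integral_exp_line_shift) auto
    finally show "(\<integral>\<^sup>+y. indicator (skew S a -` A \<inter> space (maharam_measure M)) (x, y) \<partial>exp_line) = ennreal (a x) * G (S x)" .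
  qed
  also have "\<dots> = (\<integral>\<^sup>+x. G (S x) \<partial>density M (\<lambda>x. ennreal (a x)))"
    by (subst nn_integral_density) auto
  also have "\<dots> = (\<integral>\<^sup>+x. G (S (S' x)) \<partial>M)"
    unfolding dens by (subst nn_integral_distr) auto
  also have "\<dots> = (\<integral>\<^sup>+x. G x \<partial>M)"
    by (intro nn_integral_cong) (simp add: SS')
  also have "\<dots> = emeasure (maharam_measure M) A"
    unfolding G_def by (subst emeasure_maharam_measure) (auto simp: sets_maharam_measure A)
  finally show "emeasure (distr (maharam_measure M) (M \<Otimes>\<^sub>M borel) (skew S a)) A = emeasure (maharam_measure M) A" .
qed (simp add: sets_maharam_measure)

lemma exists_index_with_count:
  fixes S :: "nat set"
  assumes "infinite S" shows "\<exists>n\<in>S. card {i\<in>S. i < n} = N"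
proof (induction N)
  case 0
  obtain s where "s \<in> S" using assms by (metis ex_in_conv finite.emptyI)
  then have "(LEAST n. n \<in> S) \<in> S" by (rule LeastI)
  moreover have "{i\<in>S. i < (LEAST n. n \<in> S)} = {}" by (auto dest: not_less_Least)
  ultimately show ?case by (metis card.empty)
next
  case (Suc N)
  then obtain n where n: "n \<in> S" "card {i\<in>S. i < n} = N" by blast
  define n' where "n' = (LEAST i. i \<in> S \<and> n < i)"
  obtain s where "s \<in> S \<and> n < s" using assms by (metis infinite_nat_iff_unbounded)
  then have n': "n' \<in> S \<and> n < n'" unfolding n'_def by (rule LeastI)
  have "{i\<in>S. i < n'} = insert n {i\<in>S. i < n}"
    using n n' not_less_Least[of _ "\<lambda>i. i \<in> S \<and> n < i"] by (auto simp: n'_def[symmetric]) (metis linorder_neqE_nat)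
  then have "card {i\<in>S. i < n'} = Suc N" using n by simp
  with n' show ?case by blast
qed

lemma AE_invariant_power:
  assumes T: "T \<in> Z \<rightarrow>\<^sub>M Z" "distr Z Z T = Z" and inv: "AE z in Z. T z \<in> A \<longleftrightarrow> z \<in> A"
  shows "distr Z Z (T ^^ n) = Z" and "AE z in Z. (T ^^ n) z \<in> A \<longleftrightarrow> z \<in> A"
proof -
  have Tn: "T ^^ n \<in> Z \<rightarrow>\<^sub>M Z" for n using T(1) by (rule measurable_compose_n)
  show *: "distr Z Z (T ^^ n) = Z" for n
  proof (induction n)
    case (Suc n)
    then show ?case using distr_distr[OF T(1) Tn[of n]] T(2) by (simp add: comp_def)
  qed (simp add: distr_id2 id_def)
  show "AE z in Z. (T ^^ n) z \<in> A \<longleftrightarrow> z \<in> A"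
  proof (induction n)
    case (Suc n)
    have "AE z in distr Z Z (T ^^ n). T z \<in> A \<longleftrightarrow> z \<in> A" using inv unfolding * .
    from AE_distrD[OF Tn this] Suc show ?case by eventually_elim simp
  qed simp
qed

text \<open>The Hopf argument for an infinite invariant measure. Let \<open>D\<close> be the set of points \<open>z\<close> of \<open>K\<^sub>0\<close> for which
  \<open>z\<close> and \<open>\<phi> 0 z\<close> are separated by the invariant set \<open>A\<close>, and let \<open>G\<close> approximate \<open>A\<close> on \<open>K\<close> so well that
  late \<open>\<phi> n\<close> do not change \<open>G\<close>. Stop the orbit of \<open>z\<close> at its \<open>N\<close>-th return to \<open>K\<close>, at time \<open>n \<ge> N\<close> say. There
  \<open>T\<^sup>n z\<close> and \<open>\<phi> n (T\<^sup>n z)\<close> are still separated by \<open>A\<close> but not by \<open>G\<close>, so one of them lies in the small set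
  \<open>B = sym_diff A G \<inter> K\<close>. The stopping time does not distinguish \<open>z\<close> from \<open>\<phi> 0 z\<close>, and the images of the
  stopping sets are disjoint, since a backward orbit makes its \<open>N\<close>-th visit to \<open>K\<close> at only one time.
  Hence \<open>D\<close> has at most twice the measure of \<open>B\<close>.\<close>

lemma asymptotic_invariance:
  fixes Z :: "'z measure" and T U :: "'z \<Rightarrow> 'z" and \<phi> :: "nat \<Rightarrow> 'z \<Rightarrow> 'z"
  assumes UNIV: "space Z = UNIV"
    and T [measurable]: "T \<in> Z \<rightarrow>\<^sub>M Z" and U [measurable]: "U \<in> Z \<rightarrow>\<^sub>M Z" and UT: "\<And>z. U (T z) = z" "\<And>z. T (U z) = z"
    and T_pres: "distr Z Z T = Z"
    and \<phi> [measurable]: "\<phi> 0 \<in> Z \<rightarrow>\<^sub>M Z" and \<phi>_pres: "distr Z Z (\<phi> 0) = Z" and T\<phi>: "\<And>i z. T (\<phi> i z) = \<phi> (Suc i) (T z)"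
    and A [measurable]: "A \<in> sets Z" and inv: "AE z in Z. T z \<in> A \<longleftrightarrow> z \<in> A"
    and K [measurable]: "K \<in> sets Z" "K\<^sub>0 \<in> sets Z" and K0: "K\<^sub>0 \<subseteq> K"
    and \<phi>K: "\<And>i z. \<phi> i z \<in> K \<longleftrightarrow> z \<in> K" "\<And>z. \<phi> 0 z \<in> K\<^sub>0 \<longleftrightarrow> z \<in> K\<^sub>0"
    and rec: "AE z in Z. z \<in> K\<^sub>0 \<longrightarrow> infinite {n. (T ^^ n) z \<in> K}"
    and approx: "\<And>e. e > 0 \<Longrightarrow> \<exists>G\<in>sets Z. \<exists>N. emeasure Z (sym_diff A G \<inter> K) \<le> ennreal e \<and> (\<forall>n\<ge>N. \<forall>z. \<phi> n z \<in> G \<longleftrightarrow> z \<in> G)"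
  shows "AE z in Z. z \<in> K\<^sub>0 \<longrightarrow> (\<phi> 0 z \<in> A \<longleftrightarrow> z \<in> A)"
proof -
  have Tn [measurable]: "T ^^ n \<in> Z \<rightarrow>\<^sub>M Z" and Un [measurable]: "U ^^ n \<in> Z \<rightarrow>\<^sub>M Z" for n
    by (auto intro: measurable_compose_n)
  have UTn: "(U ^^ n) ((T ^^ n) z) = z" for n z
  proof (induction n)
    case (Suc n)
    then show ?case unfolding funpow_Suc_right[of n U] by (simp add: UT)
  qed simp
  have TUn: "(T ^^ n) ((U ^^ n) z) = z" for n z
  proof (induction n)
    case (Suc n)
    then show ?case unfolding funpow_Suc_right[of n T] by (simp add: UT)
  qed simp
  have T\<phi>n: "(T ^^ n) (\<phi> 0 z) = \<phi> n ((T ^^ n) z)" for n z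
    by (induction n) (simp_all add: T\<phi>)
  define D where "D = {z\<in>K\<^sub>0. (\<phi> 0 z \<in> A) \<noteq> (z \<in> A)}"
  have collect: "{z. P z} \<in> sets Z" if "Measurable.pred Z P" for P
    using that by (simp add: pred_def UNIV)
  have D [measurable]: "D \<in> sets Z" unfolding D_def by (rule collect) measurable
  have Q1: "AE z in Z. \<forall>n. (T ^^ n) z \<in> A \<longleftrightarrow> z \<in> A"
    using AE_invariant_power[OF T T_pres inv] by (simp add: AE_all_countable)
  have "AE z in distr Z Z (\<phi> 0). \<forall>n. (T ^^ n) z \<in> A \<longleftrightarrow> z \<in> A" using Q1 unfolding \<phi>_pres .
  from AE_distrD[OF \<phi> this] have Q2: "AE z in Z. \<forall>n. (T ^^ n) (\<phi> 0 z) \<in> A \<longleftrightarrow> \<phi> 0 z \<in> A" .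
  have bound: "emeasure Z D \<le> 2 * ennreal e" if "e > 0" for e
  proof -
    obtain G N where G [measurable]: "G \<in> sets Z" and GB: "emeasure Z (sym_diff A G \<inter> K) \<le> ennreal e"
      and GN: "\<And>n z. n \<ge> N \<Longrightarrow> \<phi> n z \<in> G \<longleftrightarrow> z \<in> G" using approx[OF \<open>e > 0\<close>] by blast
    define B where "B = sym_diff A G \<inter> K"
    have B [measurable]: "B \<in> sets Z" unfolding B_def by measurable
    define c where "c n z = card {i. i < n \<and> (T ^^ i) z \<in> K}" for n z
    have c_sum: "c n z = (\<Sum>i<n. if (T ^^ i) z \<in> K then 1 else 0)" for n z
    proof -
      have "c n z = (\<Sum>i\<in>{i\<in>{..<n}. (T ^^ i) z \<in> K}. 1)" by (simp add: c_def)
      also have "\<dots> = (\<Sum>i<n. if (T ^^ i) z \<in> K then 1 else 0)" by (rule sum.inter_filter) simp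
      finally show ?thesis .
    qed
    have sum_add: "(\<Sum>i<a + b. f i) = (\<Sum>i<a. f i) + (\<Sum>i<b. f (a + i))" for a b and f :: "nat \<Rightarrow> nat"
      by (induction b) simp_all
    have [measurable]: "c n \<in> Z \<rightarrow>\<^sub>M count_space UNIV" for n
      unfolding c_sum by measurable
    define E where "E n = {z. z \<in> K\<^sub>0 \<and> (T ^^ n) z \<in> K \<and> c n z = N}" for n
    have E [measurable]: "E n \<in> sets Z" for n
      unfolding E_def by (rule collect) measurable
    have E\<phi>: "\<phi> 0 z \<in> E n \<longleftrightarrow> z \<in> E n" for n z
      by (simp add: E_def c_def T\<phi>n \<phi>K)
    define F where "F n = E n \<inter> (T ^^ n) -` B" for n
    have F [measurable]: "F n \<in> sets Z" for n
      using measurable_sets[OF Tn B, of n] by (simp add: F_def UNIV)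
    have F\<phi> [measurable]: "\<phi> 0 -` F n \<in> sets Z" for n
      using measurable_sets[OF \<phi> F, of n] by (simp add: UNIV)
    have sub: "AE z in Z. z \<in> D \<longrightarrow> z \<in> (\<Union>n. F n \<union> \<phi> 0 -` F n)"
      using Q1 Q2 rec
    proof eventually_elim
      case (elim z)
      show ?case
      proof
        assume z: "z \<in> D"
        then have "infinite {n. (T ^^ n) z \<in> K}" using elim by (simp add: D_def)
        from exists_index_with_count[OF this, of N]
        obtain n where n: "(T ^^ n) z \<in> K" "c n z = N"
          by (auto simp: c_def conj_commute)
        then have En: "z \<in> E n" using z by (simp add: E_def D_def)
        have "card {i. i < n \<and> (T ^^ i) z \<in> K} \<le> card {..<n}" by (intro card_mono) auto
        then have "N \<le> n" using n by (simp add: c_def)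
        then have g: "(T ^^ n) (\<phi> 0 z) \<in> G \<longleftrightarrow> (T ^^ n) z \<in> G" using GN[of n] by (simp add: T\<phi>n)
        have "((T ^^ n) (\<phi> 0 z) \<in> A) \<noteq> ((T ^^ n) z \<in> A)"
          using elim z by (simp add: D_def)
        with g have "(T ^^ n) (\<phi> 0 z) \<in> sym_diff A G \<or> (T ^^ n) z \<in> sym_diff A G" by blast
        moreover have "(T ^^ n) (\<phi> 0 z) \<in> K" using n by (simp add: T\<phi>n \<phi>K)
        ultimately have "(T ^^ n) (\<phi> 0 z) \<in> B \<or> (T ^^ n) z \<in> B" using n(1) by (auto simp: B_def)
        then have "z \<in> F n \<union> \<phi> 0 -` F n"
          using En E\<phi>[of z n] by (auto simp: F_def)
        then show "z \<in> (\<Union>n. F n \<union> \<phi> 0 -` F n)" by blast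
      qed
    qed
    define C where "C n = (U ^^ n) -` E n" for n
    have C [measurable]: "C n \<in> sets Z" for n
      using measurable_sets[OF Un E, of n] by (simp add: C_def UNIV)
    have F_eq: "emeasure Z (F n) = emeasure Z (C n \<inter> B)" for n
    proof -
      have "emeasure Z (C n \<inter> B) = emeasure (distr Z Z (T ^^ n)) (C n \<inter> B)"
        by (simp add: AE_invariant_power(1)[OF T T_pres inv])
      also have "\<dots> = emeasure Z ((T ^^ n) -` (C n \<inter> B) \<inter> space Z)" by (rule emeasure_distr) auto
      also have "(T ^^ n) -` (C n \<inter> B) \<inter> space Z = F n" by (auto simp: F_def C_def UTn UNIV)
      finally show ?thesis by simp
    qed
    have "disjoint_family (\<lambda>n. C n \<inter> B)"
    proof -
      have False if z: "z \<in> C n" "z \<in> C n'" and less: "n < n'" for z n n'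
      proof -
        define x where "x = (U ^^ n') z"
        have x: "(T ^^ (n' - n)) x = (U ^^ n) z"
        proof -
          have "(U ^^ n') z = (U ^^ (n' - n)) ((U ^^ n) z)"
            using less by (metis add_diff_inverse_nat comp_apply funpow_add not_less_iff_gr_or_eq add.commute)
          then show ?thesis unfolding x_def by (simp add: TUn)
        qed
        have cn': "c n' x = N" "x \<in> K" using z K0 by (auto simp: C_def E_def x_def)
        have cn: "c n ((T ^^ (n' - n)) x) = N" using z unfolding x by (simp add: C_def E_def)
        \<comment> \<open>the visit at time 0, which is in \<open>K\<close>, makes the first summand positive\<close>
        have "c n' x = c (n' - n) x + c n ((T ^^ (n' - n)) x)"
        proof -
          have "c n' x = (\<Sum>i<(n' - n) + n. if (T ^^ i) x \<in> K then 1 else 0)" using less by (simp add: c_sum)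
          also have "\<dots> = c (n' - n) x + (\<Sum>i<n. if (T ^^ ((n' - n) + i)) x \<in> K then 1 else 0)"
            unfolding c_sum by (rule sum_add)
          finally show ?thesis by (simp add: c_sum funpow_add add.commute)
        qed
        moreover have "c (n' - n) x > 0"
        proof -
          have "0 \<in> {i. i < n' - n \<and> (T ^^ i) x \<in> K}" using cn' less by simp
          then show ?thesis unfolding c_def by (subst card_gt_0_iff) (auto intro!: exI[of _ 0])
        qed
        ultimately show False using cn cn' by simp
      qed
      then show ?thesis unfolding disjoint_family_on_def by (metis Int_iff disjoint_iff linorder_neqE_nat)
    qed
    then have sumF: "(\<Sum>n. emeasure Z (F n)) = emeasure Z (\<Union>n. C n \<inter> B)"
      unfolding F_eq by (intro suminf_emeasure) auto
    have "emeasure Z D \<le> emeasure Z (\<Union>n. F n \<union> \<phi> 0 -` F n)"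
      using sub by (intro emeasure_mono_AE) auto
    also have "\<dots> \<le> (\<Sum>n. emeasure Z (F n \<union> \<phi> 0 -` F n))"
      by (intro emeasure_subadditive_countably) auto
    also have "\<dots> \<le> (\<Sum>n. 2 * emeasure Z (F n))"
    proof (intro suminf_le allI)
      fix n
      have "emeasure Z (\<phi> 0 -` F n) = emeasure (distr Z Z (\<phi> 0)) (F n)"
        by (subst emeasure_distr) (auto simp: UNIV)
      then have "emeasure Z (\<phi> 0 -` F n) = emeasure Z (F n)" by (simp add: \<phi>_pres)
      then show "emeasure Z (F n \<union> \<phi> 0 -` F n) \<le> 2 * emeasure Z (F n)"
        using emeasure_subadditive[of "F n" Z "\<phi> 0 -` F n"] by (simp add: mult_2)
    qed auto
    also have "\<dots> = 2 * emeasure Z (\<Union>n. C n \<inter> B)"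
      by (simp add: sumF)
    also have "\<dots> \<le> 2 * emeasure Z B" by (intro mult_left_mono emeasure_mono) auto
    also have "\<dots> \<le> 2 * ennreal e" using GB by (intro mult_left_mono) (auto simp: B_def)
    finally show ?thesis .
  qed
  have "emeasure Z D \<le> 0"
  proof (rule ennreal_le_epsilon)
    fix e :: real assume "0 < e"
    then show "emeasure Z D \<le> 0 + ennreal e"
      using bound[of "e / 2"] by (simp add: ennreal_mult[symmetric] flip: ennreal_numeral)
  qed
  then have "AE z in Z. z \<notin> D" by (intro AE_not_in) (auto intro: null_setsI)
  then show ?thesis by eventually_elim (auto simp: D_def)
qed

text \<open>The sets that can be approximated from the algebra form a \<open>\<sigma>\<close>-algebra: a countable union is first cut
  off to a finite one, whose members are approximated with geometrically decreasing errors.\<close>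

lemma (in finite_measure) approximation_by_algebra:
  assumes alg: "algebra (space M) \<A>" and gen: "sets M = sigma_sets (space M) \<A>"
    and A: "A \<in> sets M" and e: "e > 0"
  shows "\<exists>G\<in>\<A>. measure M (sym_diff A G) < e"
proof -
  interpret alg: algebra "space M" \<A> by fact
  have sub: "G \<in> sets M" if "G \<in> \<A>" for G using that gen by (simp add: sigma_sets.Basic)
  have "A \<in> sigma_sets (space M) \<A>" using A gen by simp
  then have "\<forall>e>0. \<exists>G\<in>\<A>. measure M (sym_diff A G) < e"
  proof induction
    case (Basic a)
    then show ?case by (intro allI impI bexI[of _ a]) auto
  next
    case Empty
    then show ?case by (intro allI impI bexI[of _ "{}"]) auto
  next
    case (Compl a)
    have a: "a \<subseteq> space M" using Compl.hyps gen sets.sets_into_space by metis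
    show ?case
    proof (intro allI impI)
      fix e :: real assume "e > 0"
      then obtain G where G: "G \<in> \<A>" "measure M (sym_diff a G) < e" using Compl.IH by blast
      have "sym_diff (space M - a) (space M - G) = sym_diff a G"
        using a alg.sets_into_space[OF G(1)] by blast
      with G show "\<exists>G\<in>\<A>. measure M (sym_diff (space M - a) G) < e"
        by (intro bexI[of _ "space M - G"]) auto
    qed
  next
    case (Union a)
    have a: "a i \<in> sets M" for i using Union.hyps gen by metis
    show ?case
    proof (intro allI impI)
      fix e :: real assume e: "e > 0"
      have "\<forall>i. \<exists>G\<in>\<A>. measure M (sym_diff (a i) G) < e / 2 / 2 ^ Suc i"
        using Union.IH e by simp
      then obtain G where G: "\<And>i. G i \<in> \<A>" "\<And>i. measure M (sym_diff (a i) (G i)) < e / 2 / 2 ^ Suc i" by metis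
      have "(\<lambda>n. measure M (\<Union>i<n. a i)) \<longlonglongrightarrow> measure M (\<Union>n. \<Union>i<n. a i)"
        using a by (intro finite_Lim_measure_incseq) (force simp: incseq_def)+
      moreover have "(\<Union>n. \<Union>i<n. a i) = (\<Union>i. a i)" by blast
      ultimately have "(\<lambda>n. measure M (\<Union>i<n. a i)) \<longlonglongrightarrow> measure M (\<Union>i. a i)" by simp
      then obtain n where n: "dist (measure M (\<Union>i<n. a i)) (measure M (\<Union>i. a i)) < e / 2"
        using e unfolding lim_sequentially by (meson half_gt_zero order_refl)
      let ?G = "\<Union>i<n. G i"
      have Gs: "G i \<in> sets M" for i using sub G by blast
      have "?G \<in> \<A>" using G by (intro alg.finite_UN) auto
      have 1: "measure M ((\<Union>i. a i) - (\<Union>i<n. a i)) < e / 2"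
      proof -
        have "measure M ((\<Union>i. a i) - (\<Union>i<n. a i)) = measure M (\<Union>i. a i) - measure M (\<Union>i<n. a i)"
          using a by (intro finite_measure_Diff) auto
        then show ?thesis using n unfolding dist_real_def by linarith
      qed
      have 2: "measure M (\<Union>i<n. sym_diff (a i) (G i)) \<le> e / 2"
      proof -
        have "measure M (\<Union>i<n. sym_diff (a i) (G i)) \<le> (\<Sum>i<n. measure M (sym_diff (a i) (G i)))"
          using a Gs by (intro finite_measure_subadditive_finite) auto
        also have "\<dots> \<le> (\<Sum>i<n. e / 2 * (1 / 2) ^ Suc i)"
          using G(2) by (intro sum_mono) (auto simp: power_divide intro!: less_imp_le)
        also have "\<dots> \<le> (\<Sum>i. e / 2 * (1 / 2) ^ Suc i)"
          using e by (intro sum_le_suminf summable_mult sums_summable[OF power_half_series]) auto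
        also have "\<dots> = e / 2" using sums_unique[OF sums_mult[OF power_half_series, of "e / 2"]] by simp
        finally show ?thesis .
      qed
      have "measure M (sym_diff (\<Union>i. a i) ?G) \<le> measure M (((\<Union>i. a i) - (\<Union>i<n. a i)) \<union> (\<Union>i<n. sym_diff (a i) (G i)))"
        using a Gs by (intro finite_measure_mono) auto
      also have "\<dots> \<le> measure M ((\<Union>i. a i) - (\<Union>i<n. a i)) + measure M (\<Union>i<n. sym_diff (a i) (G i))"
        using a Gs by (intro measure_Un_le) auto
      also have "\<dots> < e" using 1 2 by simp
      finally show "\<exists>G\<in>\<A>. measure M (sym_diff (\<Union> (range a)) G) < e"
        using \<open>?G \<in> \<A>\<close> by (intro bexI[of _ ?G]) auto
    qed
  qed
  with e show ?thesis by blast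
qed

text \<open>The function \<open>exp s * g s\<close> has the periods \<open>r i\<close>; monotonicity controls \<open>g\<close> between two neighbouring
  multiples of a small period.\<close>

lemma exp_decay_of_quasiperiods:
  fixes g :: "real \<Rightarrow> real" and r :: "nat \<Rightarrow> real"
  assumes mono: "antimono g" and r: "\<And>i. 0 < r i" "r \<longlonglongrightarrow> 0" and per: "\<And>i s. g (s + r i) = exp (- r i) * g s"
  shows "g s = exp (- s) * g 0"
proof -
  have mult: "g (of_int k * r i) = exp (- (of_int k * r i)) * g 0" for k i
  proof (induction k rule: int_induct[where k=0])
    case (step1 k)
    have "g (of_int (k + 1) * r i) = exp (- r i) * g (of_int k * r i)"
      using per[of "of_int k * r i" i] by (simp add: algebra_simps)
    also have "\<dots> = exp (- (of_int (k + 1) * r i)) * g 0"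
      by (simp add: step1 mult.assoc[symmetric] exp_add[symmetric] algebra_simps del: exp_add)
    finally show ?case .
  next
    case (step2 k)
    have "exp (- r i) * g (of_int (k - 1) * r i) = g (of_int k * r i)"
      using per[of "of_int (k - 1) * r i" i] by (simp add: algebra_simps)
    also have "\<dots> = exp (- r i) * (exp (- (of_int (k - 1) * r i)) * g 0)"
      by (simp add: step2 mult.assoc[symmetric] exp_add[symmetric] algebra_simps del: exp_add)
    finally show ?case by simp
  qed simp
  have upper: "g s \<le> exp (- s + r i) * g 0" and lower: "exp (- s - r i) * g 0 \<le> g s" and g0: "0 \<le> g 0" for i
  proof -
    have "g (0 + r i) \<le> g 0" using r(1)[of i] by (intro antimonoD[OF mono]) simp
    then have "(1 - exp (- r i)) * g 0 \<ge> 0" using per[of 0 i] by (simp add: algebra_simps)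
    moreover have "0 < 1 - exp (- r i)" using r(1)[of i] by simp
    ultimately show g0: "0 \<le> g 0" by (simp add: zero_le_mult_iff)
    define k where "k = \<lfloor>s / r i\<rfloor>"
    have "of_int k \<le> s / r i" "s / r i < of_int k + 1" unfolding k_def by linarith+
    then have k: "of_int k * r i \<le> s" "s \<le> of_int (k + 1) * r i"
      using r(1)[of i] by (simp_all add: field_simps)
    have "g s \<le> exp (- (of_int k * r i)) * g 0"
      using antimonoD[OF mono k(1)] by (simp only: mult)
    also have "\<dots> \<le> exp (- s + r i) * g 0"
      using g0 k(2) by (intro mult_right_mono) (auto simp: algebra_simps)
    finally show "g s \<le> exp (- s + r i) * g 0" .
    have "exp (- s - r i) * g 0 \<le> exp (- (of_int (k + 1) * r i)) * g 0"
      using g0 k(1) by (intro mult_right_mono) (auto simp: algebra_simps)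
    also have "\<dots> \<le> g s"
      using antimonoD[OF mono k(2)] by (simp only: mult)
    finally show "exp (- s - r i) * g 0 \<le> g s" .
  qed
  have "(\<lambda>i. exp (- s + r i) * g 0) \<longlonglongrightarrow> exp (- s + 0) * g 0"
    by (intro tendsto_intros r)
  then have 1: "g s \<le> exp (- s) * g 0"
    using upper by (intro LIMSEQ_le_const[of "\<lambda>i. exp (- s + r i) * g 0"]) auto
  have "(\<lambda>i. exp (- s - r i) * g 0) \<longlonglongrightarrow> exp (- s - 0) * g 0"
    by (intro tendsto_intros r)
  then have 2: "exp (- s) * g 0 \<le> g s"
    using lower by (intro LIMSEQ_le_const2[of "\<lambda>i. exp (- s - r i) * g 0"]) auto
  from 1 2 show ?thesis by (rule antisym)
qed

section \<open>Flipping coordinates in the Maharam extension\<close>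

abbreviation ext_bits :: "((int \<Rightarrow> bool) \<times> real) measure" where
  "ext_bits \<equiv> bits \<Otimes>\<^sub>M borel"

locale open_coins =
  fixes p :: "int \<Rightarrow> real"
  assumes coin_open: "\<And>j. 0 < p j \<and> p j < 1"
begin

abbreviation \<M> :: "((int \<Rightarrow> bool) \<times> real) measure" where
  "\<M> \<equiv> maharam_measure (coin_product p)"

interpretation \<mu>: prob_space "coin_product p" by (rule prob_space_coin_product)
interpretation L: sigma_finite_measure exp_line by (rule sigma_finite_exp_line)
interpretation \<M>: sigma_finite_measure \<M>
  by (rule sigma_finite_maharam_measure) (rule \<mu>.sigma_finite_measure_axioms)

lemma sets_\<M> [measurable_cong]: "sets \<M> = sets ext_bits"
  unfolding sets_maharam_measure by (intro sets_pair_measure_cong) auto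

lemma space_\<M>: "space \<M> = UNIV"
  by (simp add: maharam_measure_def space_pair_measure)

lemma sets_\<M>_Collect: "Measurable.pred ext_bits P \<Longrightarrow> {z. P z} \<in> sets \<M>"
  by (simp add: pred_def sets_\<M> space_pair_measure space_bits)

lemma sets_\<M>_Times: "C \<in> sets bits \<Longrightarrow> B \<in> sets borel \<Longrightarrow> C \<times> B \<in> sets \<M>"
  unfolding sets_\<M> by (rule pair_measureI)

lemma emeasure_\<M>_Times: "C \<in> sets bits \<Longrightarrow> B \<in> sets borel \<Longrightarrow> emeasure \<M> (C \<times> B) = emeasure (coin_product p) C * emeasure exp_line B"
  unfolding maharam_measure_eq by (intro L.emeasure_pair_measure_Times) auto

lemma vimage_sets_\<M>:
  assumes "f \<in> ext_bits \<rightarrow>\<^sub>M ext_bits" "X \<in> sets \<M>" shows "f -` X \<in> sets \<M>"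
  using measurable_sets[OF assms(1), of X] assms(2) by (simp add: sets_\<M> space_pair_measure space_bits)

lemma measurable_\<M>_iff: "f \<in> \<M> \<rightarrow>\<^sub>M \<M> \<longleftrightarrow> f \<in> ext_bits \<rightarrow>\<^sub>M ext_bits"
  by (intro arg_cong2[where f="(\<in>)"] measurable_cong_sets sets_\<M> refl)

abbreviation upper :: "real \<Rightarrow> ((int \<Rightarrow> bool) \<times> real) set" where
  "upper c \<equiv> UNIV \<times> {c..}"

lemma upper_sets [measurable]: "upper c \<in> sets ext_bits"
  by (rule pair_measureI) auto

lemma emeasure_upper: "emeasure \<M> (upper c) = ennreal (exp (- c))"
  using \<mu>.emeasure_space_1 by (simp add: emeasure_\<M>_Times emeasure_exp_line_atLeast)

lemma AE_upper:
  assumes "\<And>i::nat. AE z in \<M>. z \<in> upper (- real i) \<longrightarrow> P z" shows "AE z in \<M>. P z"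
proof -
  have "AE z in \<M>. \<forall>i::nat. z \<in> upper (- real i) \<longrightarrow> P z"
    unfolding AE_all_countable using assms by blast
  then show ?thesis
  proof eventually_elim
    case (elim z)
    obtain i :: nat where "- snd z \<le> real i" using real_arch_simple by blast
    then show ?case using elim[rule_format, of i] by (auto simp: mem_Times_iff)
  qed
qed

text \<open>Three maps on the extended space: the Maharam extension of a flip, the flip of the base alone, and
  the translation of the fibres. On the points with value 0 at \<open>j\<close> the first is the composition of the
  other two (see \<open>ext_flip_eq\<close>).\<close>

definition ext_flip :: "int \<Rightarrow> (int \<Rightarrow> bool) \<times> real \<Rightarrow> (int \<Rightarrow> bool) \<times> real" where
  "ext_flip j = skew (flip j) (flip_ratio p j)"

definition base_flip :: "int \<Rightarrow> (int \<Rightarrow> bool) \<times> real \<Rightarrow> (int \<Rightarrow> bool) \<times> real" where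
  "base_flip j z = (flip j (fst z), snd z)"

definition fibre_shift :: "real \<Rightarrow> (int \<Rightarrow> bool) \<times> real \<Rightarrow> (int \<Rightarrow> bool) \<times> real" where
  "fibre_shift r z = (fst z, snd z + r)"

lemma ext_flip_measurable [measurable]: "ext_flip j \<in> ext_bits \<rightarrow>\<^sub>M ext_bits"
  unfolding ext_flip_def by measurable

lemma base_flip_measurable [measurable]: "base_flip j \<in> ext_bits \<rightarrow>\<^sub>M ext_bits"
  unfolding base_flip_def by measurable

lemma fibre_shift_measurable [measurable]: "fibre_shift r \<in> ext_bits \<rightarrow>\<^sub>M ext_bits"
  unfolding fibre_shift_def by measurable

lemma flip_ratio_pos: "0 < flip_ratio p j w"
  using coin_open[of j] by (simp add: flip_ratio_def bit_prob_def)

lemma distr_ext_flip: "distr \<M> \<M> (ext_flip j) = \<M>"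
proof -
  have "distr \<M> (coin_product p \<Otimes>\<^sub>M borel) (ext_flip j) = \<M>"
    unfolding ext_flip_def
  proof (rule distr_skew)
    show "density (coin_product p) (\<lambda>x. ennreal (flip_ratio p j x)) = distr (coin_product p) (coin_product p) (flip j)"
      using distr_flip[of p j] coin_open distr_cong[of "coin_product p" "coin_product p" bits "coin_product p" "flip j" "flip j"] by simp
    show "flip j \<in> coin_product p \<rightarrow>\<^sub>M coin_product p" by measurable
    then show "flip j \<in> coin_product p \<rightarrow>\<^sub>M coin_product p" .
  qed (auto simp: flip_ratio_pos)
  moreover have "distr \<M> (coin_product p \<Otimes>\<^sub>M borel) (ext_flip j) = distr \<M> \<M> (ext_flip j)"
    by (intro distr_cong) (auto simp: sets_maharam_measure)
  ultimately show ?thesis by simp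
qed

lemma emeasure_base_flip:
  assumes E: "E \<in> sets \<M>" and c: "\<And>z. z \<in> E \<Longrightarrow> flip_ratio p j (fst z) = c"
  shows "emeasure \<M> (base_flip j -` E) = ennreal c * emeasure \<M> E"
proof -
  have [measurable]: "E \<in> sets ext_bits" using E by (simp add: sets_\<M>)
  have E' [measurable]: "E \<in> sets (coin_product p \<Otimes>\<^sub>M exp_line)" using E by (simp add: maharam_measure_def)
  define G where "G x = (\<integral>\<^sup>+y. indicator E (x, y) \<partial>exp_line)" for x
  have "G \<in> borel_measurable (coin_product p)"
    unfolding G_def by measurable
  then have [measurable]: "G \<in> borel_measurable bits" by simp
  have vE: "base_flip j -` E \<in> sets \<M>"
    by (rule vimage_sets_\<M>[OF base_flip_measurable E])
  have "emeasure \<M> (base_flip j -` E) = (\<integral>\<^sup>+x. G (flip j x) \<partial>coin_product p)"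
    unfolding emeasure_maharam_measure[OF vE] G_def
    by (intro nn_integral_cong) (auto simp: indicator_def base_flip_def)
  also have "\<dots> = (\<integral>\<^sup>+x. G x \<partial>distr (coin_product p) bits (flip j))"
    by (subst nn_integral_distr) auto
  also have "\<dots> = (\<integral>\<^sup>+x. ennreal (flip_ratio p j x) * G x \<partial>coin_product p)"
    unfolding distr_flip[OF coin_open] by (subst nn_integral_density) auto
  also have "\<dots> = (\<integral>\<^sup>+x. ennreal c * G x \<partial>coin_product p)"
  proof (intro nn_integral_cong)
    fix x
    show "ennreal (flip_ratio p j x) * G x = ennreal c * G x"
    proof (cases "\<exists>y. (x, y) \<in> E")
      case True
      then show ?thesis using c by force
    next
      case False
      then have "G x = 0" by (simp add: G_def indicator_def)
      then show ?thesis by simp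
    qed
  qed
  also have "\<dots> = ennreal c * emeasure \<M> E"
    unfolding emeasure_maharam_measure[OF E] G_def[symmetric] by (rule nn_integral_cmult) simp
  finally show ?thesis .
qed

lemma emeasure_fibre_shift:
  assumes E: "E \<in> sets \<M>"
  shows "emeasure \<M> (fibre_shift r -` E) = ennreal (exp r) * emeasure \<M> E"
proof -
  have E1 [measurable]: "E \<in> sets ext_bits" using E by (simp add: sets_\<M>)
  have E' [measurable]: "E \<in> sets (coin_product p \<Otimes>\<^sub>M exp_line)" using E by (simp add: maharam_measure_def)
  have vE: "fibre_shift r -` E \<in> sets \<M>"
    by (rule vimage_sets_\<M>[OF fibre_shift_measurable E])
  have "emeasure \<M> (fibre_shift r -` E) = (\<integral>\<^sup>+x. \<integral>\<^sup>+y. indicator E (x, y + r) \<partial>exp_line \<partial>coin_product p)"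
    unfolding emeasure_maharam_measure[OF vE]
    by (intro nn_integral_cong) (auto simp: indicator_def fibre_shift_def)
  also have "\<dots> = (\<integral>\<^sup>+x. ennreal (exp r) * (\<integral>\<^sup>+y. indicator E (x, y) \<partial>exp_line) \<partial>coin_product p)"
  proof (intro nn_integral_cong)
    fix x
    have "(\<lambda>y. indicator E (x, y) :: ennreal) \<in> borel_measurable borel"
      by (rule measurable_compose[where N="ext_bits"]) (auto simp: space_bits)
    then show "(\<integral>\<^sup>+y. indicator E (x, y + r) \<partial>exp_line) = ennreal (exp r) * (\<integral>\<^sup>+y. indicator E (x, y) \<partial>exp_line)"
      by (rule nn_integral_exp_line_shift)
  qed
  also have "\<dots> = ennreal (exp r) * emeasure \<M> E"
    unfolding emeasure_maharam_measure[OF E] by (rule nn_integral_cmult) measurable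
  finally show ?thesis .
qed

text \<open>A generator with two uses: boxes are invariant under all far flips, and their measure is explicit.\<close>

definition boxes :: "((int \<Rightarrow> bool) \<times> real) set set" where
  "boxes = {{w. \<forall>i\<in>J. w i \<in> F i} \<times> {s..} | J F s. finite J}"

lemma Int_stable_boxes: "Int_stable boxes"
proof (rule Int_stableI)
  fix a b assume "a \<in> boxes" "b \<in> boxes"
  then obtain J F s J' F' s' where ab: "finite J" "finite J'"
    "a = {w. \<forall>i\<in>J. w i \<in> F i} \<times> {s..}" "b = {w. \<forall>i\<in>J'. w i \<in> F' i} \<times> {s'..}"
    unfolding boxes_def by blast
  let ?F = "\<lambda>i. (if i \<in> J then F i else UNIV) \<inter> (if i \<in> J' then F' i else UNIV)"
  have "a \<inter> b = {w. \<forall>i\<in>J \<union> J'. w i \<in> ?F i} \<times> {max s s'..}" unfolding ab by auto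
  then show "a \<inter> b \<in> boxes" unfolding boxes_def
    using ab(1,2) by (intro CollectI exI[of _ "J \<union> J'"] exI[of _ ?F] exI[of _ "max s s'"] conjI) auto
qed

lemma boxes_sets: "boxes \<subseteq> sets \<M>"
  unfolding boxes_def by (auto intro!: sets_\<M>_Times)

lemma exhausted_by_upper: "(\<Union>i::nat. upper (- real i)) = UNIV"
proof -
  have "\<exists>i::nat. - real i \<le> x" for x using real_arch_simple[of "- x"] by (metis minus_le_iff)
  then show ?thesis by auto
qed

lemma sets_\<M>_eq_sigma_boxes: "sets \<M> = sigma_sets UNIV boxes"
proof
  show "sigma_sets UNIV boxes \<subseteq> sets \<M>"
    using sets.sigma_sets_subset[OF boxes_sets] by (simp add: space_\<M>)
  define S where "S = sigma UNIV boxes"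
  have S: "sets S = sigma_sets UNIV boxes" "space S = UNIV" by (simp_all add: S_def)
  have box: "{w. \<forall>i\<in>J. w i \<in> F i} \<times> {s..} \<in> sets S" if "finite J" for J F s
    unfolding S using that by (intro sigma_sets.Basic) (auto simp: boxes_def)
  have "fst \<in> S \<rightarrow>\<^sub>M bits"
  proof (rule measurable_PiM_single')
    fix i :: int
    show "(\<lambda>z. fst z i) \<in> S \<rightarrow>\<^sub>M count_space UNIV"
    proof (rule measurableI)
      fix B :: "bool set"
      have "(\<lambda>z. fst z i) -` B = (\<Union>k::nat. {w. \<forall>j\<in>{i}. w j \<in> B} \<times> {- real k..})"
      proof (rule set_eqI)
        fix z :: "(int \<Rightarrow> bool) \<times> real"
        obtain k :: nat where "- real k \<le> snd z" using real_arch_simple[of "- snd z"] by (metis minus_le_iff)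
        moreover have "z \<in> {w. \<forall>j\<in>{i}. w j \<in> B} \<times> {- real k..} \<longleftrightarrow> fst z i \<in> B \<and> - real k \<le> snd z" for k :: nat
          by (simp add: mem_Times_iff)
        ultimately show "z \<in> (\<lambda>z. fst z i) -` B \<longleftrightarrow> z \<in> (\<Union>k::nat. {w. \<forall>j\<in>{i}. w j \<in> B} \<times> {- real k..})"
          unfolding vimage_eq UN_iff by blast
      qed
      also have "\<dots> \<in> sets S"
      proof (rule sets.countable_UN)
        have "{w. \<forall>j\<in>{i}. w j \<in> B} \<times> {s..} \<in> sets S" for s by (rule box) simp
        then show "range (\<lambda>k::nat. {w. \<forall>j\<in>{i}. w j \<in> B} \<times> {- real k..}) \<subseteq> sets S"
          by (rule image_subsetI)
      qed
      finally show "(\<lambda>z. fst z i) -` B \<inter> space S \<in> sets S" by (simp add: S)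
    qed simp
  qed simp
  moreover have "snd \<in> S \<rightarrow>\<^sub>M borel"
  proof (rule borel_measurableI_ge)
    fix y
    have "{z \<in> space S. y \<le> snd z} = {w. \<forall>j\<in>{}. w j \<in> UNIV} \<times> {y..}" by (auto simp: S)
    then show "{z \<in> space S. y \<le> snd z} \<in> sets S" by (simp only: box finite.emptyI)
  qed
  ultimately have "(\<lambda>z. (fst z, snd z)) \<in> S \<rightarrow>\<^sub>M ext_bits" by (rule measurable_Pair)
  then have id: "(\<lambda>z. z) \<in> S \<rightarrow>\<^sub>M ext_bits" by simp
  show "sets \<M> \<subseteq> sigma_sets UNIV boxes"
    using measurable_sets[OF id] by (auto simp: sets_\<M> S)
qed

text \<open>Stands in for measurability with respect to finitely many coordinates and the height. It is the only
  consequence of that property which matters below, and it defines an algebra.\<close>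

definition eventually_flip_invariant :: "((int \<Rightarrow> bool) \<times> real) set \<Rightarrow> bool" where
  "eventually_flip_invariant G \<longleftrightarrow> (\<exists>N::nat. \<forall>j. int N \<le> \<bar>j\<bar> \<longrightarrow> (\<forall>z. base_flip j z \<in> G \<longleftrightarrow> z \<in> G))"

lemma approximation_by_flip_invariant:
  assumes A: "A \<in> sets \<M>" and e: "e > 0"
  shows "\<exists>G\<in>sets \<M>. eventually_flip_invariant G \<and> emeasure \<M> (sym_diff A G \<inter> upper c) \<le> ennreal e"
proof -
  define \<A> where "\<A> = {G \<in> sets \<M>. eventually_flip_invariant G}"
  have alg: "algebra UNIV \<A>"
    unfolding algebra_iff_Un
  proof (intro conjI ballI)
    show "\<A> \<subseteq> Pow UNIV" by simp
    show "{} \<in> \<A>" by (simp add: \<A>_def eventually_flip_invariant_def)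
    fix a assume a: "a \<in> \<A>"
    then show "UNIV - a \<in> \<A>"
      using sets.compl_sets[of a \<M>] by (auto simp: \<A>_def eventually_flip_invariant_def space_\<M>)
    fix b assume b: "b \<in> \<A>"
    obtain N where N: "\<And>j z. int N \<le> \<bar>j\<bar> \<Longrightarrow> base_flip j z \<in> a \<longleftrightarrow> z \<in> a"
      using a by (auto simp: \<A>_def eventually_flip_invariant_def)
    obtain N' where N': "\<And>j z. int N' \<le> \<bar>j\<bar> \<Longrightarrow> base_flip j z \<in> b \<longleftrightarrow> z \<in> b"
      using b by (auto simp: \<A>_def eventually_flip_invariant_def)
    have "eventually_flip_invariant (a \<union> b)"
      unfolding eventually_flip_invariant_def using N N' by (intro exI[of _ "max N N'"]) auto
    then show "a \<union> b \<in> \<A>" using a b by (auto simp: \<A>_def)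
  qed
  have gen: "sigma_sets UNIV \<A> = sets \<M>"
  proof
    show "sigma_sets UNIV \<A> \<subseteq> sets \<M>"
      using sets.sigma_sets_subset[of \<A> \<M>] by (auto simp: \<A>_def space_\<M>)
    have "boxes \<subseteq> \<A>"
    proof
      fix X assume X: "X \<in> boxes"
      then obtain J F s where J: "finite J" and X_eq: "X = {w. \<forall>i\<in>J. w i \<in> F i} \<times> {s..}"
        unfolding boxes_def by blast
      define N where "N = nat (Max (insert 0 (abs ` J)) + 1)"
      have N: "\<bar>i\<bar> < int N" if "i \<in> J" for i
      proof -
        have "\<bar>i\<bar> \<le> Max (insert 0 (abs ` J))" using that J by (intro Max_ge) auto
        then show ?thesis by (simp add: N_def)
      qed
      have "base_flip j z \<in> X \<longleftrightarrow> z \<in> X" if "int N \<le> \<bar>j\<bar>" for j z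
      proof -
        have "j \<notin> J" using N[of j] that by auto
        then have "flip j (fst z) i = fst z i" if "i \<in> J" for i using that by (auto simp: flip_apply)
        then show ?thesis by (auto simp: X_eq base_flip_def mem_Times_iff)
      qed
      then show "X \<in> \<A>"
        using X boxes_sets by (auto simp: \<A>_def eventually_flip_invariant_def)
    qed
    then show "sets \<M> \<subseteq> sigma_sets UNIV \<A>"
      unfolding sets_\<M>_eq_sigma_boxes by (rule sigma_sets_mono')
  qed
  have K [measurable]: "upper c \<in> sets \<M>" by (simp add: sets_\<M>)
  define M' where "M' = density \<M> (indicator (upper c))"
  have eM': "emeasure M' X = emeasure \<M> (upper c \<inter> X)" if "X \<in> sets \<M>" for X
    unfolding M'_def using that K by (rule emeasure_restricted[rotated])
  have sM': "sets M' = sets \<M>" "space M' = UNIV" by (simp_all add: M'_def space_\<M>)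
  interpret M': finite_measure M'
  proof
    show "emeasure M' (space M') \<noteq> \<infinity>"
      using eM'[of UNIV] sets.top[of \<M>] by (simp add: sM' space_\<M> emeasure_upper)
  qed
  have "\<exists>G\<in>\<A>. measure M' (sym_diff A G) < e"
    using alg gen A e by (intro M'.approximation_by_algebra) (auto simp: sM')
  then obtain G where G: "G \<in> \<A>" "measure M' (sym_diff A G) < e" by blast
  have AG: "sym_diff A G \<in> sets \<M>" using A G by (auto simp: \<A>_def)
  have "emeasure \<M> (sym_diff A G \<inter> upper c) = emeasure M' (sym_diff A G)"
    using eM'[OF AG] by (simp add: Int_commute)
  also have "\<dots> \<le> ennreal e"
    using G(2) by (simp add: M'.emeasure_eq_measure ennreal_leI less_imp_le)
  finally show ?thesis using G(1) by (auto simp: \<A>_def)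
qed

definition odds :: "int \<Rightarrow> real" where "odds j = p j / (1 - p j)"

lemma odds_pos: "0 < odds j" using coin_open[of j] by (simp add: odds_def)

lemma flip_ratio_odds: "flip_ratio p j w = (if w j then 1 / odds j else odds j)"
  by (simp add: flip_ratio_def bit_prob_def odds_def)

lemma ext_flip_eq: "\<not> fst z j \<Longrightarrow> ext_flip j z = base_flip j (fibre_shift (ln (odds j)) z)"
  by (cases z) (simp add: ext_flip_def skew_def base_flip_def fibre_shift_def flip_ratio_odds)

text \<open>Approximate \<open>A\<close> on \<open>K\<close> by a set \<open>G\<close> that ignores far coordinates, and take a far \<open>j\<close> with log-odds \<open>r\<close>.
  On the points with value 0 at \<open>j\<close> the extended flip maps \<open>z\<close> to the base flip of the translate of
  \<open>z\<close>; it preserves \<open>A\<close>, while \<open>G\<close> sees only the translation. So the set \<open>D\<close> where translation matters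
  for \<open>A\<close> has a small part with value 0 at \<open>j\<close>. This part is a fixed proportion of \<open>D\<close>, up to the
  approximation error, because the analogue \<open>G1\<close> of \<open>D\<close> for \<open>G\<close> is invariant under the flip at \<open>j\<close>.\<close>

lemma fibre_shift_invariance_of_essential_value:
  assumes A: "A \<in> sets \<M>" and inv: "\<And>j. AE z in \<M>. ext_flip j z \<in> A \<longleftrightarrow> z \<in> A"
    and r: "r \<ge> 0" and b: "\<And>j. odds j \<le> 2" and freq: "\<And>N::nat. \<exists>j. int N \<le> j \<and> ln (odds j) = r"
  shows "AE z in \<M>. fibre_shift r z \<in> A \<longleftrightarrow> z \<in> A"
proof (rule AE_upper)
  fix i0 :: nat
  define K where "K = upper (- real i0)"
  have A' [measurable]: "A \<in> sets ext_bits" using A by (simp add: sets_\<M>)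
  have K [measurable]: "K \<in> sets ext_bits" unfolding K_def by measurable
  have shiftK: "fibre_shift r z \<in> K" if "z \<in> K" for z using that r by (auto simp: K_def fibre_shift_def mem_Times_iff)
  have base_flipK: "base_flip j z \<in> K \<longleftrightarrow> z \<in> K" for j z by (auto simp: K_def base_flip_def mem_Times_iff)
  define D where "D = {z. z \<in> K \<and> (fibre_shift r z \<in> A) \<noteq> (z \<in> A)}"
  have D [measurable]: "D \<in> sets \<M>" unfolding D_def by (rule sets_\<M>_Collect) measurable
  have bound: "emeasure \<M> D \<le> ennreal (7 * (1 + exp r)) * ennreal e" if e: "e > 0" for e
  proof -
    obtain G where G [measurable]: "G \<in> sets \<M>" and Gf: "eventually_flip_invariant G"
      and Ge: "emeasure \<M> (sym_diff A G \<inter> K) \<le> ennreal e"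
      using approximation_by_flip_invariant[OF A e, of "- real i0"] unfolding K_def by blast
    have G' [measurable]: "G \<in> sets ext_bits" using G by (simp add: sets_\<M>)
    obtain N where N: "\<And>j z. int N \<le> \<bar>j\<bar> \<Longrightarrow> base_flip j z \<in> G \<longleftrightarrow> z \<in> G"
      using Gf by (auto simp: eventually_flip_invariant_def)
    obtain j where j: "int N \<le> j" "ln (odds j) = r" using freq by blast
    have Gj: "base_flip j z \<in> G \<longleftrightarrow> z \<in> G" for z using N[of j z] j by simp
    define B where "B = sym_diff A G \<inter> K"
    have B [measurable]: "B \<in> sets \<M>" unfolding B_def sets_\<M> by measurable
    have Be: "emeasure \<M> B \<le> ennreal e" using Ge by (simp add: B_def)
    define V where "V = {z :: (int \<Rightarrow> bool) \<times> real. \<not> fst z j}"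
    have V [measurable]: "V \<in> sets \<M>" unfolding V_def by (rule sets_\<M>_Collect) measurable
    define G1 where "G1 = {z. z \<in> K \<and> (fibre_shift r z \<in> G) \<noteq> (z \<in> G)}"
    have G1 [measurable]: "G1 \<in> sets \<M>" unfolding G1_def by (rule sets_\<M>_Collect) measurable
    have lB [measurable]: "fibre_shift r -` B \<in> sets \<M>" and fB [measurable]: "ext_flip j -` B \<in> sets \<M>"
      by (intro vimage_sets_\<M>; measurable)+
    let ?s = "emeasure \<M> B + emeasure \<M> (fibre_shift r -` B)"
    \<comment> \<open>translating back by \<open>r\<close> enlarges the measure by the factor \<open>exp r\<close>\<close>
    have s: "?s \<le> ennreal (1 + exp r) * ennreal e"
    proof -
      have "?s = ennreal (1 + exp r) * emeasure \<M> B"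
        by (simp add: emeasure_fibre_shift distrib_right ennreal_plus)
      also have "\<dots> \<le> ennreal (1 + exp r) * ennreal e" using Be by (intro mult_left_mono) auto
      finally show ?thesis .
    qed
    have 1: "emeasure \<M> (D \<inter> V) \<le> ?s"
    proof -
      have "emeasure \<M> (D \<inter> V) \<le> emeasure \<M> (ext_flip j -` B \<union> fibre_shift r -` B)"
      proof (rule emeasure_mono_AE)
        show "AE z in \<M>. z \<in> D \<inter> V \<longrightarrow> z \<in> ext_flip j -` B \<union> fibre_shift r -` B"
          using inv[of j]
        proof eventually_elim
          case (elim z)
          show ?case
          proof
            assume z: "z \<in> D \<inter> V"
            then have lf: "ext_flip j z = base_flip j (fibre_shift r z)" using ext_flip_eq[of z j] j by (simp add: V_def)
            have zK: "z \<in> K" "(fibre_shift r z \<in> A) \<noteq> (z \<in> A)" using z by (auto simp: D_def)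
            then have "(fibre_shift r z \<in> A) \<noteq> (ext_flip j z \<in> A)" using elim by simp
            moreover have "fibre_shift r z \<in> G \<longleftrightarrow> ext_flip j z \<in> G" unfolding lf Gj ..
            moreover have "fibre_shift r z \<in> K" "ext_flip j z \<in> K" using shiftK[OF zK(1)] by (auto simp: lf base_flipK)
            ultimately show "z \<in> ext_flip j -` B \<union> fibre_shift r -` B" by (auto simp: B_def)
          qed
        qed
      qed measurable
      also have "\<dots> \<le> emeasure \<M> (ext_flip j -` B) + emeasure \<M> (fibre_shift r -` B)"
        by (rule emeasure_subadditive) measurable
      also have "emeasure \<M> (ext_flip j -` B) = emeasure (distr \<M> \<M> (ext_flip j)) B"
        by (subst emeasure_distr) (auto simp: measurable_\<M>_iff space_\<M>)
      also have "\<dots> = emeasure \<M> B" by (simp add: distr_ext_flip)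
      finally show ?thesis .
    qed
    have DG: "D \<subseteq> G1 \<union> (B \<union> fibre_shift r -` B)" "G1 \<subseteq> D \<union> (B \<union> fibre_shift r -` B)"
      using shiftK by (auto simp: D_def G1_def B_def)
    have sub: "emeasure \<M> X \<le> emeasure \<M> Y + ?s" if "X \<subseteq> Y \<union> (B \<union> fibre_shift r -` B)" "Y \<in> sets \<M>" for X Y
    proof -
      have "emeasure \<M> X \<le> emeasure \<M> (Y \<union> (B \<union> fibre_shift r -` B))" using that by (intro emeasure_mono) auto
      also have "\<dots> \<le> emeasure \<M> Y + emeasure \<M> (B \<union> fibre_shift r -` B)" using that by (intro emeasure_subadditive) auto
      also have "\<dots> \<le> emeasure \<M> Y + ?s" by (intro add_left_mono emeasure_subadditive) auto
      finally show ?thesis .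
    qed
    have 2: "emeasure \<M> (G1 \<inter> V) \<le> ?s + ?s"
    proof -
      have "emeasure \<M> (G1 \<inter> V) \<le> emeasure \<M> (D \<inter> V) + ?s" using DG by (intro sub) auto
      then show ?thesis using 1 by (meson add_right_mono order_trans)
    qed
    have G1flip: "base_flip j z \<in> G1 \<longleftrightarrow> z \<in> G1" for z
    proof -
      have "fibre_shift r (base_flip j z) = base_flip j (fibre_shift r z)" by (simp add: fibre_shift_def base_flip_def)
      then show ?thesis by (simp add: G1_def base_flipK Gj)
    qed
    have 3: "emeasure \<M> (G1 - V) = ennreal (odds j) * emeasure \<M> (G1 \<inter> V)"
    proof -
      have "emeasure \<M> (base_flip j -` (G1 \<inter> V)) = ennreal (odds j) * emeasure \<M> (G1 \<inter> V)"
      proof (rule emeasure_base_flip)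
        show "G1 \<inter> V \<in> sets \<M>" using G1 V by (rule sets.Int)
      qed (auto simp: V_def flip_ratio_odds)
      moreover have "z \<in> base_flip j -` (G1 \<inter> V) \<longleftrightarrow> z \<in> G1 - V" for z
        using G1flip[of z] by (simp add: V_def) (simp add: base_flip_def flip_apply)
      then have "base_flip j -` (G1 \<inter> V) = G1 - V" by blast
      ultimately show ?thesis by simp
    qed
    have "emeasure \<M> D \<le> emeasure \<M> G1 + ?s" using DG by (intro sub) auto
    also have "emeasure \<M> G1 = emeasure \<M> (G1 \<inter> V) + emeasure \<M> (G1 - V)"
    proof -
      have "emeasure \<M> (G1 \<inter> V) + emeasure \<M> (G1 - V) = emeasure \<M> ((G1 \<inter> V) \<union> (G1 - V))"
        by (rule plus_emeasure) auto
      then show ?thesis by (simp add: Int_Diff_Un)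
    qed
    also have "\<dots> \<le> emeasure \<M> (G1 \<inter> V) + 2 * emeasure \<M> (G1 \<inter> V)"
    proof -
      have "ennreal (odds j) \<le> ennreal 2" by (intro ennreal_leI b)
      then have "ennreal (odds j) \<le> 2" by simp
      then show ?thesis unfolding 3 by (intro add_left_mono mult_right_mono) auto
    qed
    also have "\<dots> \<le> (?s + ?s) + 2 * (?s + ?s)" using 2 by (intro add_mono mult_left_mono) auto
    also have "(?s + ?s) + 2 * (?s + ?s) + ?s = 7 * ?s"
    proof -
      have seven: "(7::ennreal) = 1 + 1 + 1 + 1 + 1 + 1 + 1" and two: "(2::ennreal) = 1 + 1" by simp_all
      show ?thesis unfolding seven two by (simp only: distrib_right mult_1_left add.assoc)
    qed
    also have "\<dots> \<le> 7 * (ennreal (1 + exp r) * ennreal e)" using s by (intro mult_left_mono) auto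
    also have "\<dots> = ennreal (7 * (1 + exp r)) * ennreal e"
    proof -
      have "ennreal (7 * (1 + exp r)) = ennreal 7 * ennreal (1 + exp r)"
        by (rule ennreal_mult) (auto intro: add_nonneg_nonneg)
      then show ?thesis by (simp only: ennreal_numeral mult.assoc)
    qed
    finally show ?thesis by (simp add: add_right_mono)
  qed
  have "emeasure \<M> D \<le> 0"
  proof (rule ennreal_le_epsilon)
    fix e :: real assume "0 < e"
    have pos: "7 * (1 + exp r) > 0" by (simp add: add_pos_pos)
    have "emeasure \<M> D \<le> ennreal (7 * (1 + exp r)) * ennreal (e / (7 * (1 + exp r)))"
      using \<open>0 < e\<close> pos by (intro bound divide_pos_pos)
    also have "\<dots> = ennreal e"
      using \<open>0 < e\<close> pos by (subst ennreal_mult[symmetric]) auto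
    finally show "emeasure \<M> D \<le> 0 + ennreal e" by simp
  qed
  then have "AE z in \<M>. z \<notin> D" using D by (intro AE_not_in) (auto intro: null_setsI)
  then show "AE z in \<M>. z \<in> upper (- real i0) \<longrightarrow> (fibre_shift r z \<in> A \<longleftrightarrow> z \<in> A)"
    by eventually_elim (auto simp: D_def K_def)
qed

section \<open>Sets invariant under all flips and under small translations\<close>

lemma AE_fst_\<M>:
  assumes "AE w in coin_product p. P w" shows "AE z in \<M>. P (fst z)"
proof -
  obtain N where N: "N \<in> null_sets (coin_product p)" "{w. \<not> P w} \<subseteq> N"
    using assms by (auto simp: eventually_ae_filter)
  have "N \<times> UNIV \<in> null_sets \<M>"
  proof (rule null_setsI)
    have "N \<in> sets bits" using N(1) by auto
    then show "N \<times> UNIV \<in> sets \<M>" by (intro sets_\<M>_Times) auto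
    from \<open>N \<in> sets bits\<close> show "emeasure \<M> (N \<times> UNIV) = 0"
      using N(1) by (subst emeasure_\<M>_Times) auto
  qed
  then show ?thesis by (rule AE_I') (use N(2) in auto)
qed

text \<open>Let \<open>R\<close> be the measure restricted to \<open>A\<close>. Invariance under small translations makes
  \<open>R (C \<times> {s..})\<close> proportional to \<open>exp (- s)\<close>, with a factor \<open>v C\<close>. Invariance under flips forces \<open>v\<close> to
  divide a cylinder at a new coordinate in the ratio of the coin there, so \<open>v\<close> is on cylinders a
  multiple of the coin product. Hence \<open>R\<close> is \<open>c\<close> times the whole measure on all boxes, so on all
  measurable sets, and an indicator function with the constant value \<open>c\<close> is 0 or 1.\<close>

lemma invariant_under_flips_and_shifts_trivial:
  fixes r :: "nat \<Rightarrow> real"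
  assumes A: "A \<in> sets \<M>" and inv: "\<And>j. AE z in \<M>. ext_flip j z \<in> A \<longleftrightarrow> z \<in> A"
    and r: "\<And>i. 0 < r i" "r \<longlonglongrightarrow> 0" and linv: "\<And>i. AE z in \<M>. fibre_shift (r i) z \<in> A \<longleftrightarrow> z \<in> A"
  shows "(AE z in \<M>. z \<notin> A) \<or> (AE z in \<M>. z \<in> A)"
proof -
  define R where "R X = emeasure \<M> (A \<inter> X)" for X
  have R_lift: "R (fibre_shift (r i) -` X) = ennreal (exp (r i)) * R X" and R_flip: "R (ext_flip j -` X) = R X"
    if X: "X \<in> sets \<M>" for X i j
  proof -
    have AX: "A \<inter> X \<in> sets \<M>" using A X by blast
    have "R (fibre_shift (r i) -` X) = emeasure \<M> (fibre_shift (r i) -` (A \<inter> X))"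
      unfolding R_def using linv[of i] A X by (intro emeasure_eq_AE) (auto intro!: vimage_sets_\<M>)
    then show "R (fibre_shift (r i) -` X) = ennreal (exp (r i)) * R X"
      by (simp only: emeasure_fibre_shift[OF AX] R_def)
    have "R (ext_flip j -` X) = emeasure \<M> (ext_flip j -` (A \<inter> X))"
      unfolding R_def using inv[of j] A X by (intro emeasure_eq_AE) (auto intro!: vimage_sets_\<M>)
    also have "\<dots> = emeasure (distr \<M> \<M> (ext_flip j)) (A \<inter> X)"
      using AX by (subst emeasure_distr) (auto simp: measurable_\<M>_iff space_\<M>)
    finally show "R (ext_flip j -` X) = R X" by (simp only: distr_ext_flip R_def)
  qed
  have CB: "C \<times> {s..} \<in> sets \<M>" if "C \<in> sets bits" for C and s :: real
    using that by (intro sets_\<M>_Times) auto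
  have fin: "R (C \<times> {s..}) < \<top>" for C s
  proof -
    have "R (C \<times> {s..}) \<le> emeasure \<M> (upper s)"
      unfolding R_def by (intro emeasure_mono) (auto simp: sets_\<M>)
    then show ?thesis by (simp add: emeasure_upper le_less_trans)
  qed
  have R_exp: "R (C \<times> {s..}) = ennreal (exp (- s)) * R (C \<times> {0..})" if C: "C \<in> sets bits" for C s
  proof -
    have "enn2real (R (C \<times> {s..})) = exp (- s) * enn2real (R (C \<times> {0..}))"
    proof (rule exp_decay_of_quasiperiods[OF _ r])
      show "antimono (\<lambda>s. enn2real (R (C \<times> {s..})))"
        unfolding R_def using A CB[OF C] fin[of C]
        by (intro antimonoI enn2real_mono emeasure_mono) (auto simp: R_def)
      fix i s
      have "fibre_shift (r i) -` (C \<times> {s + r i..}) = C \<times> {s..}" by (auto simp: fibre_shift_def)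
      then have "R (C \<times> {s..}) = ennreal (exp (r i)) * R (C \<times> {s + r i..})"
        using R_lift[OF CB[OF C], of i "s + r i"] by simp
      then show "enn2real (R (C \<times> {s + r i..})) = exp (- r i) * enn2real (R (C \<times> {s..}))"
        by (simp add: enn2real_mult exp_minus)
    qed
    then have "ennreal (enn2real (R (C \<times> {s..}))) = ennreal (exp (- s)) * ennreal (enn2real (R (C \<times> {0..})))"
      by (simp add: ennreal_mult)
    then show ?thesis by (simp only: ennreal_enn2real fin)
  qed
  define v where "v C = R (C \<times> {0..})" for C
  define c where "c = v UNIV"
  have split: "v (C \<inter> {w. w j}) = ennreal (p j) * v C" "v (C \<inter> {w. \<not> w j}) = ennreal (1 - p j) * v C"
    if C: "C \<in> sets bits" and Cj: "flip j -` C = C" for C j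
  proof -
    let ?C1 = "C \<inter> {w. w j}" and ?C0 = "C \<inter> {w. \<not> w j}"
    have C1: "?C1 \<in> sets bits" and C0: "?C0 \<in> sets bits"
      using C by (auto intro!: sets.Int sets_Collect_bits)
    have "ext_flip j -` (?C1 \<times> {ln (odds j)..}) = ?C0 \<times> {0..}"
    proof (rule set_eqI)
      fix z :: "(int \<Rightarrow> bool) \<times> real"
      have "flip j (fst z) \<in> C \<longleftrightarrow> fst z \<in> C" using Cj by auto
      then show "z \<in> ext_flip j -` (?C1 \<times> {ln (odds j)..}) \<longleftrightarrow> z \<in> ?C0 \<times> {0..}"
        by (cases z) (auto simp: ext_flip_def skew_def flip_apply flip_ratio_odds)
    qed
    then have "v ?C0 = ennreal (exp (- ln (odds j))) * v ?C1"
      using R_flip[OF CB[OF C1], of j "ln (odds j)"] R_exp[OF C1, of "ln (odds j)"] by (simp add: v_def)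
    then have 0: "v ?C0 = ennreal (1 / odds j) * v ?C1"
      using odds_pos[of j] by (simp add: exp_minus inverse_eq_divide)
    have "v C = v ?C1 + v ?C0"
      unfolding v_def R_def using A CB[OF C1] CB[OF C0]
      by (subst plus_emeasure) (auto intro!: arg_cong[where f="emeasure \<M>"])
    also have "\<dots> = ennreal (1 + 1 / odds j) * v ?C1"
      using odds_pos[of j] by (simp add: 0 ennreal_plus distrib_right)
    also have "1 + 1 / odds j = 1 / p j"
      using coin_open[of j] by (simp add: odds_def field_simps)
    finally have "ennreal (p j) * v C = ennreal (p j * (1 / p j)) * v ?C1"
      using coin_open[of j] by (simp only: ennreal_mult less_imp_le mult.assoc zero_le_divide_1_iff)
    then show 1: "v ?C1 = ennreal (p j) * v C"
      using coin_open[of j] by simp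
    have "v ?C0 = ennreal (1 / odds j * p j) * v C"
      using coin_open[of j] odds_pos[of j] by (simp only: 0 1 ennreal_mult less_imp_le mult.assoc zero_le_divide_1_iff)
    also have "1 / odds j * p j = 1 - p j"
      using coin_open[of j] by (simp add: odds_def)
    finally show "v ?C0 = ennreal (1 - p j) * v C" .
  qed
  have v_cyl: "v {w. \<forall>i\<in>J. w i \<in> F i} = emeasure (coin_product p) {w. \<forall>i\<in>J. w i \<in> F i} * c" if "finite J" for J F
    unfolding emeasure_cylinder[OF that] using that
  proof induction
    case empty
    then show ?case by (simp add: c_def)
  next
    case (insert j J)
    let ?C = "{w. \<forall>i\<in>J. w i \<in> F i}"
    have C: "?C \<in> sets bits" using insert.hyps by (intro cylinder_measurable)
    have Cj: "flip j -` ?C = ?C" using insert.hyps(2) by (auto simp: flip_apply)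
    let ?X = "if True \<in> F j then ?C \<inter> {w. w j} else {}" and ?Y = "if False \<in> F j then ?C \<inter> {w. \<not> w j} else {}"
    have XY: "?X \<in> sets bits" "?Y \<in> sets bits"
      using C by (auto intro!: sets.Int sets_Collect_bits)
    have "{w. \<forall>i\<in>insert j J. w i \<in> F i} = ?X \<union> ?Y" (is "?L = _")
    proof (rule set_eqI)
      fix w show "w \<in> ?L \<longleftrightarrow> w \<in> ?X \<union> ?Y" by (cases "w j") auto
    qed
    moreover have "v (?X \<union> ?Y) = v ?X + v ?Y"
      unfolding v_def R_def Sigma_Un_distrib1 Int_Un_distrib
      using A CB[OF XY(1)] CB[OF XY(2)] by (intro plus_emeasure[symmetric]) auto
    moreover have "v ?X = ennreal (p j) * indicator (F j) True * v ?C" "v ?Y = ennreal (1 - p j) * indicator (F j) False * v ?C"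
      using split[OF C Cj] by (auto simp: v_def R_def)
    moreover have "emeasure (bernoulli_pmf (p j)) (F j) = ennreal (p j) * indicator (F j) True + ennreal (1 - p j) * indicator (F j) False"
      using coin_open[of j] nn_integral_bernoulli[of "p j" "indicator (F j)"] by simp
    ultimately have "v ?L = emeasure (bernoulli_pmf (p j)) (F j) * v ?C"
      by (simp only: distrib_right)
    then show ?case using insert by (simp add: mult.assoc)
  qed
  have "density \<M> (indicator A) = density \<M> (\<lambda>_. c)"
  proof (rule measure_eqI_generator_eq[OF Int_stable_boxes, where \<Omega>=UNIV and A="\<lambda>i::nat. upper (- real i)"])
    fix X assume "X \<in> boxes"
    then obtain J F s where J: "finite J" and X: "X = {w. \<forall>i\<in>J. w i \<in> F i} \<times> {s..}" (is "X = ?C \<times> _")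
      unfolding boxes_def by blast
    have C: "?C \<in> sets bits" using J by (rule cylinder_measurable)
    have "emeasure (density \<M> (indicator A)) X = R X"
      using A CB[OF C] unfolding R_def X by (rule emeasure_restricted)
    also have "\<dots> = ennreal (exp (- s)) * v ?C" unfolding X v_def by (rule R_exp[OF C])
    also have "\<dots> = emeasure (density \<M> (\<lambda>_. c)) X"
      using CB[OF C] by (simp add: X v_cyl[OF J] emeasure_density_const emeasure_\<M>_Times[OF C] emeasure_exp_line_atLeast mult_ac)
    finally show "emeasure (density \<M> (indicator A)) X = emeasure (density \<M> (\<lambda>_. c)) X" .
  next
    show "range (\<lambda>i::nat. upper (- real i)) \<subseteq> boxes"
      unfolding boxes_def by (auto intro!: exI[of _ "{} :: int set"])
    show "emeasure (density \<M> (indicator A)) (upper (- real i)) \<noteq> \<infinity>" for i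
      using fin[of UNIV "- real i"] A by (subst emeasure_restricted) (auto simp: R_def sets_\<M>)
  qed (auto simp: sets_\<M>_eq_sigma_boxes exhausted_by_upper)
  then have ind: "AE z in \<M>. indicator A z = c"
    using A by (subst (asm) \<M>.density_unique_iff) auto
  show ?thesis
  proof (cases "c = 0")
    case True
    have "AE z in \<M>. z \<notin> A" using ind by eventually_elim (auto simp: True indicator_def split: if_splits)
    then show ?thesis ..
  next
    case False
    have "AE z in \<M>. z \<in> A" using ind by eventually_elim (use False in \<open>auto simp: indicator_def split: if_splits\<close>)
    then show ?thesis ..
  qed
qed

end

section \<open>The block structure of the measure\<close>

lemma pullback_coin_product:
  "pullback_measure (coin_product p) full_shift l = coin_product (\<lambda>i. p (i - int l))"
proof -
  have "pullback_measure (coin_product p) full_shift l = distr (coin_product p) bits (unshift ^^ l)"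
    unfolding pullback_measure_def by (intro distr_cong) (auto simp: inv_full_shift)
  then show ?thesis by (simp add: distr_unshift_power)
qed

text \<open>The link between the abstract Radon-Nikodym derivatives of the shift and the explicit products below.\<close>

lemma rn_power_coin_product:
  assumes [measurable]: "f \<in> borel_measurable bits" and f: "\<And>w. 0 \<le> f w"
    and "density (coin_product p) (\<lambda>w. ennreal (f w)) = coin_product (\<lambda>i. p (i - int l))"
  shows "AE w in coin_product p. rn_power (coin_product p) full_shift l w = f w"
proof -
  interpret prob_space "coin_product p" by (rule prob_space_coin_product)
  have "AE w in coin_product p. ennreal (f w) = RN_deriv (coin_product p) (coin_product (\<lambda>i. p (i - int l))) w"
    using assms(3) by (intro RN_deriv_unique) auto
  then show ?thesis
    by eventually_elim (metis rn_power_def pullback_coin_product enn2real_ennreal f)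
qed

lemma lam_bounds: "k \<ge> 1 \<Longrightarrow> 1 \<le> lam k i \<and> lam k i \<le> 3 / 2"
proof -
  assume k: "k \<ge> 1"
  have two: "(2::real) ^ k = 2 * 2 ^ (k - 1)" using k by (metis power_eq_if not_one_le_zero)
  have a: "real_of_int i / 2 ^ k \<le> 1 / 2" if "i \<le> 2 ^ (k - 1)"
  proof -
    have "real_of_int i \<le> 2 ^ (k - 1)" using that by (metis of_int_le_iff of_int_numeral of_int_power)
    then show ?thesis by (simp add: two field_simps)
  qed
  have b: "1 / 2 \<le> real_of_int i / 2 ^ k" if "2 ^ (k - 1) \<le> i"
  proof -
    have "2 ^ (k - 1) \<le> real_of_int i" using that by (metis of_int_le_iff of_int_numeral of_int_power)
    then show ?thesis by (simp add: two field_simps)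
  qed
  have d: "real_of_int i / 2 ^ k \<le> 1" if "i \<le> 2 ^ k"
  proof -
    have "real_of_int i \<le> 2 ^ k" using that by (metis of_int_le_iff of_int_numeral of_int_power)
    then show ?thesis by (simp add: field_simps)
  qed
  show ?thesis
    using a b d by (auto simp: lam_def)
qed

lemma lam_prob_bounds: "k \<ge> 1 \<Longrightarrow> 1 / 2 \<le> lam_prob k i \<and> lam_prob k i \<le> 3 / 5"
  using lam_bounds[of k i] by (auto simp: lam_prob_def field_simps)

lemma lam_prob_outside:
  assumes k: "k \<ge> 1" and i: "i \<le> 0 \<or> 2 ^ k \<le> i"
  shows "lam_prob k i = 1 / 2"
proof -
  have half: "0 < (2::int) ^ (k - 1)" "(2::int) ^ (k - 1) < 2 ^ k"
    using k by (auto intro!: power_strict_increasing)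
  have "lam k i = 1"
    using i
  proof
    assume "i \<le> 0"
    with half(1) have "\<not> 2 ^ (k - 1) \<le> i" by linarith
    with \<open>i \<le> 0\<close> show ?thesis by (simp add: lam_def)
  next
    assume "2 ^ k \<le> i"
    moreover from this half(2) have "\<not> i \<le> 2 ^ (k - 1)" by linarith
    ultimately show ?thesis by (cases "i = 2 ^ k") (simp_all add: lam_def)
  qed
  then show ?thesis by (simp add: lam_prob_def)
qed

text \<open>
  The data of the construction. In the lemmas below, block \<open>t\<close> is the interval from \<open>m t\<close> to \<open>m (Suc t)\<close>: the
  tent with parameter \<open>k (Suc t)\<close> followed by a gap of fair coins of length \<open>2 ^ n (Suc t)\<close>. For \<open>t \<ge> 1\<close>
  it is preceded by a gap of length \<open>2 ^ n t\<close>.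
\<close>
locale tent_blocks =
  fixes k n m :: "nat \<Rightarrow> nat" and p :: "int \<Rightarrow> real"
  assumes m0: "m 0 = 0"
    and k_pos: "\<And>t. t \<ge> 1 \<Longrightarrow> k t \<ge> 1"
    and k_choice: "\<And>t. t \<ge> 1 \<Longrightarrow>
          measure (lam_measure (k t))
            {w \<in> space (lam_measure (k t)).
               (INF l\<in>{0..m (t - 1)}. rn_power (lam_measure (k t)) full_shift l w)
                 \<ge> exp (- (1 / 2 ^ t))}
          \<ge> 1 - 1 / 2 ^ t"
    and n_eq: "\<And>t. t \<ge> 1 \<Longrightarrow> n t = m (t - 1) + 2 ^ k t"
    and m_eq: "\<And>t. t \<ge> 1 \<Longrightarrow> m t = n t + 2 ^ n t"
    and p_neg: "\<And>j. j < 0 \<Longrightarrow> p j = 1 / 2"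
    and p_block: "\<And>t j. t \<ge> 1 \<Longrightarrow> int (m (t - 1)) \<le> j \<Longrightarrow> j < int (n t) \<Longrightarrow>
          p j = lam_prob (k t) (j - int (m (t - 1)))"
    and p_gap: "\<And>t j. t \<ge> 1 \<Longrightarrow> int (n t) \<le> j \<Longrightarrow> j < int (m t) \<Longrightarrow> p j = 1 / 2"
begin

abbreviation \<mu> :: "(int \<Rightarrow> bool) measure" where "\<mu> \<equiv> coin_product p"

lemma n_Suc: "n (Suc t) = m t + 2 ^ k (Suc t)"
  using n_eq[of "Suc t"] by simp

lemma m_Suc: "m (Suc t) = n (Suc t) + 2 ^ n (Suc t)"
  using m_eq[of "Suc t"] by simp

lemma m_less_n: "m t < n (Suc t)" and n_less_m: "n (Suc t) < m (Suc t)"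
  by (simp_all add: n_Suc m_Suc)

lemma m_less_Suc: "m t < m (Suc t)"
  using m_less_n n_less_m by (rule less_trans)

lemma strict_mono_m: "strict_mono m"
  by (rule strict_monoI_Suc) (rule m_less_Suc)

lemma mono_m: "s \<le> t \<Longrightarrow> m s \<le> m t"
  using strict_mono_m by (simp add: strict_mono_less_eq)

lemma le_m: "t \<le> m t"
  using strict_mono_m by (rule strict_mono_imp_increasing)

lemma le_n: "t \<ge> 1 \<Longrightarrow> t \<le> n t"
  using le_m[of "t - 1"] m_less_n[of "t - 1"] by simp

lemma two_power_n_le_m: "t \<ge> 1 \<Longrightarrow> 2 ^ n t \<le> m t"
  using m_eq[of t] by simp

lemma block_ex:
  assumes "0 \<le> j" shows "\<exists>t. int (m t) \<le> j \<and> j < int (m (Suc t))"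
proof -
  let ?P = "\<lambda>t. j < int (m t)"
  have ex: "?P (nat j + 1)" using le_m[of "nat j + 1"] assms by linarith
  define t where "t = (LEAST t. ?P t)"
  have t: "?P t" unfolding t_def using ex by (rule LeastI)
  then have "t \<noteq> 0" using assms m0 by (intro notI) simp
  then obtain s where s: "t = Suc s" by (cases t) auto
  have "\<not> ?P s" using not_less_Least[of s ?P] s unfolding t_def by simp
  with t s show ?thesis by (intro exI[of _ s]) auto
qed

lemma p_in_block:
  assumes "0 \<le> i" "i < int (m (Suc t)) - int (m t)"
  shows "p (i + int (m t)) = lam_prob (k (Suc t)) i"
proof (cases "i < 2 ^ k (Suc t)")
  case True
  then show ?thesis using p_block[of "Suc t" "i + int (m t)"] assms by (simp add: n_Suc)
next
  case False
  then show ?thesis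
    using p_gap[of "Suc t" "i + int (m t)"] assms lam_prob_outside[OF k_pos, of "Suc t" i] by (simp add: n_Suc)
qed

text \<open>A shift by at most the length of the preceding gap meets no other tent.\<close>

lemma p_around_block:
  assumes "t \<ge> 1" "- (2 ^ n t) \<le> i" "i < int (m (Suc t)) - int (m t)"
  shows "p (i + int (m t)) = lam_prob (k (Suc t)) i"
proof (cases "0 \<le> i")
  case False
  then show ?thesis
    using p_gap[of t "i + int (m t)"] assms lam_prob_outside[OF k_pos, of "Suc t" i] by (simp add: m_eq)
qed (use assms p_in_block in auto)

lemma p_bounds: "1 / 2 \<le> p j" "p j \<le> 3 / 5"
proof -
  have "1 / 2 \<le> p j \<and> p j \<le> 3 / 5"
  proof (cases "0 \<le> j")
    case True
    then obtain t where "int (m t) \<le> j" "j < int (m (Suc t))" using block_ex by blast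
    then show ?thesis
      using p_in_block[of "j - int (m t)" t] lam_prob_bounds[of "k (Suc t)" "j - int (m t)"] k_pos[of "Suc t"] by simp
  qed (simp add: p_neg)
  then show "1 / 2 \<le> p j" "p j \<le> 3 / 5" by auto
qed

lemma p_open: "0 < p j \<and> p j < 1"
  using p_bounds[of j] by linarith

text \<open>The contribution of block \<open>t\<close> to the derivative of the \<open>l\<close>-th power of the shift.\<close>

definition block_ratio :: "nat \<Rightarrow> nat \<Rightarrow> (int \<Rightarrow> bool) \<Rightarrow> real" where
  "block_ratio l t w = (\<Prod>i = int (m t)..<int (m (Suc t)). bit_ratio (p i) (p (i - int l)) (w i))"

lemma block_ratio_measurable [measurable]: "block_ratio l t \<in> borel_measurable bits"
  unfolding block_ratio_def by measurable

lemma block_ratio_pos: "0 < block_ratio l t w"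
  unfolding block_ratio_def by (intro prod_pos ballI bit_ratio_pos) (use p_open in auto)

text \<open>As long as \<open>l\<close> does not exceed the preceding gap, the vector of all \<open>block_ratio l t\<close> is the corresponding
  vector of derivatives for a single tent, read at translated coordinates. So the condition on \<open>k\<close>,
  which controls all these derivatives simultaneously, carries over.\<close>

lemma block_ratio_large:
  assumes t: "t \<ge> 1"
  shows "1 - 1 / 2 ^ Suc t \<le> measure \<mu> {w. \<forall>l \<le> 2 ^ n t. exp (- (1 / 2 ^ Suc t)) \<le> block_ratio l t w}"
proof -
  define K where "K = k (Suc t)"
  define q where "q = lam_prob K"
  define e where "e = exp (- (1 / 2 ^ Suc t) :: real)"
  define J where "J = {0..<int (m (Suc t)) - int (m t)}"
  define R where "R l w = (\<Prod>i\<in>J. bit_ratio (q i) (q (i - int l)) (w i))" for l :: nat and w :: "int \<Rightarrow> bool"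
  have [measurable]: "R l \<in> borel_measurable bits" for l unfolding R_def by measurable
  have K: "K \<ge> 1" unfolding K_def by (rule k_pos) simp
  have q: "1 / 2 \<le> q i \<and> q i \<le> 3 / 5" for i unfolding q_def by (rule lam_prob_bounds[OF K])
  have q01: "0 < q i \<and> q i < 1" for i using q[of i] by linarith
  have Rn: "0 \<le> R l w" for l w
    unfolding R_def by (intro prod_nonneg bit_ratio_nonneg ballI) (use q01 in \<open>auto simp: less_imp_le\<close>)
  interpret L: prob_space "coin_product q" by (rule prob_space_coin_product)
  interpret prob_space \<mu> by (rule prob_space_coin_product)
  have AE_l: "AE w in coin_product q. rn_power (coin_product q) full_shift l w = R l w" if l: "l \<le> m t" for l
  proof (rule rn_power_coin_product[OF _ Rn])
    show "density (coin_product q) (\<lambda>w. ennreal (R l w)) = coin_product (\<lambda>i. q (i - int l))"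
      unfolding R_def
    proof (rule coin_product_density)
      fix j assume "j \<notin> J"
      then consider "j < 0" | "int (m (Suc t)) - int (m t) \<le> j" by (force simp: J_def)
      then show "q (j - int l) = q j"
      proof cases
        case 2
        have "l \<le> 2 ^ n (Suc t)" using l m_less_n[of t] less_exp[of "n (Suc t)"] by linarith
        then have "int l \<le> 2 ^ n (Suc t)" by (metis of_nat_le_iff of_nat_numeral of_nat_power)
        moreover have "int (n (Suc t)) = int (m t) + 2 ^ K" by (simp add: n_Suc K_def)
        moreover have "int (m (Suc t)) = int (n (Suc t)) + 2 ^ n (Suc t)" by (simp add: m_Suc)
        ultimately have "2 ^ K + int l \<le> j" using 2 by linarith
        then show ?thesis using lam_prob_outside[OF K, of j] lam_prob_outside[OF K, of "j - int l"] by (simp add: q_def)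
      next
        case 1
        then show ?thesis using lam_prob_outside[OF K, of j] lam_prob_outside[OF K, of "j - int l"] by (simp add: q_def)
      qed
    qed (use q01 in \<open>auto simp: J_def less_imp_le\<close>)
  qed measurable
  then have AE_all: "AE w in coin_product q. \<forall>l\<in>{0..m t}. rn_power (coin_product q) full_shift l w = R l w"
    by (intro AE_finite_allI) auto
  have N: "2 ^ n t \<le> m t" using two_power_n_le_m[OF t] .
  let ?E = "{w. \<forall>l \<le> 2 ^ n t. e \<le> R l w}"
  have E: "?E \<in> sets bits" by (rule sets_Collect_bits) measurable
  have "1 - 1 / 2 ^ Suc t \<le> measure (coin_product q)
      {w. (INF l\<in>{0..m t}. rn_power (coin_product q) full_shift l w) \<ge> e}"
    using k_choice[of "Suc t"] by (simp add: lam_measure_def q_def K_def e_def)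
  also have "\<dots> \<le> measure (coin_product q) ?E"
  proof (rule L.finite_measure_mono_AE)
    show "AE w in coin_product q. w \<in> {w. (INF l\<in>{0..m t}. rn_power (coin_product q) full_shift l w) \<ge> e} \<longrightarrow> w \<in> ?E"
      using AE_all
    proof eventually_elim
      case (elim w)
      show ?case
      proof (intro impI CollectI allI)
        fix l :: nat assume inf: "w \<in> {w. (INF l\<in>{0..m t}. rn_power (coin_product q) full_shift l w) \<ge> e}" and l: "l \<le> 2 ^ n t"
        have l': "l \<in> {0..m t}" using l N by auto
        have "(INF l\<in>{0..m t}. rn_power (coin_product q) full_shift l w) \<le> rn_power (coin_product q) full_shift l w"
          by (rule cINF_lower[OF _ l']) (auto intro!: bdd_below_finite)
        with inf elim l' show "e \<le> R l w" by auto
      qed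
    qed
  qed (use E in auto)
  also have "measure (coin_product q) ?E = measure (coin_product (\<lambda>i. p (i + int (m t)))) ?E"
  proof -
    have R_cong: "R l w = R l w'" if "\<And>j. j \<in> J \<Longrightarrow> w j = w' j" for l w w'
      unfolding R_def using that by (intro prod.cong) auto
    have "emeasure (coin_product q) ?E = emeasure (coin_product (\<lambda>i. p (i + int (m t)))) ?E"
    proof (rule emeasure_coin_product_cong[OF _ E])
      show "finite J" by (simp add: J_def)
      fix w w' :: "int \<Rightarrow> bool" assume "\<And>j. j \<in> J \<Longrightarrow> w j = w' j"
      then show "w \<in> ?E \<longleftrightarrow> w' \<in> ?E" using R_cong[of w w'] by simp
    next
      fix j assume "j \<in> J"
      then show "q j = p (j + int (m t))" using p_in_block[of j t] by (simp add: J_def q_def K_def)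
    qed
    then show ?thesis by (simp add: measure_def)
  qed
  also have "\<dots> = measure (distr \<mu> bits (\<lambda>w i. w (i + int (m t)))) ?E"
    by (subst distr_reindex_coin_product) (auto simp: inj_on_def intro!: measurable_PiM_single')
  also have "\<dots> = measure \<mu> {w. \<forall>l \<le> 2 ^ n t. e \<le> R l (\<lambda>i. w (i + int (m t)))}"
    using E by (subst measure_distr) (auto simp: vimage_def intro!: measurable_PiM_single')
  also have "{w. \<forall>l \<le> 2 ^ n t. e \<le> R l (\<lambda>i. w (i + int (m t)))} = {w. \<forall>l \<le> 2 ^ n t. e \<le> block_ratio l t w}"
  proof -
    have "R l (\<lambda>i. w (i + int (m t))) = block_ratio l t w" if l: "l \<le> 2 ^ n t" for l w
    proof -
      have "block_ratio l t w = (\<Prod>i\<in>J. bit_ratio (p (i + int (m t))) (p (i + int (m t) - int l)) (w (i + int (m t))))"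
        unfolding block_ratio_def J_def
        by (rule prod.reindex_bij_witness[of _ "\<lambda>i. i + int (m t)" "\<lambda>i. i - int (m t)"]) auto
      also have "\<dots> = R l (\<lambda>i. w (i + int (m t)))"
        unfolding R_def
      proof (rule prod.cong)
        fix i assume i: "i \<in> J"
        have 1: "p (i + int (m t)) = q i" using i p_in_block[of i t] by (simp add: J_def q_def K_def)
        have "int l \<le> 2 ^ n t" using l by (metis of_nat_le_iff of_nat_numeral of_nat_power)
        moreover from i have "0 \<le> i" "i < int (m (Suc t)) - int (m t)" by (auto simp: J_def)
        ultimately have "- (2 ^ n t) \<le> i - int l" "i - int l < int (m (Suc t)) - int (m t)" by linarith+
        from p_around_block[OF t this] have "p (i - int l + int (m t)) = q (i - int l)"
          by (simp add: q_def K_def)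
        then have 2: "p (i + int (m t) - int l) = q (i - int l)" by (simp add: algebra_simps)
        show "bit_ratio (p (i + int (m t))) (p (i + int (m t) - int l)) (w (i + int (m t))) =
          bit_ratio (q i) (q (i - int l)) (w (i + int (m t)))" unfolding 1 2 ..
      qed simp
      finally show ?thesis by simp
    qed
    then show ?thesis by auto
  qed
  finally show ?thesis by (simp add: e_def)
qed

section \<open>Density of the shifted measure\<close>

interpretation \<mu>: prob_space \<mu> by (rule prob_space_coin_product)

definition partial_rn :: "nat \<Rightarrow> nat \<Rightarrow> (int \<Rightarrow> bool) \<Rightarrow> real" where
  "partial_rn l t w = (\<Prod>i = 0..<int (m t). bit_ratio (p i) (p (i - int l)) (w i))"

lemma partial_rn_measurable [measurable]: "partial_rn l t \<in> borel_measurable bits"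
  unfolding partial_rn_def by measurable

lemma partial_rn_pos: "0 < partial_rn l t w"
  unfolding partial_rn_def by (intro prod_pos ballI bit_ratio_pos) (use p_open in auto)

lemma partial_rn_Suc: "partial_rn l (Suc t) w = partial_rn l t w * block_ratio l t w"
proof -
  have "{0..<int (m (Suc t))} = {0..<int (m t)} \<union> {int (m t)..<int (m (Suc t))}"
    using m_less_Suc[of t] by auto
  then show ?thesis
    unfolding partial_rn_def block_ratio_def by (simp add: prod.union_disjoint ivl_disj_int)
qed

lemma density_partial_rn:
  "density \<mu> (partial_rn l t) = coin_product (\<lambda>i. if i < int (m t) then p (i - int l) else p i)"
proof -
  let ?q = "\<lambda>i. if i < int (m t) then p (i - int l) else p i"
  have "density \<mu> (\<lambda>w. ennreal (\<Prod>i = 0..<int (m t). bit_ratio (p i) (?q i) (w i))) = coin_product ?q"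
    by (rule coin_product_density) (use p_open in \<open>auto simp: less_imp_le p_neg\<close>)
  moreover have "(\<lambda>w. ennreal (\<Prod>i = 0..<int (m t). bit_ratio (p i) (?q i) (w i))) = (\<lambda>w. ennreal (partial_rn l t w))"
    unfolding partial_rn_def by (intro ext arg_cong[where f=ennreal] prod.cong) auto
  ultimately show ?thesis by simp
qed

lemma density_block_ratio:
  "density \<mu> (block_ratio l t) = coin_product (\<lambda>i. if i \<in> {int (m t)..<int (m (Suc t))} then p (i - int l) else p i)"
proof -
  let ?J = "{int (m t)..<int (m (Suc t))}"
  let ?q = "\<lambda>i. if i \<in> ?J then p (i - int l) else p i"
  have "density \<mu> (\<lambda>w. ennreal (\<Prod>i\<in>?J. bit_ratio (p i) (?q i) (w i))) = coin_product ?q"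
    by (rule coin_product_density) (use p_open in \<open>auto simp: less_imp_le\<close>)
  moreover have "(\<lambda>w. ennreal (\<Prod>i\<in>?J. bit_ratio (p i) (?q i) (w i))) = (\<lambda>w. ennreal (block_ratio l t w))"
    unfolding block_ratio_def by (intro ext arg_cong[where f=ennreal] prod.cong) auto
  ultimately show ?thesis by simp
qed

lemma nn_integral_block_ratio: "(\<integral>\<^sup>+w. block_ratio l t w \<partial>\<mu>) = 1"
proof -
  have "emeasure (density \<mu> (block_ratio l t)) UNIV = 1"
    unfolding density_block_ratio
    using prob_space.emeasure_space_1[OF prob_space_coin_product] by simp
  then show ?thesis by (subst (asm) emeasure_density) auto
qed

lemma mono_n:
  assumes "1 \<le> s" "s \<le> t" shows "n s \<le> n t"
  using assms(2)
proof (induction t rule: dec_induct)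
  case (step t)
  have "n t < m t" using n_less_m[of "t - 1"] step.hyps assms(1) by simp
  then show ?case using step.IH m_less_n[of t] by simp
qed simp

lemma le_two_power_n: "t \<ge> 1 \<Longrightarrow> l \<le> t \<Longrightarrow> l \<le> 2 ^ n t"
  using le_n[of t] less_exp[of "n t"] by linarith

lemma block_ratio_L1:
  assumes t: "t \<ge> 1" and l: "l \<le> 2 ^ n t"
  shows "(\<integral>\<^sup>+w. \<bar>block_ratio l t w - 1\<bar> \<partial>\<mu>) \<le> ennreal (4 * (1 / 2 ^ Suc t))"
proof (rule \<mu>.L1_dist_one_le)
  show "(\<integral>\<^sup>+w. block_ratio l t w \<partial>\<mu>) = 1" by (rule nn_integral_block_ratio)
  have "1 - 1 / 2 ^ Suc t \<le> \<mu>.prob {w. \<forall>l \<le> 2 ^ n t. exp (- (1 / 2 ^ Suc t)) \<le> block_ratio l t w}"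
    by (rule block_ratio_large[OF t])
  also have "\<dots> \<le> \<mu>.prob {w \<in> space \<mu>. exp (- (1 / 2 ^ Suc t)) \<le> block_ratio l t w}"
  proof (rule \<mu>.finite_measure_mono)
    show "{w \<in> space \<mu>. exp (- (1 / 2 ^ Suc t)) \<le> block_ratio l t w} \<in> \<mu>.events" by measurable
  qed (use l in auto)
  finally show "1 - 1 / 2 ^ Suc t \<le> \<mu>.prob {w \<in> space \<mu>. exp (- (1 / 2 ^ Suc t)) \<le> block_ratio l t w}" .
qed (auto intro: less_imp_le[OF block_ratio_pos])

text \<open>The step is \<open>partial_rn l t\<close> times \<open>block_ratio l t - 1\<close>. Weighting by \<open>partial_rn l t\<close> only
  changes coins to the left of block \<open>t\<close>, so the weight can be dropped.\<close>

lemma partial_rn_step_L1: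
  assumes t: "t \<ge> 1" and l: "l \<le> 2 ^ n t"
  shows "(\<integral>\<^sup>+w. \<bar>partial_rn l (Suc t) w - partial_rn l t w\<bar> \<partial>\<mu>) \<le> ennreal (4 * (1 / 2 ^ Suc t))"
proof -
  have "(\<integral>\<^sup>+w. \<bar>partial_rn l (Suc t) w - partial_rn l t w\<bar> \<partial>\<mu>)
     = (\<integral>\<^sup>+w. ennreal (partial_rn l t w) * ennreal \<bar>block_ratio l t w - 1\<bar> \<partial>\<mu>)"
  proof (intro nn_integral_cong)
    fix w
    have "\<bar>partial_rn l (Suc t) w - partial_rn l t w\<bar> = \<bar>partial_rn l t w * (block_ratio l t w - 1)\<bar>"
      by (simp add: partial_rn_Suc right_diff_distrib)
    also have "\<dots> = partial_rn l t w * \<bar>block_ratio l t w - 1\<bar>"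
      using partial_rn_pos[of l t w] by (simp add: abs_mult)
    finally show "ennreal \<bar>partial_rn l (Suc t) w - partial_rn l t w\<bar> = ennreal (partial_rn l t w) * ennreal \<bar>block_ratio l t w - 1\<bar>"
      using partial_rn_pos[of l t w] by (simp add: ennreal_mult)
  qed
  also have "\<dots> = (\<integral>\<^sup>+w. \<bar>block_ratio l t w - 1\<bar> \<partial>density \<mu> (partial_rn l t))"
    by (subst nn_integral_density) auto
  also have "\<dots> = (\<integral>\<^sup>+w. \<bar>block_ratio l t w - 1\<bar> \<partial>\<mu>)"
    unfolding density_partial_rn
  proof (rule nn_integral_coin_product_cong)
    show "finite {int (m t)..<int (m (Suc t))}" by simp
    fix w w' :: "int \<Rightarrow> bool" assume "\<And>j. j \<in> {int (m t)..<int (m (Suc t))} \<Longrightarrow> w j = w' j"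
    then have "block_ratio l t w = block_ratio l t w'"
      unfolding block_ratio_def by (intro prod.cong) auto
    then show "ennreal \<bar>block_ratio l t w - 1\<bar> = ennreal \<bar>block_ratio l t w' - 1\<bar>" by simp
  qed auto
  finally show ?thesis using block_ratio_L1[OF t l] by simp
qed

definition good_from :: "nat \<Rightarrow> (int \<Rightarrow> bool) \<Rightarrow> bool" where
  "good_from T w \<longleftrightarrow> (\<forall>t\<ge>T. \<forall>l \<le> 2 ^ n t. exp (- (1 / 2 ^ Suc t)) \<le> block_ratio l t w)"

lemma good_from_measurable [measurable]: "Measurable.pred bits (good_from T)"
  unfolding good_from_def by measurable

lemma prob_good_from:
  assumes T: "T \<ge> 1"
  shows "1 - 1 / 2 ^ T \<le> measure \<mu> {w. good_from T w}"
proof -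
  define B where "B i = {w. \<not> (\<forall>l \<le> 2 ^ n (T + i). exp (- (1 / 2 ^ Suc (T + i))) \<le> block_ratio l (T + i) w)}" for i
  have B [measurable]: "B i \<in> sets bits" for i
    unfolding B_def by (rule sets_Collect_bits) measurable
  have mB: "measure \<mu> (B i) \<le> 1 / 2 ^ Suc (T + i)" for i
  proof -
    have "measure \<mu> (B i) = 1 - measure \<mu> (UNIV - B i)"
      using \<mu>.prob_compl[of "B i"] B by simp
    moreover have "UNIV - B i = {w. \<forall>l \<le> 2 ^ n (T + i). exp (- (1 / 2 ^ Suc (T + i))) \<le> block_ratio l (T + i) w}"
      by (auto simp: B_def)
    ultimately show ?thesis using block_ratio_large[of "T + i"] T by simp
  qed
  have geom: "(\<lambda>i. 1 / 2 ^ Suc (T + i) :: real) sums (1 / 2 ^ T)"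
  proof -
    have "(\<lambda>i. (1 / 2 ^ T) * (1 / 2 :: real) ^ Suc i) sums (1 / 2 ^ T * 1)"
      by (intro sums_mult power_half_series)
    then show ?thesis by (simp add: power_add power_divide mult_ac)
  qed
  have sB: "summable (\<lambda>i. measure \<mu> (B i))"
    by (rule summable_comparison_test'[OF sums_summable[OF geom]]) (use mB in simp)
  have "measure \<mu> (\<Union>i. B i) \<le> (\<Sum>i. measure \<mu> (B i))"
    by (rule \<mu>.finite_measure_subadditive_countably) (use B sB in auto)
  also have "\<dots> \<le> 1 / 2 ^ T"
    using suminf_le[OF mB sB sums_summable[OF geom]] sums_unique[OF geom] by simp
  finally have 1: "measure \<mu> (\<Union>i. B i) \<le> 1 / 2 ^ T" .
  have "{w. good_from T w} = UNIV - (\<Union>i. B i)"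
    by (auto simp: good_from_def B_def le_iff_add)
  moreover have "measure \<mu> (UNIV - (\<Union>i. B i)) = 1 - measure \<mu> (\<Union>i. B i)"
    using \<mu>.prob_compl[of "\<Union>i. B i"] B by auto
  ultimately show ?thesis using 1 by simp
qed

lemma AE_good_from: "AE w in \<mu>. \<exists>T\<ge>l. good_from T w"
proof (rule \<mu>.AE_of_prob_lower_bound)
  show 1: "{w \<in> space \<mu>. \<exists>T\<ge>l. good_from T w} \<in> \<mu>.events" by measurable
  show "(\<lambda>T. 1 - (1 / 2) ^ T :: real) \<longlonglongrightarrow> 1"
    using LIMSEQ_power_zero[of "1/2 :: real"] by (auto intro!: tendsto_eq_intros)
  fix T assume T: "T \<ge> max 1 l"
  have "measure \<mu> {w. good_from T w} \<le> measure \<mu> {w \<in> space \<mu>. \<exists>T\<ge>l. good_from T w}"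
    using T 1 by (intro \<mu>.finite_measure_mono) auto
  then show "1 - (1 / 2) ^ T \<le> measure \<mu> {w \<in> space \<mu>. \<exists>T\<ge>l. good_from T w}"
    using prob_good_from[of T] T by (simp add: power_divide)
qed

lemma partial_rn_lower:
  assumes g: "good_from T w" and l: "l \<le> 2 ^ n T" and T: "T \<ge> 1" and t: "t \<ge> T"
  shows "partial_rn l T w * exp (-1) \<le> partial_rn l t w"
proof -
  have "partial_rn l T w * exp (- (1 / 2 ^ T - 1 / 2 ^ t)) \<le> partial_rn l t w"
    using t
  proof (induction t rule: dec_induct)
    case (step t)
    have "n T \<le> n t" using mono_n T step.hyps by simp
    then have "(2::nat) ^ n T \<le> 2 ^ n t" by (rule power_increasing) simp
    with l have le: "l \<le> 2 ^ n t" by (rule order_trans)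
    have "1 / 2 ^ T - 1 / 2 ^ Suc t = (1 / 2 ^ T - 1 / 2 ^ t) + 1 / (2 ^ Suc t :: real)" by (simp add: field_simps)
    then have "exp (- (1 / 2 ^ T - 1 / 2 ^ Suc t)) = exp (- (1 / 2 ^ T - 1 / 2 ^ t)) * exp (- (1 / 2 ^ Suc t) :: real)"
      by (metis exp_add minus_add_distrib)
    then have "partial_rn l T w * exp (- (1 / 2 ^ T - 1 / 2 ^ Suc t)) =
        (partial_rn l T w * exp (- (1 / 2 ^ T - 1 / 2 ^ t))) * exp (- (1 / 2 ^ Suc t))" by simp
    also have "\<dots> \<le> partial_rn l t w * block_ratio l t w"
      using step.IH g le step.hyps partial_rn_pos[of l t w]
      by (intro mult_mono) (auto simp: good_from_def less_imp_le)
    finally show ?case by (simp add: partial_rn_Suc)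
  qed simp
  moreover have "exp (-1) \<le> exp (- (1 / 2 ^ T - 1 / 2 ^ t) :: real)"
  proof -
    have "1 / 2 ^ T \<le> (1::real)" by simp
    moreover have "0 \<le> 1 / (2::real) ^ t" by simp
    ultimately have "-1 \<le> - (1 / 2 ^ T - 1 / (2::real) ^ t)" by linarith
    then show ?thesis by simp
  qed
  ultimately show ?thesis
    using partial_rn_pos[of l T w] by (meson mult_left_mono less_imp_le order_trans)
qed

text \<open>An everywhere defined and everywhere positive version of the derivative. It is a function of the
  sequence of partial products alone, so it inherits their exact symmetries, such as
  \<open>shift_rn_flip_neg\<close>.\<close>

definition shift_rn :: "nat \<Rightarrow> (int \<Rightarrow> bool) \<Rightarrow> real" where
  "shift_rn l w = (let L = lim (\<lambda>t. partial_rn l t w) in if L > 0 then L else 1)"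

lemma shift_rn_measurable [measurable]: "shift_rn l \<in> borel_measurable bits"
  unfolding shift_rn_def Let_def by measurable

lemma shift_rn_pos: "0 < shift_rn l w"
  by (simp add: shift_rn_def Let_def)

text \<open>The steps of the partial products have a summable bound in \<open>L\<^sup>1\<close>. The limit is positive because
  almost every \<open>w\<close> is good from some block on, after which the product loses at most the
  factor \<open>exp (-1)\<close>.\<close>

lemma shift_rn_lim:
  assumes T: "T \<ge> 1" "l \<le> T"
  shows "AE w in \<mu>. (\<lambda>t. partial_rn l t w) \<longlonglongrightarrow> shift_rn l w"
    and "(\<integral>\<^sup>+w. \<bar>shift_rn l w - partial_rn l T w\<bar> \<partial>\<mu>) \<le> ennreal (4 / 2 ^ T)"
proof -
  define u where "u i w = partial_rn l (Suc (i + T)) w - partial_rn l (i + T) w" for i w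
  have [measurable]: "u i \<in> borel_measurable bits" for i unfolding u_def by measurable
  have "(\<lambda>i. (4 / 2 ^ T) * (1 / 2 :: real) ^ Suc i) sums (4 / 2 ^ T * 1)"
    by (intro sums_mult power_half_series)
  then have geom: "(\<lambda>i. 4 * (1 / 2 ^ Suc (i + T)) :: real) sums (4 / 2 ^ T)"
    by (simp add: power_add power_divide mult_ac)
  have "(\<integral>\<^sup>+w. (\<Sum>i. ennreal \<bar>u i w\<bar>) \<partial>\<mu>) = (\<Sum>i. \<integral>\<^sup>+w. \<bar>u i w\<bar> \<partial>\<mu>)"
    by (intro nn_integral_suminf) auto
  also have "\<dots> \<le> (\<Sum>i. ennreal (4 * (1 / 2 ^ Suc (i + T))))"
    unfolding u_def by (intro suminf_le partial_rn_step_L1 le_two_power_n) (use T in auto)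
  also have "\<dots> = ennreal (4 / 2 ^ T)"
    by (rule suminf_ennreal_eq[OF _ geom]) simp
  finally have le: "(\<integral>\<^sup>+w. (\<Sum>i. ennreal \<bar>u i w\<bar>) \<partial>\<mu>) \<le> ennreal (4 / 2 ^ T)" .
  then have "(\<integral>\<^sup>+w. (\<Sum>i. ennreal \<bar>u i w\<bar>) \<partial>\<mu>) \<noteq> \<infinity>"
    unfolding infinity_ennreal_def by (rule neq_top_trans[rotated]) simp
  moreover have "(\<lambda>w. \<Sum>i. ennreal \<bar>u i w\<bar>) \<in> borel_measurable \<mu>"
    by measurable
  ultimately have "AE w in \<mu>. (\<Sum>i. ennreal \<bar>u i w\<bar>) \<noteq> \<infinity>"
    by (intro nn_integral_PInf_AE)
  then have 1: "AE w in \<mu>. summable (\<lambda>i. \<bar>u i w\<bar>)"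
    by eventually_elim (rule summable_suminf_not_top, simp_all)
  have conv: "(\<lambda>t. partial_rn l t w) \<longlonglongrightarrow> partial_rn l T w + (\<Sum>i. u i w)"
    if "summable (\<lambda>i. \<bar>u i w\<bar>)" for w
  proof -
    have "(\<lambda>N. \<Sum>i<N. u i w) \<longlonglongrightarrow> (\<Sum>i. u i w)"
      by (rule summable_LIMSEQ[OF summable_rabs_cancel[OF that]])
    moreover have "(\<Sum>i<N. u i w) = partial_rn l (N + T) w - partial_rn l T w" for N
      using sum_lessThan_telescope[of "\<lambda>i. partial_rn l (i + T) w" N] by (simp add: u_def)
    ultimately have "(\<lambda>N. partial_rn l T w + (partial_rn l (N + T) w - partial_rn l T w)) \<longlonglongrightarrow> partial_rn l T w + (\<Sum>i. u i w)"
      by (intro tendsto_add) auto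
    then have "(\<lambda>N. partial_rn l (N + T) w) \<longlonglongrightarrow> partial_rn l T w + (\<Sum>i. u i w)" by simp
    then show ?thesis by (rule LIMSEQ_offset)
  qed
  have eq: "AE w in \<mu>. shift_rn l w = partial_rn l T w + (\<Sum>i. u i w)"
    using 1 AE_good_from[of T]
  proof eventually_elim
    case (elim w)
    then obtain S where S: "S \<ge> T" "good_from S w" by auto
    have "partial_rn l S w * exp (-1) \<le> partial_rn l T w + (\<Sum>i. u i w)"
      by (rule LIMSEQ_le_const[OF conv[OF elim(1)]])
         (use partial_rn_lower[OF S(2), of l] S(1) le_two_power_n[of S l] T in auto)
    moreover have "0 < partial_rn l S w * exp (-1)" using partial_rn_pos by simp
    ultimately show ?case by (simp add: shift_rn_def limI[OF conv[OF elim(1)]])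
  qed
  show "AE w in \<mu>. (\<lambda>t. partial_rn l t w) \<longlonglongrightarrow> shift_rn l w"
    using 1 eq by eventually_elim (simp add: conv)
  have "AE w in \<mu>. ennreal \<bar>shift_rn l w - partial_rn l T w\<bar> \<le> (\<Sum>i. ennreal \<bar>u i w\<bar>)"
    using 1 eq by eventually_elim (simp add: suminf_ennreal2 summable_rabs ennreal_leI)
  from order_trans[OF nn_integral_mono_AE[OF this] le]
  show "(\<integral>\<^sup>+w. \<bar>shift_rn l w - partial_rn l T w\<bar> \<partial>\<mu>) \<le> ennreal (4 / 2 ^ T)" .
qed

text \<open>A late partial product gives a fixed cylinder exactly its measure under the translated product, and is
  close to the limit in \<open>L\<^sup>1\<close>.\<close>

lemma density_shift_rn:
  "density \<mu> (shift_rn l) = coin_product (\<lambda>i. p (i - int l))" (is "?D = ?C")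
proof -
  have eq: "emeasure ?D {w. \<forall>j\<in>J. w j \<in> F j} = emeasure ?C {w. \<forall>j\<in>J. w j \<in> F j}" (is "emeasure _ ?A = _")
    if J: "finite J" for J F
  proof -
    have A [measurable]: "?A \<in> sets bits" using J by (rule cylinder_measurable)
    define N where "N = nat (Max (insert 0 J) + 1)"
    have N: "j < int (m N)" if "j \<in> J" for j
    proof -
      have "j \<le> Max (insert 0 J)" using that J by (intro Max_ge) auto
      then show ?thesis using le_m[of N] by (simp add: N_def)
    qed
    have part: "emeasure (density \<mu> (partial_rn l t)) ?A = emeasure ?C ?A" if t: "t \<ge> N" for t
      unfolding density_partial_rn
    proof (rule emeasure_coin_product_cong[OF J A])
      fix j assume "j \<in> J"
      then show "(if j < int (m t) then p (j - int l) else p j) = p (j - int l)" using N[of j] mono_m[OF t] by simp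
    next
      fix w w' :: "int \<Rightarrow> bool" assume "\<And>j. j \<in> J \<Longrightarrow> w j = w' j"
      then show "w \<in> ?A \<longleftrightarrow> w' \<in> ?A" by auto
    qed
    have close: "emeasure ?D ?A \<le> emeasure ?C ?A + ennreal e \<and> emeasure ?C ?A \<le> emeasure ?D ?A + ennreal e"
      if e: "0 < e" for e
    proof -
      obtain d where d: "(1 / 2 :: real) ^ d < e / 4" using real_arch_pow_inv[of "e / 4" "1 / 2"] e by auto
      define t where "t = Suc (N + l + d)"
      have "(1 / 2 :: real) ^ t \<le> (1 / 2) ^ d" by (rule power_decreasing) (auto simp: t_def)
      then have "4 / 2 ^ t \<le> e" using d by (simp add: power_divide)
      then have L1: "(\<integral>\<^sup>+w. \<bar>shift_rn l w - partial_rn l t w\<bar> \<partial>\<mu>) \<le> ennreal e"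
        using shift_rn_lim(2)[of t l] by (auto simp: t_def intro: order_trans ennreal_leI)
      have part_t: "emeasure (density \<mu> (partial_rn l t)) ?A = emeasure ?C ?A"
        by (rule part) (simp add: t_def)
      have 1: "emeasure ?D ?A \<le> emeasure ?C ?A + (\<integral>\<^sup>+w. \<bar>shift_rn l w - partial_rn l t w\<bar> \<partial>\<mu>)"
        unfolding part_t[symmetric] using A by (intro emeasure_density_le_L1) (auto simp: less_imp_le partial_rn_pos)
      have 2: "emeasure ?C ?A \<le> emeasure ?D ?A + (\<integral>\<^sup>+w. \<bar>partial_rn l t w - shift_rn l w\<bar> \<partial>\<mu>)"
        unfolding part_t[symmetric] using A by (intro emeasure_density_le_L1) (auto simp: less_imp_le shift_rn_pos)
      show ?thesis
        using order_trans[OF 1 add_left_mono[OF L1]] order_trans[OF 2[unfolded abs_minus_commute] add_left_mono[OF L1]] by simp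
    qed
    show ?thesis by (rule antisym; rule ennreal_le_epsilon; use close in blast)
  qed
  show ?thesis
  proof (rule coin_product_eqI)
    have "emeasure ?D UNIV = emeasure ?C UNIV" using eq[of "{}"] by simp
    then show "finite_measure ?D"
      using prob_space.emeasure_space_1[OF prob_space_coin_product] by (intro finite_measureI) simp
  qed (auto intro: eq)
qed

section \<open>Recurrence of the Radon-Nikodym cocycle\<close>

definition cocycle :: "nat \<Rightarrow> (int \<Rightarrow> bool) \<Rightarrow> real" where
  "cocycle N w = (\<Prod>i<N. shift_rn 1 ((full_shift ^^ i) w))"

lemma full_shift_power_measurable [measurable]: "full_shift ^^ i \<in> bits \<rightarrow>\<^sub>M bits"
  by (rule measurable_compose_n) measurable

lemma cocycle_measurable [measurable]: "cocycle N \<in> borel_measurable bits"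
  unfolding cocycle_def by measurable

lemma cocycle_pos: "0 < cocycle N w"
  unfolding cocycle_def by (intro prod_pos ballI shift_rn_pos)

lemma cocycle_Suc: "cocycle (Suc N) w = shift_rn 1 w * cocycle N (full_shift w)"
  unfolding cocycle_def by (subst prod.lessThan_Suc_shift) (simp add: funpow_swap1)

lemma density_cocycle: "density \<mu> (cocycle N) = coin_product (\<lambda>i. p (i - int N))"
proof (induction N)
  case 0
  then show ?case by (simp add: cocycle_def density_1)
next
  case (Suc N)
  have "coin_product (\<lambda>i. p (i - int (Suc N))) = distr (coin_product (\<lambda>i. p (i - int N))) bits unshift"
    by (subst distr_unshift) (simp add: algebra_simps)
  also have "\<dots> = distr (density \<mu> (cocycle N)) bits unshift" by (simp add: Suc)
  also have "\<dots> = density (distr \<mu> bits unshift) (\<lambda>w. cocycle N (full_shift w))"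
  proof (rule measure_eqI)
    fix A assume "A \<in> sets (distr (density \<mu> (cocycle N)) bits unshift)"
    then have [measurable]: "A \<in> sets bits" by simp
    have v [measurable]: "unshift -` A \<in> sets bits"
      using measurable_sets[OF unshift_measurable, of A] by (simp add: space_bits)
    have "emeasure (distr (density \<mu> (cocycle N)) bits unshift) A = emeasure (density \<mu> (cocycle N)) (unshift -` A)"
      by (subst emeasure_distr) auto
    also have "\<dots> = (\<integral>\<^sup>+w. ennreal (cocycle N w) * indicator (unshift -` A) w \<partial>\<mu>)"
      using v by (subst emeasure_density) auto
    also have "\<dots> = (\<integral>\<^sup>+w. ennreal (cocycle N (full_shift w)) * indicator A w \<partial>distr \<mu> bits unshift)"
      by (subst nn_integral_distr) (auto intro!: nn_integral_cong simp: indicator_def)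
    also have "\<dots> = emeasure (density (distr \<mu> bits unshift) (\<lambda>w. cocycle N (full_shift w))) A"
      by (subst emeasure_density) auto
    finally show "emeasure (distr (density \<mu> (cocycle N)) bits unshift) A =
        emeasure (density (distr \<mu> bits unshift) (\<lambda>w. cocycle N (full_shift w))) A" .
  qed simp
  also have "distr \<mu> bits unshift = density \<mu> (shift_rn 1)"
    by (simp add: distr_unshift density_shift_rn)
  also have "density (density \<mu> (shift_rn 1)) (\<lambda>w. cocycle N (full_shift w)) = density \<mu> (cocycle (Suc N))"
    by (subst density_density_eq)
       (auto intro!: density_cong simp: cocycle_Suc ennreal_mult less_imp_le shift_rn_pos cocycle_pos)
  finally show ?case by simp
qed

text \<open>Both sides are densities of the same translated product. The cocycle describes the iterates of the
  Maharam extension, while \<open>shift_rn N\<close> can be estimated block by block.\<close>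

lemma AE_cocycle_eq: "AE w in \<mu>. cocycle N w = shift_rn N w"
proof -
  have "density \<mu> (cocycle N) = density \<mu> (shift_rn N)"
    by (simp add: density_cocycle density_shift_rn)
  then have "AE w in \<mu>. ennreal (cocycle N w) = ennreal (shift_rn N w)"
    by (subst (asm) \<mu>.density_unique_iff) auto
  then show ?thesis
    by eventually_elim (simp add: less_imp_le cocycle_pos shift_rn_pos)
qed

text \<open>The set \<open>S\<close> consists of the ones in the window \<open>{0..<d}\<close>, and none of the first \<open>r\<close> translates of the
  window by multiples of \<open>d\<close> has ones on all of \<open>S\<close>. The first condition is written coordinatewise,
  as a cylinder.\<close>

definition no_cover :: "nat \<Rightarrow> int set \<Rightarrow> nat \<Rightarrow> (int \<Rightarrow> bool) set" where
  "no_cover d S r = {w. (\<forall>i\<in>{0..<int d}. w i \<in> (if i \<in> S then {True} else {False})) \<and>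
     (\<forall>s\<in>{1..r}. \<not> (\<forall>i\<in>S. w (i + int (s * d))))}"

lemma no_cover_measurable:
  assumes "S \<subseteq> {0..<int d}" shows "no_cover d S r \<in> sets bits"
proof -
  have [simp]: "finite S" using assms finite_subset by blast
  define X where "X s = {w :: int \<Rightarrow> bool. \<forall>j\<in>(\<lambda>i. i + int (s * d)) ` S. w j \<in> {True}}" for s
  have X: "UNIV - X s \<in> sets bits" for s
    unfolding X_def by (rule sets.Diff[OF UNIV_sets_bits cylinder_measurable]) simp
  have i: "(\<Inter>s\<in>{1..r}. UNIV - X s) \<in> sets bits"
  proof (cases "r = 0")
    case False
    then show ?thesis using X by (intro sets.finite_INT) auto
  qed simp
  have eq: "no_cover d S r = {w. \<forall>i\<in>{0..<int d}. w i \<in> (if i \<in> S then {True} else {False})} \<inter>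
     (\<Inter>s\<in>{1..r}. UNIV - X s)"
    by (auto simp: no_cover_def X_def)
  show ?thesis
    unfolding eq by (rule sets.Int[OF cylinder_measurable i]) simp
qed

text \<open>The next window lies in the gap of fair coins and is disjoint from everything before. Conditioning on
  ones at the positions in \<open>J\<close> is expressed by the coin product \<open>q\<close>, which agrees with \<open>p\<close> off \<open>J\<close>.\<close>

lemma measure_no_cover_Suc:
  assumes t: "t \<ge> 1" and S: "S \<subseteq> {0..<int (n t)}" and r: "n t * Suc r \<le> 2 ^ n t"
  shows "measure \<mu> (no_cover (n t) S (Suc r)) = measure \<mu> (no_cover (n t) S r) * (1 - 1 / 2 ^ card S)"
proof -
  define d where "d = n t"
  define J where "J = (\<lambda>i. i + int (Suc r * d)) ` S"
  define C where "C = {w. \<forall>j\<in>J. w j \<in> {True}}"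
  define q where "q j = (if j \<in> J then 1 else p j)" for j
  let ?A = "no_cover d S r"
  have [simp]: "finite S" using S finite_subset by blast
  have A [measurable]: "?A \<in> sets bits" using no_cover_measurable S by (simp add: d_def)
  have fJ [simp]: "finite J" by (simp add: J_def)
  have C [measurable]: "C \<in> sets bits" unfolding C_def by (rule cylinder_measurable) simp
  have cJ: "card J = card S" unfolding J_def by (rule card_image) (simp add: inj_on_def)
  have Jr: "int (Suc r * d) \<le> j \<and> j < int (Suc r * d) + int d" if "j \<in> J" for j
    using that S by (auto simp: J_def d_def)
  have pJ: "p j = 1 / 2" if "j \<in> J" for j
  proof (rule p_gap[OF t])
    have "int d \<le> int (Suc r * d)" by (simp add: of_nat_mult[symmetric] del: of_nat_mult)
    from order_trans[OF this conjunct1[OF Jr[OF that]]] show "int (n t) \<le> j" by (simp add: d_def)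
    have "int (Suc r * d) \<le> int (2 ^ n t)" using r by (simp only: of_nat_le_iff d_def mult.commute)
    then show "j < int (m t)" using Jr[OF that] by (simp add: m_eq[OF t] d_def)
  qed
  have "density \<mu> (\<lambda>w. ennreal (\<Prod>j\<in>J. bit_ratio (p j) (q j) (w j))) = coin_product q"
    by (rule coin_product_density) (use p_open in \<open>auto simp: q_def less_imp_le\<close>)
  moreover have "(\<Prod>j\<in>J. bit_ratio (p j) (q j) (w j)) = 2 ^ card S * indicator C w" for w
  proof (cases "w \<in> C")
    case True
    then have "(\<Prod>j\<in>J. bit_ratio (p j) (q j) (w j)) = (\<Prod>j\<in>J. 2)"
      by (intro prod.cong) (auto simp: C_def pJ q_def bit_ratio_def bit_prob_def)
    with True show ?thesis by (simp add: cJ)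
  next
    case False
    then obtain j where "j \<in> J" "\<not> w j" by (auto simp: C_def)
    then have "(\<Prod>j\<in>J. bit_ratio (p j) (q j) (w j)) = 0"
      by (intro prod_zero) (auto simp: q_def bit_ratio_def bit_prob_def intro!: bexI[of _ j])
    with False show ?thesis by simp
  qed
  ultimately have dq: "density \<mu> (\<lambda>w. ennreal (2 ^ card S * indicator C w)) = coin_product q" by simp
  have "emeasure (coin_product q) ?A = emeasure \<mu> ?A"
  proof (rule emeasure_coin_product_cong[where J="{0..<int (Suc r * d)}"])
    fix w w' :: "int \<Rightarrow> bool" assume eq: "\<And>j. j \<in> {0..<int (Suc r * d)} \<Longrightarrow> w j = w' j"
    have "w i = w' i" if "i \<in> {0..<int d}" for i
      using that by (intro eq) (auto simp: of_nat_mult[symmetric] simp del: of_nat_mult intro: less_le_trans)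
    moreover have "w (i + int (s * d)) = w' (i + int (s * d))" if "s \<in> {1..r}" "i \<in> S" for s i
    proof (rule eq)
      have "s * d \<le> r * d" using that by simp
      then have "int (s * d) \<le> int (r * d)" by (simp only: of_nat_le_iff)
      moreover have "i < int d" "0 \<le> i" using that S by (auto simp: d_def)
      moreover have "int (Suc r * d) = int (r * d) + int d" by simp
      ultimately show "i + int (s * d) \<in> {0..<int (Suc r * d)}" by (simp only: atLeastLessThan_iff) linarith
    qed
    ultimately show "w \<in> ?A \<longleftrightarrow> w' \<in> ?A" by (auto simp: no_cover_def)
  next
    fix j assume "j \<in> {0..<int (Suc r * d)}"
    then have "j \<notin> J" using Jr[of j] by auto
    then show "q j = p j" by (simp add: q_def)
  qed (use A in auto)
  moreover have "emeasure (coin_product q) ?A = 2 ^ card S * emeasure \<mu> (?A \<inter> C)"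
  proof -
    have "emeasure (coin_product q) ?A = (\<integral>\<^sup>+w. ennreal (2 ^ card S * indicator C w) * indicator ?A w \<partial>\<mu>)"
      unfolding dq[symmetric] by (subst emeasure_density) auto
    also have "\<dots> = (\<integral>\<^sup>+w. 2 ^ card S * indicator (?A \<inter> C) w \<partial>\<mu>)"
      by (intro nn_integral_cong) (auto simp: indicator_def ennreal_power[symmetric])
    finally show ?thesis by (simp add: nn_integral_cmult)
  qed
  ultimately have e2: "emeasure \<mu> ?A = 2 ^ card S * emeasure \<mu> (?A \<inter> C)" by simp
  have "measure \<mu> ?A = 2 ^ card S * measure \<mu> (?A \<inter> C)"
  proof -
    from e2 have "ennreal (measure \<mu> ?A) = ennreal (2 ^ card S * measure \<mu> (?A \<inter> C))"
      by (simp add: \<mu>.emeasure_eq_measure ennreal_mult ennreal_power[symmetric])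
    then show ?thesis by (subst (asm) ennreal_inj) auto
  qed
  then have "measure \<mu> (?A \<inter> C) = measure \<mu> ?A / 2 ^ card S" by simp
  moreover have "no_cover d S (Suc r) = ?A - (?A \<inter> C)"
  proof -
    have "C = {w. \<forall>i\<in>S. w (i + int (Suc r * d))}" by (auto simp: C_def J_def)
    moreover have "{1..Suc r} = insert (Suc r) {1..r}" by auto
    ultimately show ?thesis
      unfolding no_cover_def by (auto simp del: of_nat_mult of_nat_Suc mult_Suc)
  qed
  moreover have "measure \<mu> (?A - (?A \<inter> C)) = measure \<mu> ?A - measure \<mu> (?A \<inter> C)"
    by (rule \<mu>.finite_measure_Diff) auto
  ultimately show ?thesis by (simp add: d_def right_diff_distrib)
qed

lemma one_minus_power_le:
  fixes x :: real
  assumes x: "0 < x" "x \<le> 1" and R: "R > 0" shows "(1 - x) ^ R \<le> 1 / (x * real R)"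
proof -
  have "(1 - x) ^ R * (1 + x * real R) \<le> (1 - x) ^ R * (1 + x) ^ R"
    using Bernoulli_inequality[of x R] x by (intro mult_left_mono) (auto simp: mult.commute)
  also have "\<dots> = (1 - x\<^sup>2) ^ R" by (simp add: power_mult_distrib[symmetric] power2_eq_square algebra_simps)
  also have "\<dots> \<le> 1" using x by (intro power_le_one) (auto simp: power_le_one abs_square_le_1)
  finally have "(1 - x) ^ R \<le> 1 / (1 + x * real R)" using x R by (simp add: pos_le_divide_eq add_pos_nonneg)
  also have "\<dots> \<le> 1 / (x * real R)" using x R by (intro divide_left_mono mult_pos_pos add_pos_pos) auto
  finally show ?thesis .
qed

text \<open>Given the set \<open>S\<close> of ones in the first window, all \<open>R\<close> windows fail with probability
  \<open>(1 - 1 / 2 ^ card S) ^ R\<close>, which is at most \<open>2 ^ card S / R\<close>. The mean of \<open>2 ^ card S\<close> is the product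
  of the numbers \<open>1 + p i\<close>, each at most \<open>8 / 5\<close>.\<close>

lemma prob_covering_window:
  assumes t: "t \<ge> 1" and R: "R > 0" "n t * R \<le> 2 ^ n t"
  shows "1 - (8 / 5) ^ n t / real R \<le> measure \<mu> {w. \<exists>N. n t \<le> N \<and> N \<le> 2 ^ n t \<and> (\<forall>i\<in>{0..<int (n t)}. w i \<longrightarrow> w (i + int N))}"
    (is "_ \<le> measure \<mu> ?G")
proof -
  define d where "d = n t"
  let ?I = "{0..<int d}"
  have G: "?G \<in> sets bits"
    by (rule sets_Collect_bits) measurable
  have "UNIV - ?G \<subseteq> (\<Union>S\<in>Pow ?I. no_cover d S R)"
  proof
    fix w assume w: "w \<in> UNIV - ?G"
    have "w \<in> no_cover d {i\<in>?I. w i} R"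
      unfolding no_cover_def
    proof (intro CollectI conjI ballI notI)
      fix s assume s: "s \<in> {1..R}" and all: "\<forall>i\<in>{i\<in>?I. w i}. w (i + int (s * d))"
      have "d * 1 \<le> d * s" "d * s \<le> d * R" using s by (auto intro: mult_le_mono2)
      from this(1) order_trans[OF this(2)] R(2) have "n t \<le> s * d \<and> s * d \<le> 2 ^ n t"
        by (simp only: d_def mult_1_right mult.commute[of s])
      with all w show False by (auto simp: d_def)
    qed auto
    then show "w \<in> (\<Union>S\<in>Pow ?I. no_cover d S R)" by auto
  qed
  then have "measure \<mu> (UNIV - ?G) \<le> measure \<mu> (\<Union>S\<in>Pow ?I. no_cover d S R)"
    using no_cover_measurable by (intro \<mu>.finite_measure_mono) auto
  also have "\<dots> \<le> (\<Sum>S\<in>Pow ?I. measure \<mu> (no_cover d S R))"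
    using no_cover_measurable by (intro \<mu>.finite_measure_subadditive_finite) auto
  also have "\<dots> \<le> (\<Sum>S\<in>Pow ?I. (\<Prod>i\<in>S. 2 * p i) * (\<Prod>i\<in>?I - S. 1 - p i) / real R)"
  proof (rule sum_mono)
    fix S assume "S \<in> Pow ?I"
    then have S: "S \<subseteq> ?I" by simp
    then have fS: "finite S" using finite_subset by blast
    have geo: "measure \<mu> (no_cover d S r) = measure \<mu> (no_cover d S 0) * (1 - 1 / 2 ^ card S) ^ r" if "r \<le> R" for r
      using that
    proof (induction r)
      case (Suc r)
      have "d * Suc r \<le> d * R" using Suc.prems by (intro mult_le_mono2)
      then have "n t * Suc r \<le> 2 ^ n t" using R(2) by (simp add: d_def)
      then show ?case
        using measure_no_cover_Suc[OF t, of S r] S Suc by (simp add: d_def)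
    qed simp
    have "emeasure \<mu> (no_cover d S 0) = (\<Prod>i\<in>?I. emeasure (bernoulli_pmf (p i)) (if i \<in> S then {True} else {False}))"
      unfolding no_cover_def by (subst emeasure_cylinder[symmetric]) auto
    also have "\<dots> = (\<Prod>i\<in>?I. ennreal (if i \<in> S then p i else 1 - p i))"
      using p_open by (intro prod.cong) (auto simp: emeasure_pmf_single less_imp_le)
    also have "\<dots> = ennreal (\<Prod>i\<in>?I. if i \<in> S then p i else 1 - p i)"
      using p_open by (intro prod_ennreal) (auto simp: less_imp_le)
    also have "(\<Prod>i\<in>?I. if i \<in> S then p i else 1 - p i) = (\<Prod>i\<in>S. p i) * (\<Prod>i\<in>?I - S. 1 - p i)"
      using S by (subst prod.If_cases) (auto simp: Int_absorb1 Diff_eq intro!: arg_cong2[where f="(*)"] prod.cong)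
    finally have m0: "measure \<mu> (no_cover d S 0) = (\<Prod>i\<in>S. p i) * (\<Prod>i\<in>?I - S. 1 - p i)"
      using p_open by (simp add: measure_def prod_nonneg less_imp_le)
    have "(1 - 1 / 2 ^ card S) ^ R \<le> 1 / (1 / 2 ^ card S * real R)"
      using R by (intro one_minus_power_le) auto
    then have "measure \<mu> (no_cover d S R) \<le> measure \<mu> (no_cover d S 0) * (2 ^ card S / real R)"
      unfolding geo[OF order_refl] by (intro mult_left_mono) auto
    also have "\<dots> = (\<Prod>i\<in>S. 2 * p i) * (\<Prod>i\<in>?I - S. 1 - p i) / real R"
      by (simp add: m0 prod.distrib)
    finally show "measure \<mu> (no_cover d S R) \<le> (\<Prod>i\<in>S. 2 * p i) * (\<Prod>i\<in>?I - S. 1 - p i) / real R" .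
  qed
  also have "\<dots> = (\<Prod>i\<in>?I. 2 * p i + (1 - p i)) / real R"
    by (subst prod_add) (auto simp: sum_divide_distrib)
  also have "\<dots> \<le> (\<Prod>i\<in>?I. 8 / 5) / real R"
  proof (intro divide_right_mono prod_mono conjI)
    fix i show "0 \<le> 2 * p i + (1 - p i)" "2 * p i + (1 - p i) \<le> 8 / 5"
      using p_bounds[of i] by auto
  qed simp
  finally have "measure \<mu> (UNIV - ?G) \<le> (8 / 5) ^ n t / real R" by (simp add: d_def)
  moreover have "measure \<mu> (UNIV - ?G) = 1 - measure \<mu> ?G"
    using \<mu>.prob_compl[of ?G] G by simp
  ultimately show ?thesis by simp
qed

text \<open>After cancelling the fair coins, the partial product compares the probabilities of the entries of \<open>w\<close>
  at \<open>i + N\<close> and at \<open>i\<close> under the same coin \<open>p i\<close>. Since \<open>p i \<ge> 1 / 2\<close>, a larger entry is at least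
  as probable.\<close>

lemma partial_rn_covering_window:
  assumes t: "t \<ge> 1" and N: "n t \<le> N" "N \<le> 2 ^ n t" and cover: "\<And>i. 0 \<le> i \<Longrightarrow> i < int (n t) \<Longrightarrow> w i \<Longrightarrow> w (i + int N)"
  shows "1 \<le> partial_rn N t w"
proof -
  let ?a = "\<lambda>i. 2 * bit_prob (p i) (w i)" and ?b = "\<lambda>i. 2 * bit_prob (p (i - int N)) (w i)"
  have mt: "int (m t) = int (n t) + int (2 ^ n t)" by (simp add: m_eq[OF t])
  have le: "int N + int (n t) \<le> int (m t)" using N(2) by (simp add: mt del: of_nat_power)
  have half: "2 * bit_prob (p j) x = 1" if "p j = 1 / 2" for j x using that by (simp add: bit_prob_def)
  have a_pos: "0 < ?a i" for i using p_open[of i] by (simp add: bit_prob_def)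
  have "partial_rn N t w = (\<Prod>i = 0..<int (m t). ?b i / ?a i)"
    unfolding partial_rn_def bit_ratio_def by simp
  also have "\<dots> = (\<Prod>i = 0..<int (m t). ?b i) / (\<Prod>i = 0..<int (m t). ?a i)"
    by (rule prod_dividef)
  also have "(\<Prod>i = 0..<int (m t). ?a i) = (\<Prod>i = 0..<int (n t). ?a i)"
    using le by (intro prod.mono_neutral_right) (auto intro!: half p_gap[OF t])
  also have "(\<Prod>i = 0..<int (m t). ?b i) = (\<Prod>i = int N..<int N + int (n t). ?b i)"
  proof (rule prod.mono_neutral_right)
    show "\<forall>i\<in>{0..<int (m t)} - {int N..<int N + int (n t)}. ?b i = 1"
    proof
      fix i assume i: "i \<in> {0..<int (m t)} - {int N..<int N + int (n t)}"
      then consider "i - int N < 0" | "int (n t) \<le> i - int N" by force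
      then have "p (i - int N) = 1 / 2"
        using i p_gap[OF t, of "i - int N"] p_neg by cases auto
      then show "?b i = 1" by (rule half)
    qed
  qed (use le in auto)
  also have "\<dots> = (\<Prod>i = 0..<int (n t). 2 * bit_prob (p i) (w (i + int N)))"
    by (rule prod.reindex_bij_witness[of _ "\<lambda>i. i + int N" "\<lambda>i. i - int N"]) auto
  finally have eq: "partial_rn N t w = (\<Prod>i = 0..<int (n t). 2 * bit_prob (p i) (w (i + int N))) / (\<Prod>i = 0..<int (n t). ?a i)" .
  have "(\<Prod>i = 0..<int (n t). ?a i) \<le> (\<Prod>i = 0..<int (n t). 2 * bit_prob (p i) (w (i + int N)))"
  proof (intro prod_mono conjI)
    fix i assume i: "i \<in> {0..<int (n t)}"
    show "0 \<le> ?a i" using a_pos by (simp add: less_imp_le)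
    show "?a i \<le> 2 * bit_prob (p i) (w (i + int N))"
      using cover[of i] i p_bounds[of i] by (auto simp: bit_prob_def)
  qed
  then show ?thesis unfolding eq using a_pos by (subst le_divide_eq_1_pos) (auto intro: prod_pos)
qed

lemma shift_rn_large:
  assumes t: "t \<ge> 1" and R: "R > 0" "n t * R \<le> 2 ^ n t"
  shows "1 - 1 / 2 ^ t - (8 / 5) ^ n t / real R \<le> measure \<mu> {w. \<exists>N\<ge>t. exp (-1) \<le> shift_rn N w}"
    (is "_ \<le> measure \<mu> ?H")
proof -
  let ?G = "{w. \<exists>N. n t \<le> N \<and> N \<le> 2 ^ n t \<and> (\<forall>i\<in>{0..<int (n t)}. w i \<longrightarrow> w (i + int N))}"
  let ?E = "{w. good_from t w}"
  have [measurable]: "?G \<in> sets bits" "?H \<in> sets bits" "?E \<in> sets bits"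
    by (rule sets_Collect_bits, measurable)+
  have "measure \<mu> ?G + measure \<mu> ?E - 1 \<le> measure \<mu> (?G \<inter> ?E)"
    using \<mu>.finite_measure_Union'[of ?G ?E] \<mu>.prob_le_1[of "?G \<union> ?E"] \<mu>.finite_measure_Diff'[of ?E ?G]
    by (simp add: Int_commute)
  also have "\<dots> \<le> measure \<mu> ?H"
  proof (rule \<mu>.finite_measure_mono_AE)
    have "AE w in \<mu>. \<forall>N. (\<lambda>t. partial_rn N t w) \<longlonglongrightarrow> shift_rn N w"
      unfolding AE_all_countable by (intro allI shift_rn_lim(1)[of "max 1 N" N for N]) auto
    then show "AE w in \<mu>. w \<in> ?G \<inter> ?E \<longrightarrow> w \<in> ?H"
    proof eventually_elim
      case (elim w)
      show ?case
      proof
        assume "w \<in> ?G \<inter> ?E"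
        then obtain N where N: "n t \<le> N" "N \<le> 2 ^ n t" and c: "\<forall>i\<in>{0..<int (n t)}. w i \<longrightarrow> w (i + int N)"
          and g: "good_from t w" by auto
        have "1 \<le> partial_rn N t w"
          using partial_rn_covering_window[OF t N] c by simp
        then have "exp (-1) \<le> partial_rn N s w" if "s \<ge> t" for s
          using partial_rn_lower[OF g N(2) t that] by (smt (verit) exp_gt_zero mult_le_cancel_right1)
        then have "exp (-1) \<le> shift_rn N w"
          using elim by (intro LIMSEQ_le_const[of "\<lambda>t. partial_rn N t w"]) auto
        moreover have "t \<le> N" using le_n[OF t] N by simp
        ultimately show "w \<in> ?H" by auto
      qed
    qed
  qed measurable
  finally show ?thesis
    using prob_covering_window[OF t R] prob_good_from[OF t] by simp
qed

text \<open>The gap after the \<open>t\<close>-th tent contains about \<open>2 ^ n t / n t\<close> windows, and \<open>(8 / 5) ^ n t\<close> is negligible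
  compared with this number.\<close>

lemma AE_cocycle_recurrent: "AE w in \<mu>. \<forall>T. \<exists>N\<ge>T. exp (-1) \<le> cocycle N w"
proof -
  have "AE w in \<mu>. \<exists>N\<ge>T. exp (-1) \<le> shift_rn N w" for T
  proof (rule \<mu>.AE_of_prob_lower_bound)
    let ?H = "\<lambda>T. {w \<in> space \<mu>. \<exists>N\<ge>T. exp (-1) \<le> shift_rn N w}"
    show meas: "?H T \<in> \<mu>.events" for T by measurable
    have "(\<lambda>d. real d * (4 / 5) ^ d :: real) \<longlonglongrightarrow> 0"
      by (rule powser_times_n_limit_0) simp
    moreover have "filterlim n at_top sequentially"
      by (rule filterlim_at_top_mono[OF filterlim_ident]) (use le_n in \<open>auto intro: eventually_sequentiallyI[of 1]\<close>)
    ultimately have "(\<lambda>t. real (n t) * (4 / 5) ^ n t :: real) \<longlonglongrightarrow> 0"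
      by (rule filterlim_compose)
    then have "(\<lambda>t. 1 - (1 / 2) ^ t - 2 * (real (n t) * (4 / 5) ^ n t) :: real) \<longlonglongrightarrow> 1 - 0 - 2 * 0"
      by (intro tendsto_intros LIMSEQ_power_zero) auto
    then show "(\<lambda>t. 1 - (1 / 2) ^ t - 2 * (real (n t) * (4 / 5) ^ n t) :: real) \<longlonglongrightarrow> 1" by simp
    fix t assume t: "t \<ge> max 1 T"
    \<comment> \<open>the number of disjoint windows that fit into the gap\<close>
    define R where "R = 2 ^ n t div n t"
    have d: "n t \<ge> 1" using le_n[of t] t by simp
    have nR: "n t * R \<le> 2 ^ n t" by (simp add: R_def)
    have R0: "R > 0" using d less_exp[of "n t"] by (simp add: R_def div_greater_zero_iff)
    have "2 ^ n t < n t * R + n t"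
      using d by (simp add: R_def) (metis add_less_cancel_left d less_le_trans mod_less_divisor mult_div_mod_eq zero_less_one)
    also have "\<dots> \<le> n t * R + n t * R" using R0 by simp
    finally have "real (2 ^ n t) \<le> real (2 * (n t * R))" by (simp only: of_nat_le_iff)
    then have R: "2 ^ n t \<le> 2 * real (n t) * real R" by simp
    have "(8 / 5) ^ n t / real R \<le> 2 * (real (n t) * (4 / 5) ^ n t)"
    proof -
      have "(8 / 5 :: real) ^ n t = (4 / 5) ^ n t * 2 ^ n t" by (simp add: power_mult_distrib[symmetric])
      also have "\<dots> \<le> (4 / 5) ^ n t * (2 * real (n t) * real R)" using R by (intro mult_left_mono) auto
      finally show ?thesis using R0 by (simp add: field_simps)
    qed
    moreover have "measure \<mu> (?H t) \<le> measure \<mu> (?H T)"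
      using t meas[of T] by (intro \<mu>.finite_measure_mono) (auto intro: order_trans)
    ultimately show "1 - (1 / 2) ^ t - 2 * (real (n t) * (4 / 5) ^ n t) \<le> measure \<mu> (?H T)"
      using shift_rn_large[of t R] t R0 nR by (simp add: power_divide)
  qed
  then have "AE w in \<mu>. \<forall>T. \<exists>N\<ge>T. exp (-1) \<le> shift_rn N w" by (simp add: AE_all_countable)
  moreover have "AE w in \<mu>. \<forall>N. cocycle N w = shift_rn N w"
    using AE_cocycle_eq by (simp add: AE_all_countable)
  ultimately show ?thesis by eventually_elim simp
qed

section \<open>Ergodicity of the Maharam extension\<close>

sublocale open_coins p
  by standard (rule p_open)


abbreviation \<T> :: "(int \<Rightarrow> bool) \<times> real \<Rightarrow> (int \<Rightarrow> bool) \<times> real" where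
  "\<T> \<equiv> skew full_shift (shift_rn 1)"

definition \<T>_inv :: "(int \<Rightarrow> bool) \<times> real \<Rightarrow> (int \<Rightarrow> bool) \<times> real" where
  "\<T>_inv = (\<lambda>(x, y). (unshift x, y - ln (shift_rn 1 (unshift x))))"

lemma \<T>_inverse: "\<T>_inv (\<T> z) = z" "\<T> (\<T>_inv z) = z"
  by (cases z; simp add: \<T>_inv_def skew_def)+

lemma \<T>_measurable: "\<T> \<in> \<M> \<rightarrow>\<^sub>M \<M>"
  unfolding measurable_\<M>_iff by measurable

lemma \<T>_inv_measurable: "\<T>_inv \<in> \<M> \<rightarrow>\<^sub>M \<M>"
  unfolding measurable_\<M>_iff \<T>_inv_def by measurable

lemma density_shift_rn_1: "density \<mu> (shift_rn 1) = distr \<mu> bits unshift"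
  by (simp add: density_shift_rn distr_unshift)

lemma distr_\<T>: "distr \<M> \<M> \<T> = \<M>"
proof -
  have "distr \<M> (\<mu> \<Otimes>\<^sub>M borel) \<T> = \<M>"
  proof (rule distr_skew[where S'=unshift])
    show "density \<mu> (\<lambda>x. ennreal (shift_rn 1 x)) = distr \<mu> \<mu> unshift"
      using density_shift_rn_1 distr_cong[of \<mu> \<mu> bits \<mu> unshift unshift] by simp
  qed (auto simp: shift_rn_pos)
  moreover have "distr \<M> (\<mu> \<Otimes>\<^sub>M borel) \<T> = distr \<M> \<M> \<T>"
    by (intro distr_cong) (auto simp: sets_maharam_measure)
  ultimately show ?thesis by simp
qed

lemma \<T>_power: "(\<T> ^^ N) z = ((full_shift ^^ N) (fst z), snd z + ln (cocycle N (fst z)))"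
proof (induction N arbitrary: z)
  case 0
  then show ?case by (simp add: cocycle_def)
next
  case (Suc N)
  have "(\<T> ^^ Suc N) z = (\<T> ^^ N) (\<T> z)" by (simp add: funpow_swap1)
  also have "\<dots> = ((full_shift ^^ N) (fst (\<T> z)), snd (\<T> z) + ln (cocycle N (fst (\<T> z))))" by (rule Suc)
  also have "\<dots> = ((full_shift ^^ Suc N) (fst z), snd z + ln (cocycle (Suc N) (fst z)))"
    by (cases z) (simp add: skew_def cocycle_Suc ln_mult_pos shift_rn_pos cocycle_pos funpow_swap1)
  finally show ?case .
qed

text \<open>The loss of 1 in the height comes from the bound \<open>exp (-1)\<close> for the cocycle.\<close>

lemma \<T>_recurrent:
  "AE z in \<M>. z \<in> upper (c + 1) \<longrightarrow> infinite {N. (\<T> ^^ N) z \<in> upper c}"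
  using AE_fst_\<M>[OF AE_cocycle_recurrent]
proof eventually_elim
  case (elim z)
  show ?case
  proof
    assume z: "z \<in> upper (c + 1)"
    show "infinite {N. (\<T> ^^ N) z \<in> upper c}"
      unfolding infinite_nat_iff_unbounded_le
    proof
      fix T
      obtain N where N: "N \<ge> T" "exp (-1) \<le> cocycle N (fst z)" using elim by blast
      have "-1 \<le> ln (cocycle N (fst z))" using N(2) by (subst ln_ge_iff) (auto simp: cocycle_pos)
      then show "\<exists>n\<ge>T. n \<in> {N. (\<T> ^^ N) z \<in> upper c}"
        using N(1) z by (intro exI[of _ N]) (auto simp: \<T>_power mem_Times_iff simp del: One_nat_def)
    qed
  qed
qed

lemma shift_rn_flip_neg:
  assumes "j < 0" shows "shift_rn l (flip j w) = shift_rn l w"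
proof -
  have "partial_rn l t (flip j w) = partial_rn l t w" for t
    unfolding partial_rn_def using assms by (intro prod.cong) (auto simp: flip_apply)
  then show ?thesis by (simp add: shift_rn_def)
qed

lemma ext_flip_neg: "j < 0 \<Longrightarrow> ext_flip j z = base_flip j z"
  by (cases z) (simp add: ext_flip_def skew_def base_flip_def flip_ratio_def bit_prob_def p_neg)

text \<open>To the left of 0 the coins are fair and the derivative of the shift is blind to the coordinates, so
  flips there leave the height alone and are merely moved to the left by \<open>\<T>\<close>, where the sets of the
  approximating algebra no longer see them.\<close>

lemma ext_flip_neg_invariance:
  assumes j: "j < 0" and A: "A \<in> sets \<M>" and inv: "AE z in \<M>. \<T> z \<in> A \<longleftrightarrow> z \<in> A"
  shows "AE z in \<M>. ext_flip j z \<in> A \<longleftrightarrow> z \<in> A"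
proof (rule AE_upper)
  fix i0 :: nat
  define c where "c = - real i0 - 1"
  define \<phi> where "\<phi> i = base_flip (j - int i)" for i
  have "AE z in \<M>. z \<in> upper (c + 1) \<longrightarrow> (\<phi> 0 z \<in> A \<longleftrightarrow> z \<in> A)"
  proof (rule asymptotic_invariance[where T=\<T> and U=\<T>_inv and K="upper c"])
    show "distr \<M> \<M> (\<phi> 0) = \<M>"
      using distr_ext_flip[of j] distr_cong[of \<M> \<M> \<M> \<M> "ext_flip j" "\<phi> 0"] ext_flip_neg[OF j] by (simp add: \<phi>_def)
    show "\<T> (\<phi> i z) = \<phi> (Suc i) (\<T> z)" for i z
      using j shift_rn_flip_neg[of "j - int i" 1]
      by (cases z) (simp add: \<phi>_def base_flip_def skew_def full_shift_flip algebra_simps)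
    show "\<phi> 0 \<in> \<M> \<rightarrow>\<^sub>M \<M>" unfolding measurable_\<M>_iff \<phi>_def by measurable
    show "upper c \<in> sets \<M>" "upper (c + 1) \<in> sets \<M>" by (simp_all add: sets_\<M>)
    show "upper (c + 1) \<subseteq> upper c" by auto
    show "\<phi> i z \<in> upper c \<longleftrightarrow> z \<in> upper c" "\<phi> 0 z \<in> upper (c + 1) \<longleftrightarrow> z \<in> upper (c + 1)" for i z
      by (auto simp: \<phi>_def base_flip_def mem_Times_iff)
    fix e :: real assume "e > 0"
    from approximation_by_flip_invariant[OF A this, of c]
    obtain G N where G: "G \<in> sets \<M>" "emeasure \<M> (sym_diff A G \<inter> upper c) \<le> ennreal e"
      and N: "\<And>j z. int N \<le> \<bar>j\<bar> \<Longrightarrow> base_flip j z \<in> G \<longleftrightarrow> z \<in> G"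
      unfolding eventually_flip_invariant_def by blast
    have "\<forall>n\<ge>N. \<forall>z. \<phi> n z \<in> G \<longleftrightarrow> z \<in> G" using N j by (simp add: \<phi>_def)
    with G show "\<exists>G\<in>sets \<M>. \<exists>N. emeasure \<M> (sym_diff A G \<inter> upper c) \<le> ennreal e \<and> (\<forall>n\<ge>N. \<forall>z. \<phi> n z \<in> G \<longleftrightarrow> z \<in> G)"
      by blast
  qed (use \<T>_inverse \<T>_measurable \<T>_inv_measurable distr_\<T> \<T>_recurrent A inv space_\<M> in auto)
  then show "AE z in \<M>. z \<in> upper (- real i0) \<longrightarrow> (ext_flip j z \<in> A \<longleftrightarrow> z \<in> A)"
    by (simp add: c_def \<phi>_def ext_flip_neg[OF j])
qed

text \<open>The chain rule for the two factorisations of the shift followed by a flip at \<open>j - 1\<close>, which is the flip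
  at \<open>j\<close> followed by the shift. It follows from uniqueness of densities.\<close>

lemma shift_rn_flip:
  "AE w in \<mu>. flip_ratio p j w * shift_rn 1 (flip j w) = shift_rn 1 w * flip_ratio p (j - 1) (full_shift w)"
proof -
  let ?f = "shift_rn 1" and ?p' = "\<lambda>i. p (i - 1)"
  have td: "density \<mu> ?f = coin_product ?p'" using density_shift_rn[of 1] by simp
  have "density \<mu> (\<lambda>w. ennreal (?f w) * ennreal (flip_ratio ?p' j w)) = density (density \<mu> ?f) (flip_ratio ?p' j)"
    by (subst density_density_eq) auto
  also have "\<dots> = distr (density \<mu> ?f) bits (flip j)"
    unfolding td by (rule distr_flip[symmetric]) (rule p_open)
  also have "\<dots> = density (density \<mu> (flip_ratio p j)) (\<lambda>w. ?f (flip j w))"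
  proof -
    have flip_back: "distr (distr \<mu> bits (flip j)) bits (flip j) = \<mu>"
      by (subst distr_distr) (auto simp: comp_def intro!: distr_id2)
    have "distr (density (distr (distr \<mu> bits (flip j)) bits (flip j)) ?f) (distr \<mu> bits (flip j)) (flip j) =
       density (distr \<mu> bits (flip j)) (\<lambda>w. ?f (flip j w))"
      by (subst distr_density_distr[where T="flip j" and T'="flip j"]) (auto simp: comp_def)
    moreover have "distr (density \<mu> ?f) bits (flip j) = distr (density \<mu> ?f) (distr \<mu> bits (flip j)) (flip j)"
      by (intro distr_cong) auto
    ultimately have "distr (density \<mu> ?f) bits (flip j) = density (distr \<mu> bits (flip j)) (\<lambda>w. ?f (flip j w))"
      by (simp only: flip_back)
    then show ?thesis by (simp only: distr_flip[OF p_open])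
  qed
  also have "\<dots> = density \<mu> (\<lambda>w. ennreal (flip_ratio p j w) * ennreal (?f (flip j w)))"
    by (subst density_density_eq) auto
  finally have "AE w in \<mu>. ennreal (?f w) * ennreal (flip_ratio ?p' j w) = ennreal (flip_ratio p j w) * ennreal (?f (flip j w))"
    by (subst (asm) \<mu>.density_unique_iff) auto
  then show ?thesis
  proof eventually_elim
    case (elim w)
    have "flip_ratio ?p' j w = flip_ratio p (j - 1) (full_shift w)"
      by (simp add: flip_ratio_def full_shift_def)
    moreover have "ennreal (?f w * flip_ratio ?p' j w) = ennreal (flip_ratio p j w * ?f (flip j w))"
      using elim flip_ratio_pos[of j w] shift_rn_pos[of 1 w]
      by (simp add: ennreal_mult' less_imp_le shift_rn_pos)
    ultimately show ?case
      using flip_ratio_pos shift_rn_pos by (simp add: less_imp_le)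
  qed
qed

text \<open>By the chain rule \<open>\<T>\<close> carries the extended flip at \<open>j\<close> to the one at \<open>j - 1\<close>, so invariance propagates
  from the negative coordinates to the right.\<close>

lemma ext_flip_invariance:
  assumes A: "A \<in> sets \<M>" and inv: "AE z in \<M>. \<T> z \<in> A \<longleftrightarrow> z \<in> A"
  shows "AE z in \<M>. ext_flip j z \<in> A \<longleftrightarrow> z \<in> A"
proof (cases "j < 0")
  case False
  have "AE z in \<M>. ext_flip (int i - 1) z \<in> A \<longleftrightarrow> z \<in> A" for i
  proof (induction i)
    case (Suc i)
    have eq: "int (Suc i) - 1 = int i" by simp
    have lf: "ext_flip (int i) \<in> \<M> \<rightarrow>\<^sub>M \<M>" unfolding measurable_\<M>_iff by measurable
    have "AE z in distr \<M> \<M> (ext_flip (int i)). \<T> z \<in> A \<longleftrightarrow> z \<in> A" unfolding distr_ext_flip by (rule inv)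
    note 1 = AE_distrD[OF lf this]
    have "AE z in distr \<M> \<M> \<T>. ext_flip (int i - 1) z \<in> A \<longleftrightarrow> z \<in> A" unfolding distr_\<T> by (rule Suc)
    note 2 = AE_distrD[OF \<T>_measurable this]
    show ?case
      unfolding eq using 1 2 inv AE_fst_\<M>[OF shift_rn_flip[of "int i"]]
    proof eventually_elim
      case (elim z)
      have "\<T> (ext_flip (int i) z) = ext_flip (int i - 1) (\<T> z)"
      proof -
        obtain x y where z: "z = (x, y)" by fastforce
        have "ln (flip_ratio p (int i) x) + ln (shift_rn 1 (flip (int i) x)) =
          ln (flip_ratio p (int i) x * shift_rn 1 (flip (int i) x))"
          by (simp add: ln_mult_pos flip_ratio_pos shift_rn_pos)
        also have "\<dots> = ln (shift_rn 1 x * flip_ratio p (int i - 1) (full_shift x))"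
          using elim(4) by (simp add: z)
        also have "\<dots> = ln (shift_rn 1 x) + ln (flip_ratio p (int i - 1) (full_shift x))"
          by (simp add: ln_mult_pos flip_ratio_pos shift_rn_pos)
        finally show ?thesis by (simp add: z ext_flip_def skew_def full_shift_flip)
      qed
      with elim show ?case by simp
    qed
  qed (use ext_flip_neg_invariance[OF _ A inv, of "-1"] in simp)
  from this[of "nat (j + 1)"] False show ?thesis by simp
qed (rule ext_flip_neg_invariance[OF _ A inv])

text \<open>A lower bound on \<open>k\<close>, so that the tents become flat. By the \<open>L\<^sup>1\<close> estimate for \<open>l = 1\<close> the coins at \<open>m t\<close> and
  \<open>m t + 1\<close> differ by at most \<open>2 / 2 ^ t\<close>, whereas the slope of the tent makes them differ by at least
  \<open>1 / (6 * 2 ^ k (Suc t))\<close>.\<close>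

lemma k_large:
  assumes t: "t \<ge> 1" shows "t \<le> k (Suc t) + 4"
proof -
  define K where "K = k (Suc t)"
  have K: "K \<ge> 1" unfolding K_def by (rule k_pos) simp
  define j where "j = int (m t) + 1"
  define x :: real where "x = 1 / 2 ^ K"
  have x: "0 < x" "x \<le> 1 / 2"
  proof -
    have "(2::real) ^ 1 \<le> 2 ^ K" using K by (intro power_increasing) auto
    then show "x \<le> 1 / 2" unfolding x_def by (simp add: field_simps)
  qed (simp add: x_def)
  have "(2::nat) ^ 1 \<le> 2 ^ k (Suc t)" using K by (intro power_increasing) (auto simp: K_def)
  then have mm: "m t + 2 \<le> m (Suc t)" using n_less_m[of t] by (simp add: n_Suc)
  have "lam K 1 = 1 + x"
  proof -
    have "(1::int) \<le> 2 ^ (K - 1)" by simp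
    then show ?thesis by (simp add: lam_def x_def)
  qed
  then have pj: "p j = (1 + x) / (2 + x)"
    using p_in_block[of 1 t] mm by (simp add: j_def K_def[symmetric] lam_prob_def add.commute)
  have pj': "p (j - 1) = 1 / 2"
    using p_in_block[of 0 t] mm lam_prob_outside[OF K, of 0] by (simp add: j_def K_def[symmetric])
  define C where "C = {w :: int \<Rightarrow> bool. \<forall>i\<in>{j}. w i \<in> {True}}"
  have C [measurable]: "C \<in> sets bits" unfolding C_def by (rule cylinder_measurable) simp
  have eC: "emeasure (coin_product q) C = ennreal (q j)" if "0 \<le> q j" "q j \<le> 1" for q
    unfolding C_def by (subst emeasure_cylinder) (use that in \<open>auto simp: emeasure_pmf_single\<close>)
  have "ennreal (p j) = emeasure (density \<mu> (\<lambda>_. ennreal 1)) C"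
    using p_open[of j] by (simp add: eC less_imp_le density_1)
  also have "\<dots> \<le> emeasure (density \<mu> (block_ratio 1 t)) C + (\<integral>\<^sup>+w. \<bar>1 - block_ratio 1 t w\<bar> \<partial>\<mu>)"
    by (rule emeasure_density_le_L1) (auto simp: less_imp_le block_ratio_pos)
  also have "\<dots> \<le> ennreal (1 / 2) + ennreal (4 * (1 / 2 ^ Suc t))"
  proof (rule add_mono)
    show "(\<integral>\<^sup>+w. \<bar>1 - block_ratio 1 t w\<bar> \<partial>\<mu>) \<le> ennreal (4 * (1 / 2 ^ Suc t))"
      unfolding abs_minus_commute[of 1] by (rule block_ratio_L1[OF t]) simp
    have "j \<in> {int (m t)..<int (m (Suc t))}" using mm by (simp add: j_def)
    then show "emeasure (density \<mu> (block_ratio 1 t)) C \<le> ennreal (1 / 2)"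
      unfolding density_block_ratio by (subst eC) (auto simp: pj')
  qed
  also have "\<dots> = ennreal (1 / 2 + 4 * (1 / 2 ^ Suc t))" by (rule ennreal_plus[symmetric]) auto
  finally have "p j \<le> 1 / 2 + 4 * (1 / 2 ^ Suc t)"
    by (subst (asm) ennreal_le_iff) auto
  moreover have "p j - 1 / 2 = x / (2 * (2 + x))"
    using x(1) by (simp add: pj field_simps)
  moreover have "x / 6 \<le> x / (2 * (2 + x))" using x by (intro divide_left_mono) auto
  ultimately have "x / 6 \<le> 4 * (1 / 2 ^ Suc t)" by linarith
  then have "x \<le> 12 / 2 ^ t" by (simp add: field_simps)
  then have "(2::real) ^ t \<le> 12 * 2 ^ K" by (simp add: x_def field_simps)
  also have "\<dots> \<le> 2 ^ 4 * 2 ^ K" by simp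
  also have "\<dots> = 2 ^ (K + 4)" by (simp add: power_add)
  finally have "(2::real) ^ t \<le> 2 ^ (K + 4)" .
  then show ?thesis by (simp add: K_def)
qed

text \<open>On the rising side of the tent with parameter \<open>K\<close> the odds are \<open>1 + d / 2 ^ K\<close>; once \<open>K \<ge> i\<close>, the
  position \<open>d = 2 ^ (K - i)\<close> gives the required value exactly.\<close>

lemma odds_essential_value:
  assumes i: "i \<ge> 1" shows "\<exists>j. int N \<le> j \<and> odds j = 1 + 1 / 2 ^ i"
proof -
  \<comment> \<open>the offset 5 makes up for the 4 in \<open>k_large\<close>\<close>
  define t where "t = N + i + 5"
  define K where "K = k (Suc t)"
  have "t \<le> K + 4" unfolding K_def by (rule k_large) (simp add: t_def)
  then have K: "i \<le> K" "K \<ge> 1" using i by (auto simp: t_def)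
  define d :: int where "d = 2 ^ (K - i)"
  have d: "0 \<le> d" "d \<le> 2 ^ (K - 1)" "d \<le> 2 ^ K"
    using i unfolding d_def by (auto intro!: power_increasing)
  have pd: "p (d + int (m t)) = lam_prob K d"
    unfolding K_def
  proof (rule p_in_block)
    have "int (m t + 2 ^ k (Suc t)) < int (m (Suc t))"
      using n_less_m[of t] n_Suc[of t] by (simp only: of_nat_less_iff)
    then have "int (m (Suc t)) - int (m t) > 2 ^ k (Suc t)" by simp
    then show "d < int (m (Suc t)) - int (m t)" using d(3) by (simp add: K_def)
  qed (rule d(1))
  have "lam K d = 1 + real_of_int d / 2 ^ K" using d by (simp add: lam_def)
  also have "real_of_int d = 2 ^ K / 2 ^ i"
    unfolding d_def using K by (simp only: of_int_power of_int_numeral) (simp add: power_diff)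
  finally have lam: "lam K d = 1 + 1 / 2 ^ i" by simp
  have "0 < lam K d" unfolding lam by (simp add: add_pos_pos)
  then have "1 - lam K d / (1 + lam K d) = 1 / (1 + lam K d)" by (simp add: field_simps)
  then have "odds (d + int (m t)) = lam K d"
    using \<open>0 < lam K d\<close> unfolding odds_def pd lam_prob_def by simp
  then have "odds (d + int (m t)) = 1 + 1 / 2 ^ i" by (simp only: lam)
  moreover have "int N \<le> d + int (m t)" using d(1) le_m[of t] by (simp add: t_def)
  ultimately show ?thesis by blast
qed

lemma \<T>_invariant_trivial:
  assumes A: "A \<in> sets \<M>" and inv: "AE z in \<M>. \<T> z \<in> A \<longleftrightarrow> z \<in> A"
  shows "(AE z in \<M>. z \<notin> A) \<or> (AE z in \<M>. z \<in> A)"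
proof (rule invariant_under_flips_and_shifts_trivial[OF A])
  let ?r = "\<lambda>i. ln (1 + 1 / 2 ^ Suc i) :: real"
  show "0 < ?r i" for i by (intro ln_gt_zero) simp
  have "(\<lambda>i. 1 + (1 / 2) ^ Suc i :: real) \<longlonglongrightarrow> 1 + 0"
    by (intro tendsto_add tendsto_const LIMSEQ_Suc LIMSEQ_power_zero) simp
  from tendsto_ln[OF this] show "?r \<longlonglongrightarrow> 0" by (simp add: power_divide)
  show "AE z in \<M>. ext_flip j z \<in> A \<longleftrightarrow> z \<in> A" for j by (rule ext_flip_invariance[OF A inv])
  show "AE z in \<M>. fibre_shift (?r i) z \<in> A \<longleftrightarrow> z \<in> A" for i
  proof (rule fibre_shift_invariance_of_essential_value[OF A ext_flip_invariance[OF A inv]])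
    show "0 \<le> ?r i" by (intro ln_ge_zero) simp
    show "odds j \<le> 2" for j using p_bounds[of j] by (simp add: odds_def field_simps)
    show "\<exists>j. int N \<le> j \<and> ln (odds j) = ?r i" for N
      using odds_essential_value[of "Suc i" N] by auto
  qed
qed

lemma invertible_full_shift: "invertible_measurable \<mu> full_shift"
  using bij_full_shift by (auto simp: invertible_measurable_def inv_full_shift)

lemma unshift_full_shift_power: "(unshift ^^ a) ((full_shift ^^ (a + b)) w) = (full_shift ^^ b) w"
  by (simp only: unshift_power full_shift_power) (simp add: algebra_simps)

lemma null_set_pullback:
  assumes E: "E \<in> sets bits" and "emeasure \<mu> ((full_shift ^^ N) -` E) = 0"
  shows "emeasure \<mu> E = 0"
proof -
  let ?F = "(full_shift ^^ N) -` E"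
  have F: "?F \<in> sets bits" by (rule vimage_sets_bits[OF full_shift_power_measurable E])
  then have "?F \<in> null_sets \<mu>" using assms by (intro null_setsI) auto
  then have "?F \<in> null_sets (density \<mu> (cocycle N))"
    by (subst null_sets_density_iff) (auto dest: AE_not_in)
  then have "emeasure (distr \<mu> bits (unshift ^^ N)) ?F = 0"
    by (simp add: density_cocycle distr_unshift_power null_sets_def)
  moreover have "(unshift ^^ N) -` ?F = E"
    by (auto simp: unshift_power full_shift_power)
  moreover have "unshift ^^ N \<in> bits \<rightarrow>\<^sub>M bits"
    by (rule measurable_compose_n) measurable
  then have "unshift ^^ N \<in> \<mu> \<rightarrow>\<^sub>M bits"
    by (simp add: measurable_cong_sets[OF sets_coin_product refl])
  ultimately show ?thesis using F by (simp add: emeasure_distr)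
qed

lemma nonsingular_full_shift: "nonsingular \<mu> full_shift"
  unfolding nonsingular_def
proof (intro conjI invertible_full_shift set_eqI iffI)
  fix E assume "E \<in> null_sets (distr \<mu> \<mu> full_shift)"
  then have E: "E \<in> sets bits" "emeasure \<mu> (full_shift -` E) = 0"
    by (auto simp: null_sets_def emeasure_distr)
  then show "E \<in> null_sets \<mu>" using null_set_pullback[of E 1] by (auto intro: null_setsI)
next
  fix E assume E: "E \<in> null_sets \<mu>"
  then have Es: "E \<in> sets bits" by auto
  have F: "full_shift -` E \<in> sets bits" by (rule vimage_sets_bits[OF full_shift_measurable Es])
  have "emeasure (distr \<mu> bits unshift) (full_shift -` E) = emeasure \<mu> E"
    using F by (subst emeasure_distr) (auto simp: vimage_def)
  also have "\<dots> = 0" using E by auto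
  finally have "full_shift -` E \<in> null_sets (density \<mu> (shift_rn 1))"
    using F by (intro null_setsI) (auto simp: density_shift_rn_1 simp del: One_nat_def)
  then have "AE w in \<mu>. w \<in> full_shift -` E \<longrightarrow> ennreal (shift_rn 1 w) = 0"
    by (subst (asm) null_sets_density_iff) auto
  then have "AE w in \<mu>. w \<notin> full_shift -` E"
  proof eventually_elim
    case (elim w)
    then show ?case using shift_rn_pos[of 1 w] by (simp only: ennreal_eq_0_iff not_le[symmetric]) blast
  qed
  then have "emeasure \<mu> (full_shift -` E) = 0"
    using F by (subst (asm) AE_iff_null_sets[symmetric]) auto
  then show "E \<in> null_sets (distr \<mu> \<mu> full_shift)"
    using Es by (intro null_setsI) (auto simp: emeasure_distr)
qed

text \<open>The forward images of a wandering set \<open>W\<close> are almost disjoint too, and their measures are the integrals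
  of the cocycle over \<open>W\<close>. So the cocycle is summable almost everywhere on \<open>W\<close>, against recurrence.\<close>

lemma conservative_full_shift: "conservative \<mu> full_shift"
  unfolding conservative_def
proof (intro conjI nonsingular_full_shift allI impI)
  fix W assume "wandering \<mu> full_shift W"
  then have W [measurable]: "W \<in> sets bits"
    and wand: "\<And>i j. i \<ge> 1 \<Longrightarrow> j \<ge> 1 \<Longrightarrow> i \<noteq> j \<Longrightarrow>
      emeasure \<mu> (((full_shift ^^ i) -` W) \<inter> ((full_shift ^^ j) -` W)) = 0"
    by (auto simp: wandering_def null_eq_def null_sets_def)
  define X where "X i = (unshift ^^ Suc i) -` W" for i
  have U: "unshift ^^ N \<in> bits \<rightarrow>\<^sub>M bits" for N by (intro measurable_compose_n) measurable
  have X [measurable]: "X i \<in> sets bits" for i unfolding X_def by (rule vimage_sets_bits[OF U W])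
  have XX: "AE w in \<mu>. \<not> (w \<in> X i \<and> w \<in> X j)" if "i \<noteq> j" for i j
  proof -
    have "(full_shift ^^ (Suc i + Suc j)) -` (X i \<inter> X j) = ((full_shift ^^ Suc j) -` W) \<inter> ((full_shift ^^ Suc i) -` W)"
      using unshift_full_shift_power[of "Suc i" "Suc j"] unshift_full_shift_power[of "Suc j" "Suc i"]
      unfolding X_def add.commute[of "Suc j" "Suc i"] by (intro set_eqI) (simp only: vimage_eq Int_iff)
    moreover have "emeasure \<mu> (((full_shift ^^ Suc j) -` W) \<inter> ((full_shift ^^ Suc i) -` W)) = 0"
      using that by (intro wand) simp_all
    ultimately have "emeasure \<mu> (X i \<inter> X j) = 0"
      by (intro null_set_pullback[OF sets.Int[OF X X], of "Suc i + Suc j"]) (simp only:)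
    then have "X i \<inter> X j \<in> null_sets \<mu>" using X[of i] X[of j] by (intro null_setsI) auto
    from AE_not_in[OF this] show ?thesis by eventually_elim auto
  qed
  have "AE w in \<mu>. \<forall>i j. i \<noteq> j \<longrightarrow> \<not> (w \<in> X i \<and> w \<in> X j)"
    unfolding AE_all_countable
  proof (intro allI)
    fix i j
    show "AE w in \<mu>. i \<noteq> j \<longrightarrow> \<not> (w \<in> X i \<and> w \<in> X j)"
      using XX[of i j] by (cases "i = j") auto
  qed
  then have le: "AE w in \<mu>. (\<Sum>i. indicator (X i) w) \<le> (1 :: ennreal)"
  proof eventually_elim
    case (elim w)
    show ?case
    proof (cases "\<exists>i. w \<in> X i")
      case True
      then obtain i where i: "w \<in> X i" by blast
      have "(\<Sum>i. indicator (X i) w :: ennreal) = (\<Sum>j\<in>{i}. indicator (X j) w)"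
        using elim i by (intro suminf_finite) (auto simp: indicator_def)
      then show ?thesis using i by simp
    qed (simp add: indicator_def)
  qed
  have eX: "emeasure \<mu> (X i) = (\<integral>\<^sup>+w. ennreal (cocycle (Suc i) w) * indicator W w \<partial>\<mu>)" for i
  proof -
    have "emeasure \<mu> (X i) = emeasure (distr \<mu> bits (unshift ^^ Suc i)) W"
      using U[of "Suc i"] by (subst emeasure_distr) (auto simp: X_def)
    also have "\<dots> = emeasure (density \<mu> (cocycle (Suc i))) W"
      by (simp only: distr_unshift_power density_cocycle)
    finally show ?thesis by (simp add: emeasure_density)
  qed
  have "(\<integral>\<^sup>+w. (\<Sum>i. ennreal (cocycle (Suc i) w) * indicator W w) \<partial>\<mu>) = (\<Sum>i. emeasure \<mu> (X i))"
    unfolding eX by (rule nn_integral_suminf) measurable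
  also have "\<dots> = (\<integral>\<^sup>+w. (\<Sum>i. indicator (X i) w) \<partial>\<mu>)"
    by (subst nn_integral_suminf) auto
  also have "\<dots> \<le> (\<integral>\<^sup>+w. 1 \<partial>\<mu>)" using le by (rule nn_integral_mono_AE)
  also have "\<dots> = 1" using \<mu>.emeasure_space_1 by simp
  finally have "(\<integral>\<^sup>+w. (\<Sum>i. ennreal (cocycle (Suc i) w) * indicator W w) \<partial>\<mu>) \<noteq> \<infinity>"
    by (auto simp: top_unique)
  then have "AE w in \<mu>. (\<Sum>i. ennreal (cocycle (Suc i) w) * indicator W w) \<noteq> \<infinity>"
    by (intro nn_integral_PInf_AE) measurable
  then have "AE w in \<mu>. w \<notin> W"
    using AE_cocycle_recurrent
  proof eventually_elim
    case (elim w)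
    show ?case
    proof
      assume "w \<in> W"
      then have "(\<Sum>i. ennreal (cocycle (Suc i) w)) \<noteq> \<top>" using elim(1) by simp
      then have "summable (\<lambda>i. cocycle (Suc i) w)"
        by (rule summable_suminf_not_top[OF less_imp_le[OF cocycle_pos]])
      then have "(\<lambda>i. cocycle (Suc i) w) \<longlonglongrightarrow> 0" by (rule summable_LIMSEQ_zero)
      then have "\<forall>\<^sub>F i in sequentially. cocycle (Suc i) w < exp (-1)"
        by (rule order_tendstoD) simp
      then obtain T where T: "\<And>i. i \<ge> T \<Longrightarrow> cocycle (Suc i) w < exp (-1)" by (auto simp: eventually_sequentially)
      obtain N where N: "N \<ge> Suc T" "exp (-1) \<le> cocycle N w" using elim(2) by blast
      then obtain i where "N = Suc i" "i \<ge> T" by (cases N) auto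
      then show False using T[of i] N(2) by simp
    qed
  qed
  then show "W \<in> null_sets \<mu>" using W by (subst (asm) AE_iff_null_sets[symmetric]) auto
qed

lemma rn_power_full_shift: "AE w in \<mu>. rn_power \<mu> full_shift 1 w = shift_rn 1 w"
  by (rule rn_power_coin_product) (auto simp: density_shift_rn less_imp_le shift_rn_pos)

lemma maharam_map_AE: "AE z in \<M>. maharam_map \<mu> full_shift z = \<T> z"
  using AE_fst_\<M>[OF rn_power_full_shift]
  by eventually_elim (auto simp: maharam_map_def skew_def split: prod.split)

lemma rn_power_measurable [measurable]: "rn_power \<mu> full_shift l \<in> borel_measurable bits"
proof -
  have "rn_power \<mu> full_shift l \<in> borel_measurable \<mu>" unfolding rn_power_def by measurable
  then show ?thesis by simp
qed

lemma maharam_map_measurable: "maharam_map \<mu> full_shift \<in> \<M> \<rightarrow>\<^sub>M \<M>"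
  unfolding measurable_\<M>_iff maharam_map_def by measurable

lemma nonsingular_maharam_map: "nonsingular \<M> (maharam_map \<mu> full_shift)"
proof -
  let ?S = "maharam_map \<mu> full_shift"
  define S' where "S' = (\<lambda>(x, y). (unshift x, y - ln (rn_power \<mu> full_shift 1 (unshift x))))"
  have S': "S' (?S z) = z" "?S (S' z) = z" for z
    by (cases z; simp add: S'_def maharam_map_def)+
  have bij: "bij ?S" by (rule bij_betw_byWitness[of _ S']) (auto simp: S')
  have "inv_into UNIV ?S = S'" by (rule inv_unique_comp) (auto simp: fun_eq_iff S')
  moreover have "S' \<in> \<M> \<rightarrow>\<^sub>M \<M>" unfolding measurable_\<M>_iff S'_def by measurable
  ultimately have "invertible_measurable \<M> ?S"
    using bij maharam_map_measurable by (simp add: invertible_measurable_def space_\<M>)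
  moreover have "distr \<M> \<M> ?S = distr \<M> \<M> \<T>"
    by (rule distr_cong_AE) (use maharam_map_AE maharam_map_measurable \<T>_measurable in auto)
  ultimately show ?thesis by (simp only: nonsingular_def distr_\<T> simp_thms)
qed

lemma ergodic_maharam_map: "ergodic \<M> (maharam_map \<mu> full_shift)"
  unfolding ergodic_def
proof (intro conjI nonsingular_maharam_map ballI impI)
  let ?S = "maharam_map \<mu> full_shift"
  fix A assume A: "A \<in> sets \<M>" and "null_eq \<M> (?S -` A \<inter> space \<M>) A"
  then have "AE z in \<M>. z \<in> ?S -` A \<inter> space \<M> \<longleftrightarrow> z \<in> A"
    using measurable_sets[OF maharam_map_measurable A] by (subst (asm) null_eq_iff_AE) auto
  then have "AE z in \<M>. \<T> z \<in> A \<longleftrightarrow> z \<in> A"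
    using maharam_map_AE by eventually_elim (simp add: space_\<M>)
  from \<T>_invariant_trivial[OF A this]
  show "null_eq \<M> A {} \<or> null_eq \<M> A (space \<M>)"
    using A sets.top[of \<M>] by (simp add: null_eq_iff_AE space_\<M>)
qed

lemma ergodic_full_shift: "ergodic \<mu> full_shift"
  unfolding ergodic_def
proof (intro conjI nonsingular_full_shift ballI impI)
  fix A assume "A \<in> sets \<mu>" and null: "null_eq \<mu> (full_shift -` A \<inter> space \<mu>) A"
  then have A: "A \<in> sets bits" by simp
  have "full_shift -` A \<in> sets bits" by (rule vimage_sets_bits[OF full_shift_measurable A])
  then have "AE w in \<mu>. full_shift w \<in> A \<longleftrightarrow> w \<in> A"
    using null A by (subst (asm) null_eq_iff_AE) auto
  from AE_fst_\<M>[OF this] have inv: "AE z in \<M>. \<T> z \<in> A \<times> UNIV \<longleftrightarrow> z \<in> A \<times> UNIV"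
    by eventually_elim (auto simp: skew_def split: prod.split)
  have zero: "emeasure \<mu> B = 0" if B: "B \<in> sets bits" and "AE z in \<M>. z \<notin> B \<times> UNIV" for B
  proof -
    have BU: "B \<times> UNIV \<in> sets \<M>" using B by (intro sets_\<M>_Times) auto
    then have "B \<times> UNIV \<in> null_sets \<M>" using that by (subst AE_iff_null_sets) auto
    then have "emeasure \<M> (B \<times> {0..}) = 0"
      using BU by (intro emeasure_eq_0[OF _ null_setsD1]) auto
    then show ?thesis using B by (subst (asm) emeasure_\<M>_Times) (auto simp: emeasure_exp_line_atLeast)
  qed
  have "A \<times> UNIV \<in> sets \<M>" using A by (intro sets_\<M>_Times) auto
  from \<T>_invariant_trivial[OF this inv]
  show "null_eq \<mu> A {} \<or> null_eq \<mu> A (space \<mu>)"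
  proof
    assume "AE z in \<M>. z \<notin> A \<times> UNIV"
    from zero[OF A this] show ?thesis using A by (auto simp: null_eq_def intro: null_setsI)
  next
    assume "AE z in \<M>. z \<in> A \<times> UNIV"
    then have "AE z in \<M>. z \<notin> (UNIV - A) \<times> UNIV" by eventually_elim auto
    moreover have "UNIV - A \<in> sets bits" using A by auto
    ultimately have "emeasure \<mu> (UNIV - A) = 0" "UNIV - A \<in> sets bits" by (auto intro: zero)
    then have "UNIV - A \<in> null_sets \<mu>" by (intro null_setsI) auto
    moreover have "sym_diff A (space \<mu>) = UNIV - A" by auto
    ultimately show ?thesis by (simp add: null_eq_def)
  qed
qed

end

theorem proposition4p3:
  fixes k n m :: "nat \<Rightarrow> nat" and p :: "int \<Rightarrow> real"
  assumes m0: "m 0 = 0"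
    and k_pos: "\<And>t. t \<ge> 1 \<Longrightarrow> k t \<ge> 1"
    and k_choice: "\<And>t. t \<ge> 1 \<Longrightarrow>
          measure (lam_measure (k t))
            {w \<in> space (lam_measure (k t)).
               (INF l\<in>{0..m (t - 1)}. rn_power (lam_measure (k t)) full_shift l w)
                 \<ge> exp (- (1 / 2 ^ t))}
          \<ge> 1 - 1 / 2 ^ t"
    and n_eq: "\<And>t. t \<ge> 1 \<Longrightarrow> n t = m (t - 1) + 2 ^ k t"
    and m_eq: "\<And>t. t \<ge> 1 \<Longrightarrow> m t = n t + 2 ^ n t"
    and p_neg: "\<And>j. j < 0 \<Longrightarrow> p j = 1 / 2"
    and p_block: "\<And>t j. t \<ge> 1 \<Longrightarrow> int (m (t - 1)) \<le> j \<Longrightarrow> j < int (n t) \<Longrightarrow>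
          p j = lam_prob (k t) (j - int (m (t - 1)))"
    and p_gap: "\<And>t j. t \<ge> 1 \<Longrightarrow> int (n t) \<le> j \<Longrightarrow> j < int (m t) \<Longrightarrow> p j = 1 / 2"
  shows "conservative (coin_product p) full_shift \<and>
         ergodic (coin_product p) full_shift \<and>
         type_III_1 (coin_product p) full_shift"
proof -
  interpret tent_blocks k n m p
    using assms by unfold_locales
  show ?thesis
    using conservative_full_shift ergodic_full_shift nonsingular_full_shift ergodic_maharam_map
    by (simp add: type_III_1_def)
qed

end
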